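(* For any $\theta_0\in(0,\pi)$ and any $\eta>0$ there exist a cone-shaped domain $\Omega\subset\mathbb{R}^2$ of opening angle $\theta_0$, an exponent $\alpha\in(0,1)$ and, for small $\varepsilon>0$, a solution $u_\varepsilon$ of $$-\Delta u_\varepsilon=\frac1{\varepsilon^2}u_\varepsilon(1-|u_\varepsilon|^2)\ \text{ in }\Omega,\qquad u_\varepsilon=g_\varepsilon\ \text{ on }\partial\Omega,$$ such that for small $\varepsilon>0$ one has $u_\varepsilon(P_\varepsilon)=0$ for a degree-one vortex point $P_\varepsilon\in\Omega$, and $$M_\varepsilon\le\Big(\frac{\theta_0}{2}+\eta\Big)|\log\varepsilon|\ \text{ for small }\varepsilon>0,\qquad \varepsilon^{\alpha}N_\varepsilon\to0\ \text{ as }\varepsilon\to0.$$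
   Context: A cone-shaped domain of opening angle $\theta_0$ is a bounded open planar cone (isosceles triangle) whose apex angle is $\theta_0$. A degree-one vortex point $P_\varepsilon$ of $u_\varepsilon$ is an isolated zero of $u_\varepsilon$ such that $u_\varepsilon/|u_\varepsilon|$ has winding number $1$ on small circles around $P_\varepsilon$. Here $g_\varepsilon:=u_\varepsilon|_{\partial\Omega}$, $\tau$ is the unit tangent on $\partial\Omega$ and $$N_\varepsilon=\int_{\partial\Omega}\frac12|\partial_\tau g_\varepsilon|^2+\frac1{4\varepsilon^2}(1-|g_\varepsilon|^2)^2\,d\mathcal{H}^1,\qquad M_\varepsilon=\int_\Omega\frac12|\nabla u_\varepsilon|^2+\frac1{4\varepsilon^2}(1-|u_\varepsilon|^2)^2\,dx.$$ *)

theory Defs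
  imports "HOL-Complex_Analysis.Complex_Analysis"
begin

section \<open>One-dimensional Hausdorff measure\<close>

definition hausdorff1_pre :: "real \<Rightarrow> 'a::metric_space set \<Rightarrow> ennreal" where
  "hausdorff1_pre \<delta> A =
     (INF U \<in> {U. A \<subseteq> (\<Union>i::nat. U i) \<and> (\<forall>i. bounded (U i) \<and> diameter (U i) \<le> \<delta>)}.
        \<Sum>i. ennreal (diameter (U i)))"

definition hausdorff1_outer :: "'a::metric_space set \<Rightarrow> ennreal" where
  "hausdorff1_outer A = (SUP \<delta>\<in>{0<..}. hausdorff1_pre \<delta> A)"

text \<open>The normalisation is the one for which the measure of a segment is its length.
  The term \<^const>\<open>measure_of\<close> denotes the null measure if the given set function is not countably
  additive; the lemma \<open>emeasure_hausdorff1\<close> below excludes this.\<close>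

definition hausdorff1 :: "'a::metric_space measure" where
  "hausdorff1 = measure_of UNIV (sets borel) hausdorff1_outer"

lemma hausdorff1_pre_le:
  assumes "A \<subseteq> (\<Union>i::nat. U i)" "\<And>i. bounded (U i)" "\<And>i. diameter (U i) \<le> \<delta>"
  shows "hausdorff1_pre \<delta> A \<le> (\<Sum>i. ennreal (diameter (U i)))"
  unfolding hausdorff1_pre_def by (rule INF_lower) (use assms in auto)

lemma hausdorff1_pre_mono: "A \<subseteq> B \<Longrightarrow> hausdorff1_pre \<delta> A \<le> hausdorff1_pre \<delta> B"
  unfolding hausdorff1_pre_def by (rule INF_superset_mono) auto

lemma hausdorff1_pre_antimono: "\<delta> \<le> \<delta>' \<Longrightarrow> hausdorff1_pre \<delta>' A \<le> hausdorff1_pre \<delta> A"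
  unfolding hausdorff1_pre_def by (rule INF_superset_mono) (auto intro: order_trans)

lemma hausdorff1_pre_close:
  "hausdorff1_pre \<delta> A < e \<Longrightarrow> \<exists>U::nat \<Rightarrow> 'a::metric_space set. A \<subseteq> (\<Union>i. U i) \<and>
     (\<forall>i. bounded (U i) \<and> diameter (U i) \<le> \<delta>) \<and> (\<Sum>i. ennreal (diameter (U i))) < e"
  unfolding hausdorff1_pre_def INF_less_iff by auto

lemma hausdorff1_pre_subadditive:
  fixes A :: "nat \<Rightarrow> 'a::metric_space set"
  shows "hausdorff1_pre \<delta> (\<Union>n. A n) \<le> (\<Sum>n. hausdorff1_pre \<delta> (A n))"
proof (rule ennreal_le_epsilon)
  fix e :: real assume e: "0 < e" and fin: "(\<Sum>n. hausdorff1_pre \<delta> (A n)) < top"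
  have *: "hausdorff1_pre \<delta> (A n) < hausdorff1_pre \<delta> (A n) + e * (1/2)^Suc n" for n
    using e fin by (auto simp add: less_top dest!: ennreal_suminf_lessD)
  have "\<forall>n. \<exists>U::nat \<Rightarrow> 'a set. A n \<subseteq> (\<Union>i. U i) \<and>
     (\<forall>i. bounded (U i) \<and> diameter (U i) \<le> \<delta>) \<and>
     (\<Sum>i. ennreal (diameter (U i))) < hausdorff1_pre \<delta> (A n) + e * (1/2)^Suc n"
    using hausdorff1_pre_close[OF *] by blast
  then obtain B :: "nat \<Rightarrow> nat \<Rightarrow> 'a set" where B: "\<And>n. A n \<subseteq> (\<Union>i. B n i)"
      "\<And>n i. bounded (B n i)" "\<And>n i. diameter (B n i) \<le> \<delta>"
      "\<And>n. (\<Sum>i. ennreal (diameter (B n i))) < hausdorff1_pre \<delta> (A n) + e * (1/2)^Suc n"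
    by metis
  define C where "C = case_prod B o prod_decode"
  have AC: "(\<Union>n. A n) \<subseteq> (\<Union>i. C i)"
    using B(1) by (auto simp add: C_def subset_eq) (metis prod.case prod_encode_inverse)
  have "hausdorff1_pre \<delta> (\<Union>n. A n) \<le> (\<Sum>i. ennreal (diameter (C i)))"
    by (rule hausdorff1_pre_le[OF AC]) (auto simp: C_def split_def B)
  also have "\<dots> = (\<Sum>n. \<Sum>i. ennreal (diameter (B n i)))"
    using suminf_ennreal_2dimen[of "\<lambda>n. \<Sum>i. ennreal (diameter (B n i))"
        "\<lambda>p. ennreal (diameter (case_prod B p))"]
    by (simp add: C_def)
  also have "\<dots> \<le> (\<Sum>n. hausdorff1_pre \<delta> (A n) + ennreal (e * (1/2) ^ Suc n))"
    by (intro suminf_le allI less_imp_le[OF B(4)]) auto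
  also have "\<dots> = (\<Sum>n. hausdorff1_pre \<delta> (A n)) + (\<Sum>n. ennreal e * ennreal ((1/2) ^ Suc n))"
    using e by (subst suminf_add[symmetric])
      (auto simp del: ennreal_suminf_cmult simp add: ennreal_mult[symmetric])
  also have "\<dots> = (\<Sum>n. hausdorff1_pre \<delta> (A n)) + e"
    unfolding ennreal_suminf_cmult
    by (subst suminf_ennreal_eq[OF zero_le_power power_half_series]) auto
  finally show "hausdorff1_pre \<delta> (\<Union>n. A n) \<le> (\<Sum>n. hausdorff1_pre \<delta> (A n)) + ennreal e" .
qed

lemma hausdorff1_outer_mono: "A \<subseteq> B \<Longrightarrow> hausdorff1_outer A \<le> hausdorff1_outer B"
  unfolding hausdorff1_outer_def by (intro SUP_mono') (rule hausdorff1_pre_mono)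

lemma hausdorff1_outer_empty: "hausdorff1_outer ({} :: 'a::metric_space set) = 0"
proof -
  have "hausdorff1_pre \<delta> ({} :: 'a set) \<le> 0" if "0 < \<delta>" for \<delta>
    using hausdorff1_pre_le[of "{}" "\<lambda>_. {} :: 'a set" \<delta>] that by simp
  then have "hausdorff1_outer ({} :: 'a set) \<le> 0"
    unfolding hausdorff1_outer_def by (intro SUP_least) auto
  then show ?thesis by simp
qed

lemma hausdorff1_outer_subadditive:
  "hausdorff1_outer (\<Union>n. A n) \<le> (\<Sum>n. hausdorff1_outer (A n))"
  unfolding hausdorff1_outer_def
proof (intro SUP_least order_trans[OF hausdorff1_pre_subadditive] suminf_le)
  fix \<delta> :: real and n assume "\<delta> \<in> {0<..}"
  then show "hausdorff1_pre \<delta> (A n) \<le> (SUP \<delta>\<in>{0<..}. hausdorff1_pre \<delta> (A n))"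
    by (rule SUP_upper)
qed auto

lemma hausdorff1_outer_space: "outer_measure_space UNIV hausdorff1_outer"
  unfolding outer_measure_space_def positive_def increasing_def countably_subadditive_def
  by (auto intro: hausdorff1_outer_mono hausdorff1_outer_subadditive simp: hausdorff1_outer_empty)

lemma hausdorff1_outer_Un: "hausdorff1_outer (A \<union> B) \<le> hausdorff1_outer A + hausdorff1_outer B"
proof -
  have "hausdorff1_outer (\<Union>n. if n = 0 then A else if n = Suc 0 then B else {})
      \<le> (\<Sum>n. hausdorff1_outer (if n = 0 then A else if n = Suc 0 then B else {}))"
    by (rule hausdorff1_outer_subadditive)
  also have "\<dots> = (\<Sum>n\<in>{0, Suc 0}. hausdorff1_outer (if n = 0 then A else if n = Suc 0 then B else {}))"
    by (rule suminf_finite) (auto simp: hausdorff1_outer_empty)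
  also have "\<dots> = hausdorff1_outer A + hausdorff1_outer B" by simp
  finally have *: "hausdorff1_outer (\<Union>n::nat. if n = 0 then A else if n = Suc 0 then B else {})
      \<le> hausdorff1_outer A + hausdorff1_outer B" .
  have "A \<union> B \<subseteq> (\<Union>n::nat. if n = 0 then A else if n = Suc 0 then B else {})"
    by (auto split: if_splits)
  from order_trans[OF hausdorff1_outer_mono[OF this] *] show ?thesis .
qed

lemma hausdorff1_pre_separated:
  fixes A B :: "'a::metric_space set"
  assumes sep: "\<And>x y. x \<in> A \<Longrightarrow> y \<in> B \<Longrightarrow> r \<le> dist x y" and \<delta>: "0 < \<delta>" "\<delta> < r"
  shows "hausdorff1_pre \<delta> A + hausdorff1_pre \<delta> B \<le> hausdorff1_pre \<delta> (A \<union> B)"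
  unfolding hausdorff1_pre_def[of \<delta> "A \<union> B"]
proof (safe intro!: INF_greatest)
  fix U :: "nat \<Rightarrow> 'a set"
  assume U: "A \<union> B \<subseteq> (\<Union>i. U i)" "\<forall>i. bounded (U i) \<and> diameter (U i) \<le> \<delta>"
  define V where "V S i = (if U i \<inter> S = {} then {} else U i)" for S i
  have le: "hausdorff1_pre \<delta> S \<le> (\<Sum>i. ennreal (diameter (V S i)))" if "S \<subseteq> A \<union> B" for S
  proof (rule hausdorff1_pre_le)
    show "S \<subseteq> (\<Union>i. V S i)"
    proof
      fix x assume x: "x \<in> S"
      with that U(1) obtain i where "x \<in> U i" by blast
      with x have "x \<in> V S i" by (auto simp: V_def)
      then show "x \<in> (\<Union>i. V S i)" by blast
    qed
  qed (use U(2) \<delta> in \<open>auto simp: V_def\<close>)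
  have VV: "ennreal (diameter (V A i)) + ennreal (diameter (V B i)) \<le> ennreal (diameter (U i))" for i
  proof (cases "U i \<inter> A = {} \<or> U i \<inter> B = {}")
    case True
    then show ?thesis by (auto simp: V_def)
  next
    case False
    then obtain x y where xy: "x \<in> U i" "x \<in> A" "y \<in> U i" "y \<in> B" by blast
    have "dist x y \<le> diameter (U i)" using U(2) xy by (intro diameter_bounded_bound) auto
    moreover have "diameter (U i) \<le> \<delta>" using U(2) by auto
    ultimately show ?thesis using sep[OF xy(2,4)] \<delta> by simp
  qed
  have "hausdorff1_pre \<delta> A + hausdorff1_pre \<delta> B
      \<le> (\<Sum>i. ennreal (diameter (V A i))) + (\<Sum>i. ennreal (diameter (V B i)))"
    by (intro add_mono le) auto
  also have "\<dots> = (\<Sum>i. ennreal (diameter (V A i)) + ennreal (diameter (V B i)))"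
    by (rule suminf_add) auto
  also have "\<dots> \<le> (\<Sum>i. ennreal (diameter (U i)))"
    by (intro suminf_le VV) auto
  finally show "hausdorff1_pre \<delta> A + hausdorff1_pre \<delta> B \<le> (\<Sum>i. ennreal (diameter (U i)))" .
qed

lemma hausdorff1_outer_separated:
  fixes A B :: "'a::metric_space set"
  assumes sep: "\<And>x y. x \<in> A \<Longrightarrow> y \<in> B \<Longrightarrow> r \<le> dist x y" and r: "0 < r"
  shows "hausdorff1_outer A + hausdorff1_outer B \<le> hausdorff1_outer (A \<union> B)"
proof -
  have 1: "hausdorff1_pre \<delta>1 A + hausdorff1_pre \<delta>2 B \<le> hausdorff1_outer (A \<union> B)"
    if "0 < \<delta>1" "0 < \<delta>2" for \<delta>1 \<delta>2
  proof -
    define \<delta> where "\<delta> = min (min \<delta>1 \<delta>2) (r/2)"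
    have \<delta>: "0 < \<delta>" "\<delta> < r" "\<delta> \<le> \<delta>1" "\<delta> \<le> \<delta>2" using that r by (auto simp: \<delta>_def)
    have "hausdorff1_pre \<delta>1 A + hausdorff1_pre \<delta>2 B \<le> hausdorff1_pre \<delta> A + hausdorff1_pre \<delta> B"
      by (intro add_mono hausdorff1_pre_antimono \<delta>)
    also have "\<dots> \<le> hausdorff1_pre \<delta> (A \<union> B)"
      by (rule hausdorff1_pre_separated[OF sep \<delta>(1,2)])
    also have "\<dots> \<le> hausdorff1_outer (A \<union> B)"
      unfolding hausdorff1_outer_def by (rule SUP_upper) (use \<delta> in auto)
    finally show ?thesis .
  qed
  have ne: "{0<..} \<noteq> ({} :: real set)" by auto
  have 2: "hausdorff1_outer A + hausdorff1_pre \<delta>2 B \<le> hausdorff1_outer (A \<union> B)" if "0 < \<delta>2" for \<delta>2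
  proof -
    have "hausdorff1_outer A + hausdorff1_pre \<delta>2 B
        = (SUP \<delta>1\<in>{0<..}. hausdorff1_pre \<delta>1 A + hausdorff1_pre \<delta>2 B)"
      unfolding hausdorff1_outer_def by (rule ennreal_SUP_add_left[OF ne, symmetric])
    also have "\<dots> \<le> hausdorff1_outer (A \<union> B)" by (intro SUP_least 1) (use that in auto)
    finally show ?thesis .
  qed
  have "hausdorff1_outer A + hausdorff1_outer B
      = (SUP \<delta>2\<in>{0<..}. hausdorff1_outer A + hausdorff1_pre \<delta>2 B)"
    unfolding hausdorff1_outer_def[of B] by (rule ennreal_SUP_add_right[OF ne])
  also have "\<dots> \<le> hausdorff1_outer (A \<union> B)" by (intro SUP_least 2) auto
  finally show ?thesis .
qed

lemma hausdorff1_outer_closed_split: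
  fixes C E :: "'a::metric_space set"
  assumes C: "closed C" and Cne: "C \<noteq> {}"
  shows "hausdorff1_outer (E \<inter> C) + hausdorff1_outer (E - C) \<le> hausdorff1_outer E"
proof (cases "hausdorff1_outer E = top")
  case True
  then show ?thesis by simp
next
  case False
  define F where "F n = {x \<in> E. inverse (real (Suc n)) \<le> infdist x C}" for n
  define R where "R n = F (Suc n) - F n" for n
  have lip: "infdist x C \<le> infdist y C + dist x y" for x y
    by (rule infdist_triangle)
  have inv_mono: "inverse (real (Suc n)) \<le> inverse (real (Suc m))" if "m \<le> n" for m n
    using that by (simp add: field_simps)
  have chain: "(\<Sum>i<m. hausdorff1_outer (R (2*i + p))) \<le> hausdorff1_outer (\<Union>i<m. R (2*i + p))"
    for m p
  proof (induction m)
    case 0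
    then show ?case by (simp add: hausdorff1_outer_empty)
  next
    case (Suc m)
    define a where "a = inverse (real (Suc (2*m + p)))"
    show ?case
    proof (cases m)
      case 0
      then show ?thesis by (simp add: lessThan_Suc)
    next
      case (Suc k)
      define c where "c = inverse (real (Suc (Suc (2*k + p))))"
      have ac: "a < c" unfolding a_def c_def Suc by (simp add: field_simps)
      have low': "c \<le> infdist x C" if x: "x \<in> (\<Union>i<m. R (2*i + p))" for x
      proof -
        from x obtain i where i: "i < m" "x \<in> F (Suc (2*i + p))" by (auto simp: R_def)
        then have "inverse (real (Suc (Suc (2*i + p)))) \<le> infdist x C" by (simp add: F_def)
        moreover have "Suc (2*i + p) \<le> Suc (2*k + p)" using i Suc by simp
        ultimately show ?thesis using inv_mono unfolding c_def by (meson order_trans)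
      qed
      have up: "infdist y C < a" if "y \<in> R (2*m + p)" for y
        using that by (auto simp: R_def F_def a_def)
      have "(\<Sum>i<Suc m. hausdorff1_outer (R (2*i + p)))
          \<le> hausdorff1_outer (\<Union>i<m. R (2*i + p)) + hausdorff1_outer (R (2*m + p))"
        using Suc.IH by (simp add: add_right_mono)
      also have "\<dots> \<le> hausdorff1_outer ((\<Union>i<m. R (2*i + p)) \<union> R (2*m + p))"
      proof (rule hausdorff1_outer_separated)
        fix x y assume "x \<in> (\<Union>i<m. R (2*i + p))" "y \<in> R (2*m + p)"
        then show "c - a \<le> dist x y" using low'[of x] up[of y] lip[of x y] by linarith
      qed (use ac in simp)
      also have "(\<Union>i<m. R (2*i + p)) \<union> R (2*m + p) = (\<Union>i<Suc m. R (2*i + p))"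
        by (auto simp: lessThan_Suc)
      finally show ?thesis .
    qed
  qed
  have RE: "(\<Union>i<m. R (2*i + p)) \<subseteq> E" for m p by (auto simp: R_def F_def)
  have half: "(\<Sum>i. hausdorff1_outer (R (2*i + p))) \<le> hausdorff1_outer E" for p
    by (intro suminf_le_const summableI order_trans[OF chain] hausdorff1_outer_mono RE)
  have tot: "(\<Sum>i<n. hausdorff1_outer (R i)) \<le> hausdorff1_outer E + hausdorff1_outer E" for n
  proof -
    have "(\<Sum>i<n. hausdorff1_outer (R i)) \<le> (\<Sum>i<2*n. hausdorff1_outer (R i))"
      by (rule sum_mono2) auto
    also have "\<dots> = (\<Sum>i<n. hausdorff1_outer (R (2*i + 0))) + (\<Sum>i<n. hausdorff1_outer (R (2*i + 1)))"
      by (induction n) (simp_all add: algebra_simps)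
    also have "\<dots> \<le> hausdorff1_outer E + hausdorff1_outer E"
      by (intro add_mono order_trans[OF chain] hausdorff1_outer_mono RE)
    finally show ?thesis .
  qed
  have sum_fin: "(\<Sum>i. hausdorff1_outer (R i)) \<noteq> top"
  proof -
    have "(\<Sum>i. hausdorff1_outer (R i)) \<le> hausdorff1_outer E + hausdorff1_outer E"
      by (intro suminf_le_const summableI tot)
    also have "\<dots> < top" using False by (simp add: less_top)
    finally show ?thesis by simp
  qed
  have FC: "hausdorff1_outer (E \<inter> C) + hausdorff1_outer (F n) \<le> hausdorff1_outer E" for n
  proof -
    have "hausdorff1_outer (E \<inter> C) + hausdorff1_outer (F n) \<le> hausdorff1_outer ((E \<inter> C) \<union> F n)"
    proof (rule hausdorff1_outer_separated)
      fix x y assume "x \<in> E \<inter> C" "y \<in> F n"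
      then show "inverse (real (Suc n)) \<le> dist x y"
        using infdist_le[of x C y] by (auto simp: F_def dist_commute)
    qed simp
    also have "\<dots> \<le> hausdorff1_outer E"
      by (rule hausdorff1_outer_mono) (auto simp: F_def)
    finally show ?thesis .
  qed
  have cover: "E - C \<subseteq> F n \<union> (\<Union>i. R (i + n))" for n
  proof
    fix x assume x: "x \<in> E - C"
    then have "0 < infdist x C"
      using C Cne by (metis DiffD2 in_closed_iff_infdist_zero infdist_nonneg less_eq_real_def)
    then obtain m where m: "inverse (real (Suc m)) < infdist x C"
      using reals_Archimedean by blast
    then have ex: "x \<in> F m" using x by (simp add: F_def)
    define k where "k = (LEAST k. x \<in> F k)"
    have k: "x \<in> F k" unfolding k_def by (rule LeastI[of _ m]) (rule ex)
    have kmin: "x \<notin> F j" if "j < k" for j using that not_less_Least unfolding k_def by blast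
    show "x \<in> F n \<union> (\<Union>i. R (i + n))"
    proof (cases "k \<le> n")
      case True
      have "x \<in> F n" using k order_trans[OF inv_mono[OF True]] unfolding F_def by blast
      then show ?thesis by blast
    next
      case False
      then obtain i where i: "k = Suc (i + n)"
        by (metis add.commute less_imp_Suc_add not_le)
      then have "x \<in> R (i + n)" using k kmin[of "i + n"] by (simp add: R_def)
      then show ?thesis by blast
    qed
  qed
  have bound: "hausdorff1_outer (E \<inter> C) + hausdorff1_outer (E - C)
      \<le> hausdorff1_outer E + (\<Sum>i. hausdorff1_outer (R (i + n)))" for n
  proof -
    have "hausdorff1_outer (E - C) \<le> hausdorff1_outer (F n \<union> (\<Union>i. R (i + n)))"
      by (rule hausdorff1_outer_mono[OF cover])
    also have "\<dots> \<le> hausdorff1_outer (F n) + hausdorff1_outer (\<Union>i. R (i + n))"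
      by (rule hausdorff1_outer_Un)
    also have "\<dots> \<le> hausdorff1_outer (F n) + (\<Sum>i. hausdorff1_outer (R (i + n)))"
      by (intro add_left_mono hausdorff1_outer_subadditive)
    finally have "hausdorff1_outer (E \<inter> C) + hausdorff1_outer (E - C)
        \<le> hausdorff1_outer (E \<inter> C) + (hausdorff1_outer (F n) + (\<Sum>i. hausdorff1_outer (R (i + n))))"
      by (rule add_left_mono)
    also have "\<dots> \<le> hausdorff1_outer E + (\<Sum>i. hausdorff1_outer (R (i + n)))"
      using FC[of n] by (metis add.assoc add_right_mono)
    finally show ?thesis .
  qed
  have tail: "(\<lambda>n. \<Sum>i. hausdorff1_outer (R (i + n))) \<longlonglongrightarrow> 0"
  proof -
    have fin: "hausdorff1_outer (R i) \<noteq> top" for i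
      using sum_fin ennreal_suminf_lessD[of "\<lambda>i. hausdorff1_outer (R i)" top i]
      by (auto simp: less_top)
    define a where "a i = enn2real (hausdorff1_outer (R i))" for i
    have a: "hausdorff1_outer (R i) = ennreal (a i)" "0 \<le> a i" for i
      using fin[of i] by (auto simp: a_def less_top)
    have suma: "summable a"
      by (rule summable_suminf_not_top) (use sum_fin a in auto)
    have "(\<lambda>n. ennreal (\<Sum>i. a (i + n))) \<longlonglongrightarrow> ennreal 0"
      by (intro tendsto_ennrealI suminf_exist_split2 suma)
    moreover have "ennreal (\<Sum>i. a (i + n)) = (\<Sum>i. hausdorff1_outer (R (i + n)))" for n
      unfolding a(1) by (rule suminf_ennreal2[symmetric]) (use a suma in \<open>auto simp: summable_iff_shift\<close>)
    ultimately show ?thesis by simp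
  qed
  have "(\<lambda>n. hausdorff1_outer E + (\<Sum>i. hausdorff1_outer (R (i + n)))) \<longlonglongrightarrow> hausdorff1_outer E + 0"
    by (intro tendsto_add tendsto_const tail)
  then have "hausdorff1_outer (E \<inter> C) + hausdorff1_outer (E - C) \<le> hausdorff1_outer E + 0"
    by (rule LIMSEQ_le_const) (use bound in blast)
  then show ?thesis by simp
qed

lemma borel_lambda_system_hausdorff1:
  "sets (borel :: 'a::metric_space measure) \<subseteq> lambda_system UNIV UNIV hausdorff1_outer"
proof -
  interpret S: sigma_algebra UNIV "UNIV :: 'a set set"
    using sigma_algebra_Pow[of "UNIV :: 'a set"] by simp
  have ms: "measure_space UNIV (lambda_system UNIV UNIV hausdorff1_outer)
      (hausdorff1_outer :: 'a set \<Rightarrow> ennreal)"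
    by (rule S.caratheodory_lemma[OF hausdorff1_outer_space])
  then interpret L: sigma_algebra UNIV
      "lambda_system UNIV UNIV (hausdorff1_outer :: 'a set \<Rightarrow> ennreal)"
    by (simp add: measure_space_def)
  have "C \<in> lambda_system UNIV UNIV hausdorff1_outer" if C: "closed C" for C :: "'a set"
    unfolding S.lambda_system_eq
  proof (intro CollectI conjI ballI UNIV_I antisym)
    fix E :: "'a set"
    show "hausdorff1_outer (E \<inter> C) + hausdorff1_outer (E - C) \<le> hausdorff1_outer E"
      by (cases "C = {}")
         (auto simp: hausdorff1_outer_empty intro: hausdorff1_outer_closed_split[OF C])
    have "E = (E \<inter> C) \<union> (E - C)" by blast
    then show "hausdorff1_outer E \<le> hausdorff1_outer (E \<inter> C) + hausdorff1_outer (E - C)"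
      using hausdorff1_outer_Un by metis
  qed
  then show ?thesis
    unfolding borel_eq_closed by (subst sets_measure_of) (auto intro!: L.sigma_sets_subset)
qed

lemma space_hausdorff1 [simp]: "space hausdorff1 = UNIV"
  by (simp add: hausdorff1_def)

lemma sets_hausdorff1 [simp, measurable_cong]: "sets hausdorff1 = sets borel"
  by (simp add: hausdorff1_def sets.sigma_sets_eq[of borel, simplified])

lemma emeasure_hausdorff1:
  assumes "A \<in> sets borel"
  shows "emeasure hausdorff1 A = hausdorff1_outer (A :: 'a::metric_space set)"
proof -
  interpret S: sigma_algebra UNIV "UNIV :: 'a set set"
    using sigma_algebra_Pow[of "UNIV :: 'a set"] by simp
  have ms: "measure_space UNIV (lambda_system UNIV UNIV hausdorff1_outer)
      (hausdorff1_outer :: 'a set \<Rightarrow> ennreal)"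
    by (rule S.caratheodory_lemma[OF hausdorff1_outer_space])
  show ?thesis
    unfolding hausdorff1_def
  proof (rule emeasure_measure_of_sigma)
    show "sigma_algebra UNIV (sets borel :: 'a set set)"
      using sets.sigma_algebra_axioms[of borel] by simp
    show "positive (sets borel :: 'a set set) hausdorff1_outer"
      by (simp add: positive_def hausdorff1_outer_empty)
    show "countably_additive (sets borel :: 'a set set) hausdorff1_outer"
      using ms borel_lambda_system_hausdorff1
      unfolding measure_space_def countably_additive_def by blast
  qed (use assms in auto)
qed


section \<open>Planar Ginzburg--Landau equation\<close>

text \<open>The plane and the target of the order parameter are both identified with the complex
  numbers; their Lebesgue measure, norm and \<^const>\<open>Basis\<close> are those of the Euclidean plane.\<close>

definition pderiv_along :: "'a \<Rightarrow> ('a::euclidean_space \<Rightarrow> 'b::real_normed_vector) \<Rightarrow> 'a \<Rightarrow> 'b" where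
  "pderiv_along b u x = vector_derivative (\<lambda>t. u (x + t *\<^sub>R b)) (at 0)"

definition C1_on :: "'a::euclidean_space set \<Rightarrow> ('a \<Rightarrow> 'b::real_normed_vector) \<Rightarrow> bool" where
  "C1_on S u \<longleftrightarrow> (\<forall>b\<in>Basis. (\<forall>x\<in>S. (\<lambda>t. u (x + t *\<^sub>R b)) differentiable (at 0)) \<and>
     continuous_on S (pderiv_along b u))"

definition C2_on :: "'a::euclidean_space set \<Rightarrow> ('a \<Rightarrow> 'b::real_normed_vector) \<Rightarrow> bool" where
  "C2_on S u \<longleftrightarrow> C1_on S u \<and> (\<forall>b\<in>Basis. C1_on S (pderiv_along b u))"

definition laplacian :: "('a::euclidean_space \<Rightarrow> 'b::real_normed_vector) \<Rightarrow> 'a \<Rightarrow> 'b" where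
  "laplacian u x = (\<Sum>b\<in>Basis. pderiv_along b (pderiv_along b u) x)"

definition grad_norm_sq :: "('a::euclidean_space \<Rightarrow> 'b::real_normed_vector) \<Rightarrow> 'a \<Rightarrow> real" where
  "grad_norm_sq u x = (\<Sum>b\<in>Basis. (norm (pderiv_along b u x))\<^sup>2)"

text \<open>A point of a polygonal curve has a unit tangent in this sense iff it is not a corner, and
  then the tangent is unique up to its sign.\<close>

definition unit_tangent :: "complex set \<Rightarrow> complex \<Rightarrow> complex \<Rightarrow> bool" where
  "unit_tangent \<Gamma> x \<tau> \<longleftrightarrow> norm \<tau> = 1 \<and> (\<forall>\<^sub>F t in nhds (0::real). x + t *\<^sub>R \<tau> \<in> \<Gamma>)"

text \<open>Only the norm of the following derivative is used. It does not depend on the choice of the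
  sign of the tangent. The value at corners is irrelevant, since corners are null sets.\<close>

definition tangential_deriv :: "complex set \<Rightarrow> (complex \<Rightarrow> complex) \<Rightarrow> complex \<Rightarrow> complex" where
  "tangential_deriv \<Gamma> g x = pderiv_along (SOME \<tau>. unit_tangent \<Gamma> x \<tau>) g x"

definition tangentially_differentiable_on :: "complex set \<Rightarrow> (complex \<Rightarrow> complex) \<Rightarrow> bool" where
  "tangentially_differentiable_on \<Gamma> g \<longleftrightarrow>
     (\<forall>x\<in>\<Gamma>. \<forall>\<tau>. unit_tangent \<Gamma> x \<tau> \<longrightarrow> (\<lambda>t. g (x + t *\<^sub>R \<tau>)) differentiable (at (0::real)))"

text \<open>Classical solutions, continuous up to the boundary. If the boundary energy below is finite,
  a continuous tangentially differentiable \<open>g\<close> is absolutely continuous on each edge, so that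
  its tangential derivative is also the weak one.\<close>

definition GL_solution ::
    "real \<Rightarrow> complex set \<Rightarrow> (complex \<Rightarrow> complex) \<Rightarrow> (complex \<Rightarrow> complex) \<Rightarrow> bool" where
  "GL_solution \<epsilon> \<Omega> g u \<longleftrightarrow>
     C2_on \<Omega> u \<and> continuous_on (closure \<Omega>) u \<and>
     (\<forall>x\<in>\<Omega>. - laplacian u x = (1 / \<epsilon>\<^sup>2) *\<^sub>R ((1 - (norm (u x))\<^sup>2) *\<^sub>R u x)) \<and>
     (\<forall>x\<in>frontier \<Omega>. u x = g x) \<and> tangentially_differentiable_on (frontier \<Omega>) g"

definition GL_energy :: "real \<Rightarrow> complex set \<Rightarrow> (complex \<Rightarrow> complex) \<Rightarrow> ennreal" where
  "GL_energy \<epsilon> \<Omega> u =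
     (\<integral>\<^sup>+x\<in>\<Omega>. ennreal (1/2 * grad_norm_sq u x + 1 / (4 * \<epsilon>\<^sup>2) * (1 - (norm (u x))\<^sup>2)\<^sup>2) \<partial>lborel)"

definition GL_boundary_energy :: "real \<Rightarrow> complex set \<Rightarrow> (complex \<Rightarrow> complex) \<Rightarrow> ennreal" where
  "GL_boundary_energy \<epsilon> \<Omega> g =
     (\<integral>\<^sup>+x\<in>frontier \<Omega>. ennreal (1/2 * (norm (tangential_deriv (frontier \<Omega>) g x))\<^sup>2
         + 1 / (4 * \<epsilon>\<^sup>2) * (1 - (norm (g x))\<^sup>2)\<^sup>2) \<partial>hausdorff1)"

definition degree_one_vortex :: "complex set \<Rightarrow> (complex \<Rightarrow> complex) \<Rightarrow> complex \<Rightarrow> bool" where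
  "degree_one_vortex \<Omega> u P \<longleftrightarrow> P \<in> \<Omega> \<and> u P = 0 \<and>
     (\<exists>r0>0. ball P r0 \<subseteq> \<Omega> \<and> (\<forall>x\<in>ball P r0 - {P}. u x \<noteq> 0) \<and>
       (\<forall>r\<in>{0<..<r0}.
          winding_number (\<lambda>t. u (circlepath P r t) / of_real (norm (u (circlepath P r t)))) 0 = 1))"

definition apex_angle :: "complex \<Rightarrow> complex \<Rightarrow> complex \<Rightarrow> real" where
  "apex_angle A B C = arccos ((B - A) \<bullet> (C - A) / (norm (B - A) * norm (C - A)))"

definition cone_domain :: "real \<Rightarrow> complex set \<Rightarrow> bool" where
  "cone_domain \<theta> \<Omega> \<longleftrightarrow> (\<exists>A B C. A \<noteq> B \<and> dist A B = dist A C \<and> apex_angle A B C = \<theta> \<and>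
     \<Omega> = interior (convex hull {A, B, C}))"

end

theory Submission
  imports Defs
begin

text \<open>
  The solution is the radial vortex of degree one of the whole plane, rescaled to length \<open>\<epsilon>\<close> and
  centred on the axis of the cone at distance \<open>\<rho> = \<epsilon> powr \<beta>\<close> from the apex, with \<open>\<beta> < 1\<close> close to \<open>1\<close>.
  All functions are defined on the whole plane, and the boundary datum is the vortex itself.

  The energy density of the vortex is about \<open>1 / (2 r\<^sup>2)\<close> at distance \<open>r > \<epsilon>\<close> from the centre. Up to the
  distance \<open>\<rho>\<close> the vortex sees at most a full disc, which costs \<open>\<pi> (1 - \<beta>) \<bar>ln \<epsilon>\<bar>\<close>. Beyond that scale it
  looks like a vortex at the apex, of which the cone only contains the angle \<open>\<theta>\<close>; this costs
  \<open>\<theta> / 2\<close> times \<open>\<beta> \<bar>ln \<epsilon>\<bar>\<close>. The sum is below \<open>(\<theta> / 2 + \<eta>) \<bar>ln \<epsilon>\<bar>\<close> once \<open>\<beta>\<close> is close to \<open>1\<close>. On the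
  boundary, which stays at distance comparable to \<open>\<rho> + \<bar>z\<bar>\<close> from the centre, the density is of order
  \<open>1 / (\<rho>\<^sup>2 + \<bar>z\<bar>\<^sup>2)\<close>, so the boundary energy is of order \<open>1 / \<rho> = \<epsilon> powr (- \<beta>)\<close>, and any
  \<open>\<alpha>\<close> between \<open>\<beta>\<close> and \<open>1\<close> will do.

  The vortex is \<open>U z = q (\<bar>z\<bar>\<^sup>2) z\<close>. In the variable \<open>t = \<bar>z\<bar>\<^sup>2\<close> the Ginzburg--Landau equation becomes
  \<open>4 (t q'' + 2 q') + q (1 - t q\<^sup>2) = 0\<close> on \<open>t \<ge> 0\<close>, and smoothness of \<open>U\<close> at its zero is just smoothness
  of \<open>q\<close> at \<open>0\<close>. The explicit functions \<open>1 / sqrt (t + 4)\<close> and \<open>1 / sqrt (t + 1)\<close> are a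
  subsolution and a supersolution, and a monotone iteration between them produces \<open>q\<close>
  (\<open>fixed_point_of_green\<close>, \<open>vortex_profile_exists\<close>). Since both barriers are asymptotic to \<open>1 / r\<close> with
  error \<open>O (1 / r\<^sup>3)\<close>, they give at once the decay of the potential term, and an interpolation argument
  gives that of the radial derivative (\<open>radial_derivative_decay\<close>). What remains is the evaluation of
  explicit integrals: by Fubini in Cartesian coordinates over the triangle
  (\<open>cone_energy_bound\<close>) and by dyadic annuli on its boundary
  (\<open>nn_integral_linear_growth_le\<close>).
\<close>

section \<open>Monotone iteration for the vortex profile\<close>

text \<open>The modulus \<open>r / sqrt (r\<^sup>2 + c)\<close> of a model vortex, divided by \<open>r\<close>, in the variable \<open>t = r\<^sup>2\<close>.\<close>

definition barrier :: "real \<Rightarrow> real \<Rightarrow> real" where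
  "barrier c t = 1 / sqrt (t + c)"

text \<open>Adding \<open>(4 + t) q\<close> to both sides of \<open>- 4 (t q'' + 2 q') = q (1 - t q\<^sup>2)\<close> makes the right-hand side
  \<open>(5 + t - t q\<^sup>2) q\<close> increasing in \<open>q\<close> as long as \<open>t q\<^sup>2 \<le> 1\<close>. The coefficient \<open>4 + t\<close> is chosen because
  then \<open>exp (t / 2)\<close> solves the homogeneous equation, and the operator factorises:
  \<open>(t\<^sup>2 e\<^sup>t (e\<^sup>-\<^sup>t\<^sup>/\<^sup>2 q)')' = - source t (q t)\<close> is the differential equation. Two integrations,
  with no contribution from \<open>0\<close> and from infinity, give \<open>exp (- t / 2) * q t = green q t\<close>.\<close>

definition source :: "real \<Rightarrow> real \<Rightarrow> real" where
  "source x y = x / 4 * exp (x / 2) * ((5 + x - x * y\<^sup>2) * y)"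

definition green :: "(real \<Rightarrow> real) \<Rightarrow> real \<Rightarrow> ennreal" where
  "green q t = (\<integral>\<^sup>+s. (ennreal (exp (- s) / s\<^sup>2) *
     (\<integral>\<^sup>+x. ennreal (source x (q x)) * indicator {0..s} x \<partial>lborel)) * indicator {t..} s \<partial>lborel)"

lemma source_mono:
  assumes "0 \<le> x" "0 \<le> y" "y \<le> z" "x * z\<^sup>2 \<le> 1"
  shows "source x y \<le> source x z"
proof -
  have "x * y * y \<le> x * z * z" "x * y * z \<le> x * z * z"
    using assms by (intro mult_mono mult_left_mono; simp)+
  then have "0 \<le> 5 + x - x * (z\<^sup>2 + z * y + y\<^sup>2)"
    using assms by (simp add: power2_eq_square algebra_simps)
  then have "0 \<le> (z - y) * (5 + x - x * (z\<^sup>2 + z * y + y\<^sup>2))"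
    using assms by simp
  also have "\<dots> = (5 + x - x * z\<^sup>2) * z - (5 + x - x * y\<^sup>2) * y"
    by (simp add: algebra_simps power2_eq_square)
  finally show ?thesis unfolding source_def using assms by (intro mult_left_mono) auto
qed

lemma source_nonneg:
  assumes "0 \<le> x" "0 \<le> y" "x * y\<^sup>2 \<le> 1"
  shows "0 \<le> source x y"
  using assms unfolding source_def by auto

lemma barrier_pos: "0 \<le> t \<Longrightarrow> 0 < c \<Longrightarrow> 0 < barrier c t"
  by (simp add: barrier_def)

lemma barrier_sq: "0 \<le> t \<Longrightarrow> 0 < c \<Longrightarrow> (barrier c t)\<^sup>2 = 1 / (t + c)"
  by (simp add: barrier_def power_divide)

lemma barrier_sq_le: "0 \<le> t \<Longrightarrow> 0 < c \<Longrightarrow> t * (barrier c t)\<^sup>2 \<le> 1"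
  by (simp add: barrier_sq)

lemma barrier_antimono: "0 \<le> t \<Longrightarrow> 0 < c \<Longrightarrow> c \<le> d \<Longrightarrow> barrier d t \<le> barrier c t"
  by (simp add: barrier_def frac_le)

lemma barrier_deriv:
  "0 \<le> t \<Longrightarrow> 0 < c \<Longrightarrow> (barrier c has_real_derivative (- ((barrier c t) ^ 3 / 2))) (at t)"
  unfolding barrier_def
  by (auto intro!: derivative_eq_intros simp: field_simps power2_eq_square power3_eq_cube)

lemma barrier_le_of_between:
  assumes "0 \<le> t" "0 \<le> y" "y \<le> barrier 1 t"
  shows "t * y\<^sup>2 \<le> 1"
proof -
  have "t * y\<^sup>2 \<le> t * (barrier 1 t)\<^sup>2" using assms by (intro mult_left_mono power_mono) auto
  also have "\<dots> \<le> 1" using assms by (intro barrier_sq_le) auto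
  finally show ?thesis .
qed

text \<open>The function \<open>- s\<^sup>2 e\<^sup>s (e\<^sup>-\<^sup>s\<^sup>/\<^sup>2 q)'\<close> for \<open>q = barrier c\<close>. Comparing its derivative with the source
  decides whether the barrier is a subsolution or a supersolution.\<close>

definition flux :: "real \<Rightarrow> real \<Rightarrow> real" where
  "flux c s = s\<^sup>2 * exp (s / 2) * (barrier c s + (barrier c s) ^ 3) / 2"

definition flux_deriv :: "real \<Rightarrow> real \<Rightarrow> real" where
  "flux_deriv c s = exp (s / 2) * ((2 * s + s\<^sup>2 / 2) * (barrier c s + (barrier c s) ^ 3)
     - s\<^sup>2 / 2 * ((barrier c s) ^ 3 + 3 * (barrier c s) ^ 5)) / 2"

lemma flux_has_derivative:
  "0 \<le> s \<Longrightarrow> 0 < c \<Longrightarrow> (flux c has_real_derivative flux_deriv c s) (at s)"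
  unfolding flux_def flux_deriv_def
  using barrier_deriv[of s c]
  by (auto intro!: derivative_eq_intros simp: field_simps power2_eq_square power3_eq_cube numeral_eq_Suc)

lemma flux_deriv_nonneg:
  assumes "0 \<le> s" "0 < c"
  shows "0 \<le> flux_deriv c s"
proof -
  define y where "y = barrier c s"
  have y: "0 < y" "s * y\<^sup>2 \<le> 1" unfolding y_def using assms barrier_pos barrier_sq_le by auto
  have "s * y * (s * y\<^sup>2) \<le> s * y * 1" "s * y ^ 3 * (s * y\<^sup>2) \<le> s * y ^ 3 * 1"
    using y assms by (intro mult_left_mono; simp)+
  then have "s\<^sup>2 * y ^ 3 \<le> s * y" "s\<^sup>2 * y ^ 5 \<le> s * y ^ 3"
    by (simp_all add: algebra_simps power2_eq_square numeral_eq_Suc)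
  moreover have "0 \<le> s * y" "0 \<le> s * y ^ 3" "0 \<le> s\<^sup>2 * y" "0 \<le> s\<^sup>2 * y ^ 3" using y assms by auto
  moreover have "(2 * s + s\<^sup>2 / 2) * (y + y ^ 3) - s\<^sup>2 / 2 * (y ^ 3 + 3 * y ^ 5)
      = 2 * (s * y) + 2 * (s * y ^ 3) + (s\<^sup>2 * y) / 2 - 3 / 2 * (s\<^sup>2 * y ^ 5)"
    by (simp add: algebra_simps)
  ultimately have "0 \<le> (2 * s + s\<^sup>2 / 2) * (y + y ^ 3) - s\<^sup>2 / 2 * (y ^ 3 + 3 * y ^ 5)"
    by linarith
  then show ?thesis unfolding flux_deriv_def y_def by simp
qed

text \<open>The correction is \<open>- s / 4 * exp (s / 2)\<close> times the residual of the barrier in the profile equation;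
  the last factor of the correction is \<open>- 3 s\<close> for \<open>c = 4\<close> and \<open>3\<close> for \<open>c = 1\<close>, which explains the two choices of \<open>c\<close>.\<close>

lemma flux_deriv_eq:
  assumes "0 \<le> s" "0 < c"
  shows "flux_deriv c s = source s (barrier c s)
     + s / 4 * exp (s / 2) * (barrier c s) ^ 5 * (s * (1 - c) + c * (4 - c))"
proof -
  define y where "y = barrier c s"
  have y: "y\<^sup>2 * (s + c) = 1" unfolding y_def using assms by (simp add: barrier_sq)
  have "y ^ 3 = y ^ 3 * (y\<^sup>2 * (s + c))" "y = y * (y\<^sup>2 * (s + c)) * (y\<^sup>2 * (s + c))"
    unfolding y by auto
  then have *: "y ^ 3 = y ^ 5 * (s + c)" "y = y ^ 5 * (s + c)\<^sup>2"
    by (auto simp: algebra_simps power2_eq_square numeral_eq_Suc)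
  have "- y + (4 + s) * y ^ 3 - 3 * s * y ^ 5 = y ^ 5 * (s * (1 - c) + c * (4 - c))"
    by (subst (1) *(2), subst *(1)) (simp add: algebra_simps power2_eq_square)
  then have "s / 2 * (y ^ 5 * (s * (1 - c) + c * (4 - c)))
      = s / 2 * (- y + (4 + s) * y ^ 3 - 3 * s * y ^ 5)" by simp
  then have N: "(2 * s + s\<^sup>2 / 2) * (y + y ^ 3) - s\<^sup>2 / 2 * (y ^ 3 + 3 * y ^ 5)
      = s / 2 * ((5 + s - s * y\<^sup>2) * y) + s / 2 * (y ^ 5 * (s * (1 - c) + c * (4 - c)))"
    by (simp only:) (simp add: field_simps power2_eq_square numeral_eq_Suc)
  have *: "E * (s / 2 * A + s / 2 * (B * Z)) / 2 = s / 4 * E * A + s / 4 * E * B * Z" for E A B Z :: real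
    by (simp add: field_simps)
  show ?thesis unfolding flux_deriv_def y_def[symmetric] source_def N by (rule *)
qed

lemma barrier_measurable [measurable]: "barrier c \<in> borel_measurable borel"
  unfolding barrier_def by measurable

lemma flux_deriv_measurable [measurable]: "flux_deriv c \<in> borel_measurable borel"
  unfolding flux_deriv_def by measurable

lemma flux_deriv_integral:
  assumes "0 \<le> s" "0 < c"
  shows "(\<integral>\<^sup>+x. ennreal (flux_deriv c x) * indicator {0..s} x \<partial>lborel) = ennreal (flux c s)"
proof -
  have "(\<integral>\<^sup>+x. ennreal (flux_deriv c x) * indicator {0..s} x \<partial>lborel) = flux c s - flux c 0"
    by (rule nn_integral_FTC_Icc)
       (use assms in \<open>auto intro: flux_deriv_nonneg DERIV_subset[OF flux_has_derivative]\<close>)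
  then show ?thesis by (simp add: flux_def)
qed

text \<open>The weighted flux is minus the derivative of \<open>exp (- s / 2) * barrier c s\<close>, which vanishes at infinity.\<close>

lemma flux_integral:
  assumes "0 \<le> t" "0 < c"
  shows "(\<integral>\<^sup>+s. (ennreal (exp (- s) / s\<^sup>2) * ennreal (flux c s)) * indicator {t..} s \<partial>lborel)
    = ennreal (exp (- t / 2) * barrier c t)"
proof -
  let ?w = "\<lambda>s. exp (- s / 2) * (barrier c s + (barrier c s) ^ 3) / 2"
  have "exp (- s) * exp (s / 2) = exp (- s / 2)" for s :: real
    by (simp add: exp_add[symmetric])
  then have eq: "exp (- s) / s\<^sup>2 * flux c s = ?w s" if "s \<noteq> 0" for s
    using that by (simp add: flux_def)
  have "(\<integral>\<^sup>+s. (ennreal (exp (- s) / s\<^sup>2) * ennreal (flux c s)) * indicator {t..} s \<partial>lborel)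
    = (\<integral>\<^sup>+s. ennreal (?w s) * indicator {t..} s \<partial>lborel)"
  proof (rule nn_integral_cong_AE)
    show "AE s in lborel. (ennreal (exp (- s) / s\<^sup>2) * ennreal (flux c s)) * indicator {t..} s
        = ennreal (?w s) * indicator {t..} s"
      using AE_lborel_singleton[of "0::real"]
    proof eventually_elim
      case (elim s)
      have "ennreal (exp (- s) / s\<^sup>2) * ennreal (flux c s) = ennreal (exp (- s) / s\<^sup>2 * flux c s)"
        by (rule ennreal_mult'[symmetric]) simp
      then show ?case unfolding eq[OF elim] by (rule arg_cong)
    qed
  qed
  also have "\<dots> = ennreal (0 - (- (exp (- t / 2) * barrier c t)))"
  proof (rule nn_integral_FTC_atLeast)
    show "((\<lambda>s. - (exp (- s / 2) * barrier c s)) \<longlongrightarrow> 0) at_top"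
      unfolding barrier_def by real_asymp
    fix s assume s: "t \<le> s"
    then show "0 \<le> ?w s" using barrier_pos[of s c] assms by simp
    show "((\<lambda>s. - (exp (- s / 2) * barrier c s)) has_real_derivative ?w s) (at s)"
      using barrier_deriv[of s c] s assms
      by (auto intro!: derivative_eq_intros simp: field_simps)
  qed auto
  finally show ?thesis by simp
qed

lemma source_measurable [measurable]:
  "q \<in> borel_measurable borel \<Longrightarrow> (\<lambda>x. source x (q x)) \<in> borel_measurable borel"
  unfolding source_def by measurable

lemma source_integral_measurable [measurable]:
  assumes [measurable]: "q \<in> borel_measurable borel"
  shows "(\<lambda>s. \<integral>\<^sup>+x. ennreal (source x (q x)) * indicator {0..s} x \<partial>lborel) \<in> borel_measurable borel"
proof -
  have "(\<lambda>s. \<integral>\<^sup>+x. ennreal (source x (q x)) * (if 0 \<le> x \<and> x \<le> s then 1 else 0) \<partial>lborel)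
     \<in> borel_measurable borel"
    by measurable
  then show ?thesis by (simp add: indicator_def if_distrib cong: if_cong)
qed

lemma green_measurable [measurable]:
  assumes [measurable]: "q \<in> borel_measurable borel"
  shows "green q \<in> borel_measurable borel"
proof -
  have "(\<lambda>t. \<integral>\<^sup>+s. (ennreal (exp (- s) / s\<^sup>2) *
     (\<integral>\<^sup>+x. ennreal (source x (q x)) * indicator {0..s} x \<partial>lborel)) * (if t \<le> s then 1 else 0) \<partial>lborel)
     \<in> borel_measurable borel"
    by measurable
  then show ?thesis by (simp add: indicator_def if_distrib green_def[abs_def] cong: if_cong)
qed

lemma green_mono:
  assumes "\<And>x. 0 \<le> x \<Longrightarrow> source x (p x) \<le> source x (q x)"
  shows "green p t \<le> green q t"
proof -
  have *: "(\<integral>\<^sup>+x. ennreal (source x (p x)) * indicator {0..s} x \<partial>lborel)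
      \<le> (\<integral>\<^sup>+x. ennreal (source x (q x)) * indicator {0..s} x \<partial>lborel)" for s
    by (rule nn_integral_mono) (auto simp: indicator_def intro!: ennreal_leI assms)
  show ?thesis
    unfolding green_def by (rule nn_integral_mono, rule mult_right_mono, rule mult_left_mono, rule *) simp_all
qed

lemma weighted_integral_mono:
  fixes F H :: "real \<Rightarrow> ennreal"
  assumes "\<And>s. 0 \<le> s \<Longrightarrow> F s \<le> H s" "0 \<le> t"
  shows "(\<integral>\<^sup>+s. (w s * F s) * indicator {t..} s \<partial>lborel) \<le> (\<integral>\<^sup>+s. (w s * H s) * indicator {t..} s \<partial>lborel)"
proof (rule nn_integral_mono)
  fix s
  show "w s * F s * indicator {t..} s \<le> w s * H s * indicator {t..} s"
    using mult_left_mono[OF assms(1), of s "w s"] assms(2) by (cases "t \<le> s") auto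
qed

lemma subsolution:
  assumes "0 \<le> t"
  shows "ennreal (exp (- t / 2) * barrier 4 t) \<le> green (barrier 4) t"
proof -
  have *: "flux_deriv 4 x \<le> source x (barrier 4 x)" if "0 \<le> x" for x
  proof -
    have "0 \<le> x / 4 * exp (x / 2) * barrier 4 x ^ 5 * (3 * x)"
      using that barrier_pos[of x 4] by simp
    then show ?thesis using flux_deriv_eq[OF that, of 4] by simp
  qed
  have "ennreal (flux 4 s) \<le> (\<integral>\<^sup>+x. ennreal (source x (barrier 4 x)) * indicator {0..s} x \<partial>lborel)"
    if s: "0 \<le> s" for s
  proof -
    have "ennreal (flux 4 s) = (\<integral>\<^sup>+x. ennreal (flux_deriv 4 x) * indicator {0..s} x \<partial>lborel)"
      by (rule flux_deriv_integral[symmetric]) (use s in auto)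
    also have "\<dots> \<le> (\<integral>\<^sup>+x. ennreal (source x (barrier 4 x)) * indicator {0..s} x \<partial>lborel)"
      by (rule nn_integral_mono) (auto simp: indicator_def intro!: ennreal_leI *)
    finally show ?thesis .
  qed
  note inner = this
  have "ennreal (exp (- t / 2) * barrier 4 t)
      = (\<integral>\<^sup>+s. (ennreal (exp (- s) / s\<^sup>2) * ennreal (flux 4 s)) * indicator {t..} s \<partial>lborel)"
    by (rule flux_integral[symmetric]) (use assms in auto)
  also have "\<dots> \<le> green (barrier 4) t"
    unfolding green_def by (rule weighted_integral_mono, rule inner, assumption, rule assms)
  finally show ?thesis .
qed

lemma supersolution:
  assumes "0 \<le> t"
  shows "green (barrier 1) t \<le> ennreal (exp (- t / 2) * barrier 1 t)"
proof -
  have *: "source x (barrier 1 x) \<le> flux_deriv 1 x" if "0 \<le> x" for x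
  proof -
    have "0 \<le> x / 4 * exp (x / 2) * barrier 1 x ^ 5 * 3"
      using that barrier_pos[of x 1] by simp
    then show ?thesis using flux_deriv_eq[OF that, of 1] by simp
  qed
  have "(\<integral>\<^sup>+x. ennreal (source x (barrier 1 x)) * indicator {0..s} x \<partial>lborel) \<le> ennreal (flux 1 s)"
    if s: "0 \<le> s" for s
  proof -
    have "(\<integral>\<^sup>+x. ennreal (source x (barrier 1 x)) * indicator {0..s} x \<partial>lborel)
        \<le> (\<integral>\<^sup>+x. ennreal (flux_deriv 1 x) * indicator {0..s} x \<partial>lborel)"
      by (rule nn_integral_mono) (auto simp: indicator_def intro!: ennreal_leI *)
    also have "\<dots> = ennreal (flux 1 s)"
      by (rule flux_deriv_integral) (use s in auto)
    finally show ?thesis .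
  qed
  note inner = this
  have "green (barrier 1) t
      \<le> (\<integral>\<^sup>+s. (ennreal (exp (- s) / s\<^sup>2) * ennreal (flux 1 s)) * indicator {t..} s \<partial>lborel)"
    unfolding green_def by (rule weighted_integral_mono, rule inner, assumption, rule assms)
  also have "\<dots> = ennreal (exp (- t / 2) * barrier 1 t)"
    by (rule flux_integral) (use assms in auto)
  finally show ?thesis .
qed

text \<open>The iteration starts at the subsolution and increases; it stays below the supersolution, so that
  the possibly infinite integrals in \<open>green\<close> are finite along it.\<close>

primrec iterate :: "nat \<Rightarrow> real \<Rightarrow> real" where
  "iterate 0 = barrier 4"
| "iterate (Suc n) = (\<lambda>t. exp (t / 2) * enn2real (green (iterate n) t))"

lemma iterate_measurable [measurable]: "iterate n \<in> borel_measurable borel"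
  by (induction n) (auto intro: barrier_measurable)

lemma green_between:
  assumes "\<And>x. 0 \<le> x \<Longrightarrow> barrier 4 x \<le> q x \<and> q x \<le> barrier 1 x" and t: "0 \<le> t"
  shows "ennreal (exp (- t / 2) * barrier 4 t) \<le> green q t"
    and "green q t \<le> ennreal (exp (- t / 2) * barrier 1 t)"
proof -
  have nonneg: "0 \<le> q x" if "0 \<le> x" for x
    using assms(1)[OF that] barrier_pos[OF that, of 4] by linarith
  have "green (barrier 4) t \<le> green q t"
    by (intro green_mono source_mono barrier_le_of_between)
       (use assms nonneg barrier_pos[of _ 4] in \<open>auto intro: less_imp_le\<close>)
  then show "ennreal (exp (- t / 2) * barrier 4 t) \<le> green q t"
    using subsolution[OF t] by (rule order_trans[rotated])
  have "green q t \<le> green (barrier 1) t"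
    by (intro green_mono source_mono barrier_sq_le) (use assms nonneg in auto)
  then show "green q t \<le> ennreal (exp (- t / 2) * barrier 1 t)"
    using supersolution[OF t] by (rule order_trans)
qed

lemma iterate_between:
  "0 \<le> t \<Longrightarrow> barrier 4 t \<le> iterate n t \<and> iterate n t \<le> barrier 1 t"
proof (induction n arbitrary: t)
  case 0
  then show ?case by (auto intro: barrier_antimono)
next
  case (Suc n)
  note b = green_between[OF Suc.IH Suc.prems]
  from b(2) have fin: "green (iterate n) t < top" by (rule le_less_trans[OF _ ennreal_less_top])
  then obtain g where g: "green (iterate n) t = ennreal g" "0 \<le> g"
    by (cases "green (iterate n) t") auto
  have "exp (- t / 2) * barrier 4 t \<le> g" "g \<le> exp (- t / 2) * barrier 1 t"
    using b g barrier_pos[OF Suc.prems, of 1] by (auto simp: ennreal_le_iff)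
  then have "exp (t / 2) * (exp (- t / 2) * barrier 4 t) \<le> exp (t / 2) * g"
      "exp (t / 2) * g \<le> exp (t / 2) * (exp (- t / 2) * barrier 1 t)"
    by (intro mult_left_mono; simp)+
  then show ?case using g by (simp add: mult.assoc[symmetric] exp_add[symmetric])
qed

lemma iterate_Suc_eq_green:
  assumes "0 \<le> t"
  shows "ennreal (exp (- t / 2) * iterate (Suc n) t) = green (iterate n) t"
proof -
  have "green (iterate n) t < top"
    using green_between(2)[OF iterate_between assms] by (rule le_less_trans[OF _ ennreal_less_top])
  moreover have "exp (- t / 2) * exp (t / 2) = 1" by (simp add: exp_add[symmetric])
  ultimately show ?thesis by (simp add: mult.assoc[symmetric])
qed

lemma iterate_nonneg: "0 \<le> t \<Longrightarrow> 0 \<le> iterate n t"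
  using iterate_between[of t n] barrier_pos[of t 4] by simp

lemma source_iterate_mono:
  assumes "\<And>x. 0 \<le> x \<Longrightarrow> iterate m x \<le> iterate n x" "0 \<le> x"
  shows "source x (iterate m x) \<le> source x (iterate n x)"
  using assms iterate_between[of x n] iterate_nonneg
  by (intro source_mono barrier_le_of_between) auto

lemma iterate_mono: "0 \<le> t \<Longrightarrow> iterate n t \<le> iterate (Suc n) t"
proof (induction n arbitrary: t)
  case 0
  then show ?case using iterate_between[of t "Suc 0"] by simp
next
  case (Suc n)
  have "green (iterate n) t \<le> green (iterate (Suc n)) t"
    by (intro green_mono source_iterate_mono Suc.IH) auto
  then have "ennreal (exp (- t / 2) * iterate (Suc n) t) \<le> ennreal (exp (- t / 2) * iterate (Suc (Suc n)) t)"
    by (simp only: iterate_Suc_eq_green[OF Suc.prems])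
  then show ?case
    using iterate_nonneg[OF Suc.prems] by (subst (asm) ennreal_le_iff) auto
qed

text \<open>Monotone convergence, first in the inner and then in the outer integral of \<open>green\<close>, shows that the
  limit of the iteration is a fixed point.\<close>

lemma fixed_point_of_green:
  obtains q where "q \<in> borel_measurable borel"
    and "\<And>t. 0 \<le> t \<Longrightarrow> barrier 4 t \<le> q t" and "\<And>t. 0 \<le> t \<Longrightarrow> q t \<le> barrier 1 t"
    and "\<And>t. 0 \<le> t \<Longrightarrow> ennreal (exp (- t / 2) * q t) = green q t"
proof
  define q where "q t = lim (\<lambda>n. iterate n t)" for t
  have inc: "incseq (\<lambda>n. iterate n t)" if "0 \<le> t" for t
    using iterate_mono[OF that] by (rule incseq_SucI)
  have conv: "(\<lambda>n. iterate n t) \<longlonglongrightarrow> q t" if "0 \<le> t" for t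
  proof -
    have "convergent (\<lambda>n. iterate n t)"
      by (rule Bseq_mono_convergent[OF BseqI'[of _ "barrier 1 t"]])
         (use inc[OF that] iterate_between[OF that] iterate_nonneg[OF that] in \<open>auto simp: incseq_def\<close>)
    then show ?thesis unfolding q_def by (simp add: convergent_LIMSEQ_iff)
  qed
  have "(\<lambda>t. lim (\<lambda>n. iterate n t)) \<in> borel_measurable borel" by measurable
  then show [measurable]: "q \<in> borel_measurable borel" by (simp add: q_def[abs_def])
  show "barrier 4 t \<le> q t" "q t \<le> barrier 1 t" if "0 \<le> t" for t
    using LIMSEQ_le_const[OF conv[OF that]] LIMSEQ_le_const2[OF conv[OF that]] iterate_between[OF that]
    by blast+
  have src: "(\<lambda>n. ennreal (source x (iterate n x))) \<longlonglongrightarrow> ennreal (source x (q x))" if "0 \<le> x" for x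
    unfolding source_def by (intro tendsto_ennrealI tendsto_mult tendsto_diff tendsto_power tendsto_const conv that)
  have srci: "incseq (\<lambda>n. ennreal (source x (iterate n x)))" if "0 \<le> x" for x
    by (intro incseq_SucI ennreal_leI source_iterate_mono iterate_mono that)
  define I where "I p s = (\<integral>\<^sup>+x. ennreal (source x (p x)) * indicator {0..s} x \<partial>lborel)" for p s
  have [measurable]: "I p \<in> borel_measurable borel" if "p \<in> borel_measurable borel" for p
    unfolding I_def using that by measurable
  have I: "(\<lambda>n. I (iterate n) s) \<longlonglongrightarrow> I q s" for s
    unfolding I_def
  proof (rule nn_integral_LIMSEQ)
    show "incseq (\<lambda>n x. ennreal (source x (iterate n x)) * indicator {0..s} x)"
      using srci by (simp add: incseq_def le_fun_def indicator_def)
    show "(\<lambda>n. ennreal (source x (iterate n x)) * indicator {0..s} x)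
        \<longlonglongrightarrow> ennreal (source x (q x)) * indicator {0..s} x" for x
      using src by (auto simp: indicator_def)
  qed measurable
  have Ii: "incseq (\<lambda>n. I (iterate n) s)" for s
    unfolding I_def
  proof (intro incseq_SucI nn_integral_mono)
    fix n x
    show "ennreal (source x (iterate n x)) * indicator {0..s} x
        \<le> ennreal (source x (iterate (Suc n) x)) * indicator {0..s} x"
      using mult_right_mono[OF incseq_SucD[OF srci, of x n], of "indicator {0..s} x"]
      by (cases "0 \<le> x") (auto simp: indicator_def)
  qed
  have green: "green p t = (\<integral>\<^sup>+s. (ennreal (exp (- s) / s\<^sup>2) * I p s) * indicator {t..} s \<partial>lborel)" for p t
    by (simp add: green_def I_def)
  have lim: "(\<lambda>n. green (iterate n) t) \<longlonglongrightarrow> green q t" for t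
    unfolding green
  proof (rule nn_integral_LIMSEQ)
    show "incseq (\<lambda>n s. ennreal (exp (- s) / s\<^sup>2) * I (iterate n) s * indicator {t..} s)"
      by (intro incseq_SucI le_funI mult_right_mono mult_left_mono incseq_SucD[OF Ii]) auto
    show "(\<lambda>n. ennreal (exp (- s) / s\<^sup>2) * I (iterate n) s * indicator {t..} s)
        \<longlonglongrightarrow> ennreal (exp (- s) / s\<^sup>2) * I q s * indicator {t..} s" for s
      using ennreal_tendsto_cmult[OF _ I, of "ennreal (exp (- s) / s\<^sup>2)" s] by (auto simp: indicator_def)
  qed measurable
  show "ennreal (exp (- t / 2) * q t) = green q t" if t: "0 \<le> t" for t
  proof (rule LIMSEQ_unique[OF _ lim])
    show "(\<lambda>n. green (iterate n) t) \<longlonglongrightarrow> ennreal (exp (- t / 2) * q t)"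
      unfolding iterate_Suc_eq_green[OF t, symmetric]
      by (intro tendsto_ennrealI tendsto_mult tendsto_const LIMSEQ_Suc conv t)
  qed
qed

section \<open>Regularity of the vortex profile\<close>

lemma integrable_of_finite_nn_integral:
  fixes f :: "real \<Rightarrow> real"
  assumes f: "f \<in> borel_measurable borel" and S: "S \<in> sets borel"
    and nonneg: "\<And>x. x \<in> S \<Longrightarrow> 0 \<le> f x"
    and eq: "(\<integral>\<^sup>+x. ennreal (f x) * indicator S x \<partial>lborel) = ennreal r" and r: "0 \<le> r"
  shows "(f has_integral r) S"
proof -
  have "((\<lambda>x. if x \<in> S then f x else 0) has_integral r) UNIV"
  proof (rule nn_integral_has_integral)
    have "{x \<in> space borel. x \<in> S} \<in> sets borel" using S by simp
    then show "(\<lambda>x. if x \<in> S then f x else 0) \<in> borel_measurable borel"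
      using f by (intro measurable_If) auto
    show "0 \<le> (if x \<in> S then f x else 0)" for x using nonneg by auto
    have "ennreal (if x \<in> S then f x else 0) = ennreal (f x) * indicator S x" for x by auto
    then show "(\<integral>\<^sup>+x. ennreal (if x \<in> S then f x else 0) \<partial>lborel) = ennreal r"
      using eq by simp
  qed (fact r)
  then show ?thesis by (simp add: has_integral_restrict_UNIV)
qed

lemma at_within_atLeast:
  fixes t :: real
  assumes "t < T" shows "at t within {0..T} = at t within {0..}"
  by (rule at_within_nhd[of t "{..<T}"]) (use assms in auto)

lemma continuous_on_atLeast:
  fixes f :: "real \<Rightarrow> 'a::topological_space"
  assumes "\<And>T. continuous_on {0..T} f"
  shows "continuous_on {0..} f"
  unfolding continuous_on_def
proof
  fix t :: real assume t: "t \<in> {0..}"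
  have "(f \<longlongrightarrow> f t) (at t within {0..t + 1})"
    using assms[of "t + 1"] t by (simp add: continuous_on_def)
  then show "(f \<longlongrightarrow> f t) (at t within {0..})"
    using at_within_atLeast[of t "t + 1"] by simp
qed

text \<open>Each of the two integrations gains regularity: the inner integral \<open>b\<close> is continuous because its
  integrand is bounded, hence \<open>q\<close> is continuous, hence the integrands are continuous, and the fundamental
  theorem of calculus applies twice. The function \<open>p\<close> is \<open>t\<^sup>2 q'\<close>; in terms of it the equation is
  \<open>p' = - t / 4 * q (1 - t q\<^sup>2)\<close>, from which the auxiliary coefficient \<open>4 + t\<close> has disappeared.\<close>

lemma regularity_of_fixed_point:
  assumes qm [measurable]: "q \<in> borel_measurable borel"
    and lo: "\<And>t. 0 \<le> t \<Longrightarrow> barrier 4 t \<le> q t" and hi: "\<And>t. 0 \<le> t \<Longrightarrow> q t \<le> barrier 1 t"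
    and fix_q: "\<And>t. 0 \<le> t \<Longrightarrow> ennreal (exp (- t / 2) * q t) = green q t"
  obtains p where "continuous_on {0..} q" "continuous_on {0..} p" "p 0 = 0"
    "\<And>t. 0 < t \<Longrightarrow> (q has_real_derivative p t / t\<^sup>2) (at t)"
    "\<And>t. 0 < t \<Longrightarrow> (p has_real_derivative (- (t / 4 * (q t * (1 - t * (q t)\<^sup>2))))) (at t)"
proof -
  have pos: "0 < q t" if "0 \<le> t" for t
    using lo[OF that] barrier_pos[OF that, of 4] by linarith
  have sq: "t * (q t)\<^sup>2 \<le> 1" if "0 \<le> t" for t
    using that pos[OF that] hi[OF that] by (intro barrier_le_of_between) auto
  have le1: "q t \<le> 1" if "0 \<le> t" for t
    using hi[OF that] that by (simp add: barrier_def order_trans)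
  define a where "a x = source x (q x)" for x
  have [measurable]: "a \<in> borel_measurable borel" unfolding a_def by measurable
  have a_nonneg: "0 \<le> a x" if "0 \<le> x" for x
    unfolding a_def using that pos[OF that] sq[OF that] by (intro source_nonneg) auto
  have a_le: "a x \<le> s / 4 * exp (s / 2) * ((5 + s) * 1)" if "0 \<le> x" "x \<le> s" for x s
  proof -
    have "0 \<le> x * (q x)\<^sup>2" using that by simp
    then have le: "5 + x - x * (q x)\<^sup>2 \<le> 5 + s" using that by linarith
    then have "(5 + x - x * (q x)\<^sup>2) * q x \<le> (5 + s) * 1"
      using that pos[of x] sq[of x] le1[of x] by (intro mult_mono) auto
    then show ?thesis unfolding a_def source_def
      using that le pos[of x] sq[of x] le1[of x] by (intro mult_mono) auto
  qed
  define B where "B s = (\<integral>\<^sup>+x. ennreal (a x) * indicator {0..s} x \<partial>lborel)" for s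
  define b where "b s = enn2real (B s)" for s
  have [measurable]: "B \<in> borel_measurable borel" unfolding B_def a_def by measurable
  have [measurable]: "b \<in> borel_measurable borel" unfolding b_def by measurable
  have B_fin: "B s < top" for s
  proof -
    have "B s \<le> (\<integral>\<^sup>+x. ennreal (s / 4 * exp (s / 2) * ((5 + s) * 1)) * indicator {0..s} x \<partial>lborel)"
      unfolding B_def
    proof (rule nn_integral_mono)
      fix x
      show "ennreal (a x) * indicator {0..s} x
          \<le> ennreal (s / 4 * exp (s / 2) * ((5 + s) * 1)) * indicator {0..s} x"
        using a_le[of x s] by (cases "x \<in> {0..s}") (auto intro!: ennreal_leI)
    qed
    also have "\<dots> = ennreal (s / 4 * exp (s / 2) * ((5 + s) * 1)) * emeasure lborel {0..s}"
      by (rule nn_integral_cmult_indicator) simp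
    also have "\<dots> < top" by (cases "0 \<le> s") (auto simp: ennreal_mult_less_top)
    finally show ?thesis .
  qed
  have B_eq: "B s = ennreal (b s)" for s using B_fin[of s] by (simp add: b_def less_top)
  have b_nonneg: "0 \<le> b s" for s by (simp add: b_def)
  have b_int: "(a has_integral b s) {0..s}" for s
    by (rule integrable_of_finite_nn_integral)
       (use B_eq[of s] a_nonneg b_nonneg in \<open>auto simp: B_def\<close>)
  have b0: "b 0 = 0" 
  proof -
    have "(a has_integral b 0) {0}" using b_int[of 0] by simp
    then show ?thesis using has_integral_unique has_integral_refl(2) by blast
  qed
  have b_cont: "continuous_on {0..T} b" for T
  proof -
    have "continuous_on {0..T} (\<lambda>s. integral {0..s} a)"
      using b_int[of T] by (intro indefinite_integral_continuous_1) auto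
    then show ?thesis unfolding integral_unique[OF b_int] .
  qed
  define m where "m s = exp (- s) / s\<^sup>2 * b s" for s
  have [measurable]: "m \<in> borel_measurable borel" unfolding m_def by measurable
  have m_nonneg: "0 \<le> m s" for s unfolding m_def using b_nonneg[of s] by simp
  \<comment> \<open>\<open>v\<close> is the outer integral of the fixed-point equation, taken over the half-line from \<open>t\<close>.\<close>
  define v where "v t = exp (- t / 2) * q t" for t
  have v_int: "(m has_integral v t) {t..}" if t: "0 \<le> t" for t
  proof (rule integrable_of_finite_nn_integral)
    have "ennreal (m s) = ennreal (exp (- s) / s\<^sup>2) * B s" for s
      unfolding m_def B_eq by (rule ennreal_mult') simp
    then show "(\<integral>\<^sup>+x. ennreal (m x) * indicator {t..} x \<partial>lborel) = ennreal (v t)"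
      using fix_q[OF t] by (simp add: v_def green_def B_def a_def)
  qed (use m_nonneg pos[OF t] in \<open>auto simp: v_def\<close>)
  have m_int: "m integrable_on {s..t}" if "0 \<le> s" for s t
  proof (rule integrable_on_subinterval)
    show "m integrable_on {s..}" using v_int[OF that] by blast
  qed auto
  have v_diff: "v t = v s - integral {s..t} m" if st: "0 \<le> s" "s \<le> t" for s t
  proof -
    have "(m has_integral (integral {s..t} m + v t)) ({s..t} \<union> {t..})"
    proof (rule has_integral_Un)
      show "(m has_integral integral {s..t} m) {s..t}"
        using m_int[OF st(1)] by (rule integrable_integral)
      show "(m has_integral v t) {t..}" using v_int st by simp
      have "{s..t} \<inter> {t..} = {t}" using st by auto
      then show "negligible ({s..t} \<inter> {t..})" by simp
    qed
    also have "{s..t} \<union> {t..} = {s..}" using st by auto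
    finally have "(m has_integral (integral {s..t} m + v t)) {s..}" .
    from has_integral_unique[OF this v_int[OF st(1)]] show ?thesis by simp
  qed
  have v_cont: "continuous_on {0..T} v" for T
  proof (rule continuous_on_eq)
    show "continuous_on {0..T} (\<lambda>t. v 0 - integral {0..t} m)"
      using m_int[of 0 T] by (intro continuous_intros indefinite_integral_continuous_1) auto
    show "v 0 - integral {0..t} m = v t" if "t \<in> {0..T}" for t
      using v_diff[of 0 t] that by simp
  qed
  have q_v: "q t = exp (t / 2) * v t" for t
    unfolding v_def by (simp add: mult.assoc[symmetric] exp_add[symmetric])
  have q_contT: "continuous_on {0..T} q" for T
    unfolding q_v[abs_def] by (intro continuous_intros v_cont) auto
  have q_cont: "continuous_on {0..} q" by (rule continuous_on_atLeast[OF q_contT])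
  have a_cont: "continuous_on {s..T} a" if "0 \<le> s" for s T
    unfolding a_def source_def
    by (intro continuous_intros continuous_on_subset[OF q_cont]) (use that in auto)
  have b_deriv: "(b has_real_derivative a t) (at t)" if t: "0 < t" for t
  proof -
    have "((\<lambda>s. integral {0..s} a) has_real_derivative a t) (at t within {0..2 * t})"
      by (rule integral_has_real_derivative) (use a_cont[of 0] t in auto)
    then have "((\<lambda>s. integral {0..s} a) has_real_derivative a t) (at t)"
      using t by (simp add: at_within_Icc_at)
    moreover have "(\<lambda>s. integral {0..s} a) = b" using b_int by (auto simp: integral_unique)
    ultimately show ?thesis by simp
  qed
  have v_deriv: "(v has_real_derivative (- m t)) (at t)" if t: "0 < t" for t
  proof -
    have "continuous_on {t/2..2 * t} m"
      unfolding m_def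
      by (intro continuous_intros continuous_on_subset[OF b_cont[of "2 * t"]]) (use t in auto)
    then have "((\<lambda>s. integral {t/2..s} m) has_real_derivative m t) (at t within {t/2..2 * t})"
      by (rule integral_has_real_derivative) (use t in auto)
    then have "((\<lambda>s. v (t/2) - integral {t/2..s} m) has_real_derivative (- m t)) (at t within {t/2..2 * t})"
      by (auto intro!: derivative_eq_intros)
    then have "(v has_real_derivative (- m t)) (at t within {t/2..2 * t})"
      by (rule has_field_derivative_transform_within[OF _ zero_less_one]) (use t v_diff[of "t/2", symmetric] in auto)
    then show ?thesis using t by (simp add: at_within_Icc_at)
  qed
  define p where "p t = t\<^sup>2 * q t / 2 - exp (- t / 2) * b t" for t
  have p0: "p 0 = 0" by (simp add: p_def b0)
  have p_cont: "continuous_on {0..} p"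
    unfolding p_def by (intro continuous_on_atLeast continuous_intros q_contT b_cont) auto
  have q_deriv: "(q has_real_derivative p t / t\<^sup>2) (at t)" if t: "0 < t" for t
  proof -
    have "((\<lambda>t. exp (t / 2) * v t) has_real_derivative exp (t / 2) * v t / 2 - exp (t / 2) * m t) (at t)"
      using v_deriv[OF t] by (auto intro!: derivative_eq_intros)
    moreover have "exp (t / 2) * v t / 2 - exp (t / 2) * m t = p t / t\<^sup>2"
    proof -
      have "exp (t / 2) * exp (- t) = exp (- t / 2)" by (simp add: exp_add[symmetric])
      then have m: "exp (t / 2) * m t = exp (- t / 2) * b t / t\<^sup>2"
        by (simp add: m_def mult.assoc[symmetric])
      have "exp (t / 2) * v t = q t" by (simp add: q_v)
      then show ?thesis unfolding m p_def using t by (simp add: diff_divide_distrib)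
    qed
    ultimately show ?thesis by (simp add: q_v[symmetric])
  qed
  have p_deriv: "(p has_real_derivative (- (t / 4 * (q t * (1 - t * (q t)\<^sup>2))))) (at t)"
    if t: "0 < t" for t
  proof -
  have "((\<lambda>t. t\<^sup>2 * q t / 2 - exp (- t / 2) * b t) has_real_derivative
      (t * q t + t\<^sup>2 * d / 2 + exp (- t / 2) * b t / 2 - exp (- t / 2) * a t)) (at t)"
    if d: "(q has_real_derivative d) (at t)" for d
  proof -
    have "((\<lambda>t. t\<^sup>2) has_real_derivative 2 * t) (at t)"
      by (auto intro!: derivative_eq_intros)
    from DERIV_cdivide[OF DERIV_mult[OF this d], of 2]
    have 1: "((\<lambda>t. t\<^sup>2 * q t / 2) has_real_derivative (2 * t * q t + d * t\<^sup>2) / 2) (at t)" .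
    have "((\<lambda>t. exp (- t / 2)) has_real_derivative - (exp (- t / 2) / 2)) (at t)"
      by (auto intro!: derivative_eq_intros)
    from DERIV_diff[OF 1 DERIV_mult[OF this b_deriv[OF t]]] show ?thesis
      by (rule DERIV_cong) (simp add: field_simps)
  qed
  from this[OF q_deriv[OF t]]
  have "(p has_real_derivative (t * q t + t\<^sup>2 * (p t / t\<^sup>2) / 2 + exp (- t / 2) * b t / 2
      - exp (- t / 2) * a t)) (at t)"
    by (simp only: p_def[abs_def])
  moreover have "t * q t + t\<^sup>2 * (p t / t\<^sup>2) / 2 + exp (- t / 2) * b t / 2 - exp (- t / 2) * a t
    = - (t / 4 * (q t * (1 - t * (q t)\<^sup>2)))"
  proof -
    have "exp (- t / 2) * exp (t / 2) = 1" by (simp add: exp_add[symmetric])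
    then have 1: "exp (- t / 2) * a t = t / 4 * ((5 + t - t * (q t)\<^sup>2) * q t)"
      by (simp add: a_def source_def)
    have 2: "t\<^sup>2 * (p t / t\<^sup>2) = t\<^sup>2 * q t / 2 - exp (- t / 2) * b t" using t by (simp add: p_def)
    show ?thesis unfolding 1 2 by (simp add: field_simps power2_eq_square)
  qed
  ultimately show ?thesis by simp
  qed
  show ?thesis by (rule that[OF q_cont p_cont p0 q_deriv p_deriv])
qed

text \<open>Differentiability up to \<open>t = 0\<close> is read off from the formula
  \<open>q' t = - integral {0..1} (\<lambda>\<sigma>. \<sigma> * k (t * \<sigma>))\<close> with \<open>k s = q s (1 - s (q s)\<^sup>2) / 4\<close>, obtained from
  \<open>t\<^sup>2 q' = - integral {0..t} (\<lambda>s. s * k s)\<close> by the substitution \<open>s = t \<sigma>\<close>: it has no singularity at \<open>0\<close>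
  and can be differentiated under the integral sign.\<close>

lemma vortex_profile_exists:
  obtains q q' q'' :: "real \<Rightarrow> real" where
    "\<And>t. 0 \<le> t \<Longrightarrow> (q has_real_derivative q' t) (at t within {0..})"
    "\<And>t. 0 \<le> t \<Longrightarrow> (q' has_real_derivative q'' t) (at t within {0..})"
    "continuous_on {0..} q''"
    "\<And>t. 0 \<le> t \<Longrightarrow> 4 * (t * q'' t + 2 * q' t) + q t * (1 - t * (q t)\<^sup>2) = 0"
    "\<And>t. 0 \<le> t \<Longrightarrow> barrier 4 t \<le> q t" "\<And>t. 0 \<le> t \<Longrightarrow> q t \<le> barrier 1 t"
proof -
  obtain q where qm: "q \<in> borel_measurable borel"
    and lo: "\<And>t. 0 \<le> t \<Longrightarrow> barrier 4 t \<le> q t" and hi: "\<And>t. 0 \<le> t \<Longrightarrow> q t \<le> barrier 1 t"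
    and fix_q: "\<And>t. 0 \<le> t \<Longrightarrow> ennreal (exp (- t / 2) * q t) = green q t"
    using fixed_point_of_green by metis
  obtain p where q_cont: "continuous_on {0..} q" and p_cont: "continuous_on {0..} p" and p0: "p 0 = 0"
    and q_deriv0: "\<And>t. 0 < t \<Longrightarrow> (q has_real_derivative p t / t\<^sup>2) (at t)"
    and p_deriv: "\<And>t. 0 < t \<Longrightarrow> (p has_real_derivative (- (t / 4 * (q t * (1 - t * (q t)\<^sup>2))))) (at t)"
    using regularity_of_fixed_point[OF qm lo hi fix_q] by metis
  define k where "k s = q s * (1 - s * (q s)\<^sup>2) / 4" for s
  have k_cont: "continuous_on {0..} k" unfolding k_def by (intro continuous_intros q_cont) auto
  define Q where "Q t = - integral {0..1} (\<lambda>\<sigma>. \<sigma> * k (t * \<sigma>))" for t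
  have Q_eq: "Q t = p t / t\<^sup>2" if t: "0 < t" for t
  proof -
    have "((\<lambda>\<sigma>. - (\<sigma> * k (t * \<sigma>))) has_integral (p (t * 1) / t\<^sup>2 - p (t * 0) / t\<^sup>2)) {0..1}"
    proof (rule fundamental_theorem_of_calculus_interior)
      show "continuous_on {0..1} (\<lambda>\<sigma>. p (t * \<sigma>) / t\<^sup>2)"
        by (intro continuous_intros continuous_on_compose2[OF p_cont]) (use t in auto)
      fix \<sigma> :: real assume \<sigma>: "\<sigma> \<in> {0<..<1}"
      then have pos: "0 < t * \<sigma>" using t by simp
      have "(p has_real_derivative (- (t * \<sigma> * k (t * \<sigma>)))) (at (t * \<sigma>))"
        by (rule p_deriv[OF pos, THEN DERIV_cong]) (simp add: k_def)
      then have "((\<lambda>\<sigma>. p (t * \<sigma>)) has_real_derivative (- (t * \<sigma> * k (t * \<sigma>))) * t) (at \<sigma>)"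
        by (rule DERIV_chain2) (auto intro!: derivative_eq_intros)
      then have "((\<lambda>\<sigma>. p (t * \<sigma>) / t\<^sup>2) has_real_derivative (- (t * \<sigma> * k (t * \<sigma>))) * t / t\<^sup>2) (at \<sigma>)"
        by (rule DERIV_cdivide)
      moreover have "(- (t * \<sigma> * k (t * \<sigma>))) * t / t\<^sup>2 = - (\<sigma> * k (t * \<sigma>))"
        using t by (simp add: power2_eq_square)
      ultimately show "((\<lambda>\<sigma>. p (t * \<sigma>) / t\<^sup>2) has_vector_derivative - (\<sigma> * k (t * \<sigma>))) (at \<sigma>)"
        by (simp add: has_real_derivative_iff_has_vector_derivative)
    qed simp
    from integral_unique[OF this] p0 show ?thesis by (simp add: Q_def)
  qed
  have cont_param: "continuous_on {0..} (\<lambda>t. integral {0..1} (\<lambda>\<sigma>. \<sigma> ^ n * h (t * \<sigma>)))"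
    if "continuous_on {0..} h" for h :: "real \<Rightarrow> real" and n
    unfolding cbox_interval[symmetric]
    by (rule integral_continuous_on_param)
       (auto simp: split_def intro!: continuous_intros continuous_on_compose2[OF that])
  have Q_cont: "continuous_on {0..} Q"
    unfolding Q_def using cont_param[OF k_cont, of 1] by (intro continuous_intros) simp
  have q_deriv: "(q has_real_derivative Q t) (at t within {0..})" if t: "0 \<le> t" for t
  proof -
    have FTC: "q s = q 0 + integral {0..s} Q" if s: "0 \<le> s" for s
    proof -
      have "(Q has_integral (q s - q 0)) {0..s}"
      proof (rule fundamental_theorem_of_calculus_interior[OF s])
        show "continuous_on {0..s} q" by (rule continuous_on_subset[OF q_cont]) auto
        show "(q has_vector_derivative Q x) (at x)" if "x \<in> {0<..<s}" for x
          using q_deriv0[of x] Q_eq[of x] that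
          by (simp add: has_real_derivative_iff_has_vector_derivative)
      qed
      then show ?thesis by (simp add: integral_unique)
    qed
    have "((\<lambda>s. integral {0..s} Q) has_real_derivative Q t) (at t within {0..t + 1})"
      by (rule integral_has_real_derivative) (use t in \<open>auto intro: continuous_on_subset[OF Q_cont]\<close>)
    moreover have "at t within {0..t + 1} = at t within {0..}" by (rule at_within_atLeast) simp
    ultimately have "((\<lambda>s. integral {0..s} Q) has_real_derivative Q t) (at t within {0..})" by (simp only:)
    then have "((\<lambda>s. q 0 + integral {0..s} Q) has_real_derivative 0 + Q t) (at t within {0..})"
      by (intro DERIV_add DERIV_const)
    then have "((\<lambda>s. q 0 + integral {0..s} Q) has_real_derivative Q t) (at t within {0..})"
      by simp
    then show ?thesis
      by (rule has_field_derivative_transform_within[OF _ zero_less_one]) (use t FTC[symmetric] in auto)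
  qed
  define k' where "k' s = (Q s * (1 - s * (q s)\<^sup>2) - q s * ((q s)\<^sup>2 + 2 * s * q s * Q s)) / 4" for s
  have k_deriv: "(k has_real_derivative k' t) (at t within {0..})" if t: "0 \<le> t" for t
    unfolding k_def[abs_def] k'_def
    by (auto intro!: derivative_eq_intros q_deriv[OF t] simp: field_simps power2_eq_square)
  have k'_cont: "continuous_on {0..} k'"
    unfolding k'_def by (intro continuous_intros q_cont Q_cont) auto
  define Q' where "Q' t = - integral {0..1} (\<lambda>\<sigma>. \<sigma>\<^sup>2 * k' (t * \<sigma>))" for t
  have Q'_cont: "continuous_on {0..} Q'"
    unfolding Q'_def by (intro continuous_intros cont_param k'_cont)
  have Q_deriv: "(Q has_real_derivative Q' t) (at t within {0..})" if t: "0 \<le> t" for t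
  proof -
    have "((\<lambda>t. integral (cbox 0 1) (\<lambda>\<sigma>. \<sigma> * k (t * \<sigma>))) has_real_derivative
        integral (cbox 0 1) (\<lambda>\<sigma>. \<sigma>\<^sup>2 * k' (t * \<sigma>))) (at t within {0..})"
    proof (rule leibniz_rule_field_derivative[where U = "{0..}"])
      fix s \<sigma> :: real assume s: "s \<in> {0..}" and \<sigma>: "\<sigma> \<in> cbox 0 1"
      have "(k has_real_derivative k' (s * \<sigma>)) (at (s * \<sigma>) within (\<lambda>s. s * \<sigma>) ` {0..})"
        by (rule has_field_derivative_subset[OF k_deriv]) (use s \<sigma> in auto)
      then have "((k \<circ> (\<lambda>s. s * \<sigma>)) has_real_derivative k' (s * \<sigma>) * \<sigma>) (at s within {0..})"
        by (rule DERIV_image_chain) (auto intro!: derivative_eq_intros)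
      then show "((\<lambda>s. \<sigma> * k (s * \<sigma>)) has_real_derivative \<sigma>\<^sup>2 * k' (s * \<sigma>)) (at s within {0..})"
        by (auto intro!: derivative_eq_intros simp: o_def power2_eq_square)
    next
      show "(\<lambda>\<sigma>. \<sigma> * k (s * \<sigma>)) integrable_on cbox 0 1" if "s \<in> {0..}" for s
        by (intro integrable_continuous continuous_intros continuous_on_compose2[OF k_cont])
           (use that in auto)
      show "continuous_on ({0..} \<times> cbox 0 1) (\<lambda>(s, \<sigma>). \<sigma>\<^sup>2 * k' (s * \<sigma>))"
        by (auto simp: split_def intro!: continuous_intros continuous_on_compose2[OF k'_cont])
    qed (use t in auto)
    then show ?thesis unfolding Q_def[abs_def] Q'_def cbox_interval by (rule DERIV_minus)
  qed
  have ode: "4 * (t * Q' t + 2 * Q t) + q t * (1 - t * (q t)\<^sup>2) = 0" if t: "0 \<le> t" for t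
  proof (cases "t = 0")
    case True
    have "((\<lambda>\<sigma>. \<sigma> * k 0) has_integral (1\<^sup>2 / 2 * k 0 - 0\<^sup>2 / 2 * k 0)) {0..1}"
      by (rule fundamental_theorem_of_calculus)
         (auto intro!: derivative_eq_intros simp: has_real_derivative_iff_has_vector_derivative[symmetric])
    from integral_unique[OF this] have "Q 0 = - (k 0 / 2)" by (simp add: Q_def)
    then show ?thesis using True by (simp add: k_def)
  next
    case False
    then have t: "0 < t" using t by simp
    have at: "at t within {0..} = at t" by (rule at_within_interior) (use t in simp)
    have "((\<lambda>t. t\<^sup>2 * Q t) has_real_derivative 2 * t * Q t + t\<^sup>2 * Q' t) (at t)"
      using Q_deriv[of t] t unfolding at by (auto intro!: derivative_eq_intros)
    then have "(p has_real_derivative 2 * t * Q t + t\<^sup>2 * Q' t) (at t)"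
      by (rule has_field_derivative_transform_within_open[where S = "{0<..}"]) (use t Q_eq in auto)
    from DERIV_unique[OF this p_deriv[OF t]]
    have "t * (2 * Q t + t * Q' t) = t * (- (q t * (1 - t * (q t)\<^sup>2) / 4))"
      by (simp add: field_simps power2_eq_square)
    then have "2 * Q t + t * Q' t = - (q t * (1 - t * (q t)\<^sup>2) / 4)"
      using t by (metis mult_left_cancel less_irrefl)
    then show ?thesis by simp
  qed
  show ?thesis
    by (rule that[OF q_deriv Q_deriv Q'_cont ode lo hi])
qed

section \<open>Decay of the radial derivative\<close>

text \<open>With the modulus \<open>f r = r * q (r\<^sup>2)\<close> the quantity in question is \<open>f'\<close>. The barriers confine \<open>f\<close> to a strip of
  width \<open>O (1 / r\<^sup>2)\<close> below \<open>1\<close>, so \<open>f'\<close> is of this order at some point of \<open>[r, r + 1]\<close>. The equation gives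
  \<open>(r f')' = O (1 / r)\<close>, so \<open>r f'\<close> varies by at most \<open>O (1 / r)\<close> on this interval, and the bound
  \<open>f' = O (1 / r\<^sup>2)\<close> extends to the whole interval. For \<open>t \<le> 1\<close> continuity suffices.\<close>

lemma radial_derivative_decay:
  fixes q q' q'' :: "real \<Rightarrow> real"
  assumes q: "\<And>t. 0 \<le> t \<Longrightarrow> (q has_real_derivative q' t) (at t within {0..})"
    and q': "\<And>t. 0 \<le> t \<Longrightarrow> (q' has_real_derivative q'' t) (at t within {0..})"
    and ode: "\<And>t. 0 \<le> t \<Longrightarrow> 4 * (t * q'' t + 2 * q' t) + q t * (1 - t * (q t)\<^sup>2) = 0"
    and lo: "\<And>t. 0 \<le> t \<Longrightarrow> barrier 4 t \<le> q t" and hi: "\<And>t. 0 \<le> t \<Longrightarrow> q t \<le> barrier 1 t"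
  obtains C where "\<And>t. 0 \<le> t \<Longrightarrow> \<bar>q t + 2 * t * q' t\<bar> \<le> C / (1 + t)"
proof -
  have pos: "0 < q t" if "0 \<le> t" for t
    using lo[OF that] barrier_pos[OF that, of 4] by linarith
  have sq_hi: "t * (q t)\<^sup>2 \<le> 1" if "0 \<le> t" for t
    using that pos[OF that] hi[OF that] by (intro barrier_le_of_between) auto
  have sq_lo: "1 - t * (q t)\<^sup>2 \<le> 4 / (t + 4)" if "0 \<le> t" for t
  proof -
    have "t * (barrier 4 t)\<^sup>2 \<le> t * (q t)\<^sup>2"
      using lo[OF that] barrier_pos[OF that, of 4] that by (intro mult_left_mono power_mono) auto
    then show ?thesis using that by (simp add: barrier_sq field_simps)
  qed
  have at: "at (r\<^sup>2) within {0..} = at (r\<^sup>2)" if "0 < r" for r :: real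
    by (rule at_within_interior) (use that in simp)
  define f where "f r = r * q (r\<^sup>2)" for r
  define f' where "f' r = q (r\<^sup>2) + 2 * r\<^sup>2 * q' (r\<^sup>2)" for r
  have f: "(f has_real_derivative f' r) (at r)" if "0 < r" for r
    unfolding f_def f'_def using q[of "r\<^sup>2"] unfolding at[OF that]
    by (auto intro!: derivative_eq_intros DERIV_chain2[of q] simp: power2_eq_square algebra_simps)
  \<comment> \<open>\<open>g\<close> is the derivative of \<open>r f'\<close>, rewritten with the differential equation as \<open>f / r - r f (1 - f\<^sup>2)\<close>.\<close>
  define g where "g r = q (r\<^sup>2) - r\<^sup>2 * q (r\<^sup>2) * (1 - r\<^sup>2 * (q (r\<^sup>2))\<^sup>2)" for r
  have g: "((\<lambda>r. r * f' r) has_real_derivative g r) (at r)" if "0 < r" for r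
  proof -
    have "((\<lambda>r. r * f' r) has_real_derivative
       q (r\<^sup>2) + 2 * r\<^sup>2 * q' (r\<^sup>2) + r * (2 * r * q' (r\<^sup>2) + 4 * r * q' (r\<^sup>2) + 4 * r\<^sup>2 * r * q'' (r\<^sup>2))) (at r)"
      unfolding f'_def using q[of "r\<^sup>2"] q'[of "r\<^sup>2"] unfolding at[OF that]
      by (auto intro!: derivative_eq_intros DERIV_chain2[of q] DERIV_chain2[of q'] simp: power2_eq_square algebra_simps)
    moreover have "q (r\<^sup>2) + 2 * r\<^sup>2 * q' (r\<^sup>2) + r * (2 * r * q' (r\<^sup>2) + 4 * r * q' (r\<^sup>2) + 4 * r\<^sup>2 * r * q'' (r\<^sup>2))
       = q (r\<^sup>2) + r\<^sup>2 * (4 * (r\<^sup>2 * q'' (r\<^sup>2) + 2 * q' (r\<^sup>2)))"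
      by (simp add: algebra_simps power2_eq_square)
    moreover have "4 * (r\<^sup>2 * q'' (r\<^sup>2) + 2 * q' (r\<^sup>2)) = - (q (r\<^sup>2) * (1 - r\<^sup>2 * (q (r\<^sup>2))\<^sup>2))"
      using ode[of "r\<^sup>2"] by simp
    moreover have "q (r\<^sup>2) + r\<^sup>2 * (- (q (r\<^sup>2) * (1 - r\<^sup>2 * (q (r\<^sup>2))\<^sup>2))) = g r"
      by (simp add: g_def)
    ultimately show ?thesis by (simp only:)
  qed
  have f01: "0 \<le> f r" "f r \<le> 1" "1 - f r \<le> 4 / r\<^sup>2" if r: "0 < r" for r
  proof -
    have sq: "(f r)\<^sup>2 = r\<^sup>2 * (q (r\<^sup>2))\<^sup>2" by (simp add: f_def power_mult_distrib)
    show 0: "0 \<le> f r" using pos[of "r\<^sup>2"] r by (simp add: f_def)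
    have "(f r)\<^sup>2 \<le> 1\<^sup>2" using sq_hi[of "r\<^sup>2"] by (simp add: sq)
    then show 1: "f r \<le> 1" by (rule power2_le_imp_le) simp
    have "f r * f r \<le> f r * 1" using 0 1 by (intro mult_left_mono) auto
    then have "1 - f r \<le> 1 - (f r)\<^sup>2" by (simp add: power2_eq_square)
    also have "\<dots> \<le> 4 / (r\<^sup>2 + 4)" using sq_lo[of "r\<^sup>2"] by (simp add: sq)
    also have "\<dots> \<le> 4 / r\<^sup>2" by (rule frac_le) (use r in auto)
    finally show "1 - f r \<le> 4 / r\<^sup>2" .
  qed
  have g_le: "\<bar>g r\<bar> \<le> 5 / r" if r: "0 < r" for r
  proof -
    have fr: "q (r\<^sup>2) = f r / r" using r by (simp add: f_def)
    have sq: "r\<^sup>2 * (q (r\<^sup>2))\<^sup>2 = (f r)\<^sup>2" by (simp add: f_def power_mult_distrib)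
    have d: "0 \<le> 1 - (f r)\<^sup>2" "1 - (f r)\<^sup>2 \<le> 4 / r\<^sup>2"
      using sq_hi[of "r\<^sup>2"] sq_lo[of "r\<^sup>2"] r order_trans[of "1 - (f r)\<^sup>2" "4 / (r\<^sup>2 + 4)" "4 / r\<^sup>2"]
      by (auto simp: sq frac_le)
    have "g r = f r / r - r * f r * (1 - (f r)\<^sup>2)"
      unfolding g_def sq using r by (simp add: f_def power2_eq_square)
    moreover have "0 \<le> f r / r" "f r / r \<le> 1 / r" using f01[OF r] r by (auto simp: divide_right_mono)
    moreover have "r * f r * (1 - (f r)\<^sup>2) \<le> r * 1 * (4 / r\<^sup>2)"
      using f01[OF r] d r by (intro mult_mono) auto
    moreover have "r * 1 * (4 / r\<^sup>2) = 4 / r" using r by (simp add: power2_eq_square)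
    moreover have "0 \<le> r * f r * (1 - (f r)\<^sup>2)" using f01[OF r] d r by simp
    moreover have "1 / r + 4 / r = 5 / r" "0 \<le> 1 / r" using r by (auto simp: add_divide_distrib[symmetric])
    ultimately show ?thesis by linarith
  qed
  have far: "\<bar>f' r\<bar> \<le> 13 / r\<^sup>2" if r: "1 \<le> r" for r
  proof -
    have r0: "0 < r" using r by simp
    obtain \<xi> where \<xi>: "r < \<xi>" "\<xi> < r + 1" "f (r + 1) - f r = (r + 1 - r) * f' \<xi>"
      using MVT2[of r "r + 1" f f'] f r by force
    obtain \<zeta> where \<zeta>: "r < \<zeta>" "\<zeta> < \<xi>" "\<xi> * f' \<xi> - r * f' r = (\<xi> - r) * g \<zeta>"
      using MVT2[of r \<xi> "\<lambda>r. r * f' r" g] g \<xi> r by force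
    have "\<bar>f' \<xi>\<bar> \<le> 4 / r\<^sup>2"
      using \<xi>(3) f01[OF r0] f01[of "r + 1"] r0 f01(3)[of "r+1"] frac_le[of 4 4 "r\<^sup>2" "(r + 1)\<^sup>2"]
      by (auto simp: abs_le_iff power2_eq_square algebra_simps)
    then have "\<xi> * \<bar>f' \<xi>\<bar> \<le> (2 * r) * (4 / r\<^sup>2)" using \<xi> r by (intro mult_mono) auto
    also have "\<dots> = 8 / r" using r by (simp add: power2_eq_square)
    finally have 1: "\<xi> * \<bar>f' \<xi>\<bar> \<le> 8 / r" .
    have "\<bar>g \<zeta>\<bar> \<le> 5 / \<zeta>" using g_le[of \<zeta>] \<zeta> r by simp
    also have "\<dots> \<le> 5 / r" using \<zeta> r by (intro divide_left_mono) auto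
    finally have "(\<xi> - r) * \<bar>g \<zeta>\<bar> \<le> 1 * (5 / r)" using \<xi> by (intro mult_mono) auto
    then have 2: "\<bar>(\<xi> - r) * g \<zeta>\<bar> \<le> 5 / r" using \<xi> by (simp add: abs_mult)
    have "\<bar>r * f' r\<bar> \<le> \<bar>\<xi> * f' \<xi>\<bar> + \<bar>(\<xi> - r) * g \<zeta>\<bar>" using \<zeta>(3) by linarith
    also have "\<dots> \<le> 8 / r + 5 / r" using 1 2 \<xi> r by (intro add_mono) (auto simp: abs_mult)
    finally have "r * \<bar>f' r\<bar> \<le> 13 / r" using r by (simp add: abs_mult)
    then show ?thesis using r by (simp add: field_simps power2_eq_square)
  qed
  have "continuous_on {0..} q" "continuous_on {0..} q'"
    using q q' by (auto intro!: DERIV_continuous_on)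
  then have "continuous_on {0..} (\<lambda>t. q t + 2 * t * q' t)"
    by (intro continuous_intros)
  then have "continuous_on {0..1} (\<lambda>t. q t + 2 * t * q' t)"
    by (rule continuous_on_subset) auto
  then have "bounded ((\<lambda>t. q t + 2 * t * q' t) ` {0..1})"
    by (intro compact_imp_bounded compact_continuous_image) auto
  then obtain K where K: "\<forall>t\<in>{0..1}. \<bar>q t + 2 * t * q' t\<bar> \<le> K"
    by (auto simp: bounded_iff)
  show ?thesis
  proof (rule that[of "max 26 (2 * K)"])
    fix t :: real assume t: "0 \<le> t"
    have "0 \<le> K" using bspec[OF K, of 0] by simp
    show "\<bar>q t + 2 * t * q' t\<bar> \<le> max 26 (2 * K) / (1 + t)"
    proof (cases "t \<le> 1")
      case True
      then have "\<bar>q t + 2 * t * q' t\<bar> \<le> K" using K t by simp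
      also have "K \<le> 2 * K / (1 + t)" using mult_left_mono[OF True \<open>0 \<le> K\<close>] t by (simp add: field_simps)
      also have "\<dots> \<le> max 26 (2 * K) / (1 + t)" using t by (intro divide_right_mono) auto
      finally show ?thesis .
    next
      case False
      then have "\<bar>q t + 2 * t * q' t\<bar> \<le> 13 / t" using far[of "sqrt t"] t by (simp add: f'_def)
      also have "\<dots> \<le> 26 / (1 + t)" using False by (simp add: field_simps)
      also have "\<dots> \<le> max 26 (2 * K) / (1 + t)" using t by (intro divide_right_mono) auto
      finally show ?thesis .
    qed
  qed
qed

section \<open>The rescaled vortex\<close>

text \<open>The function \<open>\<phi>\<close> is only differentiable from the right at \<open>0\<close>; this suffices because the squared norm
  takes values in \<open>{0..}\<close>, even along lines through the centre \<open>P\<close>.\<close>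

lemma has_real_derivative_radial:
  fixes x b P :: "'a::real_inner" and \<phi> :: "real \<Rightarrow> real"
  assumes \<phi>: "\<forall>t\<ge>0. (\<phi> has_real_derivative \<phi>' t) (at t within {0..})"
  shows "((\<lambda>s. \<phi> ((norm (x + s *\<^sub>R b - P))\<^sup>2)) has_real_derivative
     \<phi>' ((norm (x - P))\<^sup>2) * (2 * ((x - P) \<bullet> b))) (at 0)"
proof -
  let ?g = "\<lambda>s. (norm (x + s *\<^sub>R b - P))\<^sup>2"
  have g: "?g = (\<lambda>s. (norm (x - P))\<^sup>2 + s * (2 * ((x - P) \<bullet> b)) + s\<^sup>2 * (b \<bullet> b))"
  proof
    fix s
    have "x + s *\<^sub>R b - P = (x - P) + s *\<^sub>R b" by simp
    then show "?g s = (norm (x - P))\<^sup>2 + s * (2 * ((x - P) \<bullet> b)) + s\<^sup>2 * (b \<bullet> b)"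
      unfolding power2_norm_eq_inner
      by (simp only: inner_add_left inner_add_right inner_scaleR_left inner_scaleR_right)
         (simp add: inner_commute[of b "x - P"] power2_eq_square distrib_left)
  qed
  have "(?g has_real_derivative 2 * ((x - P) \<bullet> b)) (at 0)"
    unfolding g by (auto intro!: derivative_eq_intros)
  moreover have "(\<phi> has_real_derivative \<phi>' (?g 0)) (at (?g 0) within range ?g)"
    by (rule has_field_derivative_subset[OF \<phi>[rule_format]]) auto
  ultimately have "((\<phi> \<circ> ?g) has_real_derivative \<phi>' (?g 0) * (2 * ((x - P) \<bullet> b))) (at 0)"
    by (intro DERIV_image_chain)
  then show ?thesis by (simp add: o_def)
qed

lemma has_vector_derivative_radial:
  fixes x b P :: "'a::real_inner" and \<phi> :: "real \<Rightarrow> real"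
  assumes "\<forall>t\<ge>0. (\<phi> has_real_derivative \<phi>' t) (at t within {0..})"
    and "(F has_vector_derivative F') (at 0)"
  shows "((\<lambda>s. \<phi> ((norm (x + s *\<^sub>R b - P))\<^sup>2) *\<^sub>R F s) has_vector_derivative
     (\<phi> ((norm (x - P))\<^sup>2) *\<^sub>R F' + (2 * ((x - P) \<bullet> b) * \<phi>' ((norm (x - P))\<^sup>2)) *\<^sub>R F 0)) (at 0)"
  using has_vector_derivative_scaleR[OF has_real_derivative_radial[OF assms(1), where x = x and b = b and P = P] assms(2)]
  by (simp add: mult.commute)

lemma continuous_on_radial:
  fixes P :: "'a::real_normed_vector" and \<phi> :: "real \<Rightarrow> real"
  assumes "continuous_on {0..} \<phi>"
  shows "continuous_on S (\<lambda>x. \<phi> ((norm (x - P))\<^sup>2))"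
  by (rule continuous_on_compose2[OF assms]) (auto intro!: continuous_intros)

definition radial_field :: "(real \<Rightarrow> real) \<Rightarrow> 'a::real_inner \<Rightarrow> 'a \<Rightarrow> 'a" where
  "radial_field p P x = p ((norm (x - P))\<^sup>2) *\<^sub>R (x - P)"

context
  fixes p p' :: "real \<Rightarrow> real" and P :: "'a::euclidean_space"
  assumes p: "\<forall>t\<ge>0. (p has_real_derivative p' t) (at t within {0..})"
begin

lemma radial_field_has_derivative:
  "((\<lambda>s. radial_field p P (x + s *\<^sub>R b)) has_vector_derivative
     (p ((norm (x - P))\<^sup>2) *\<^sub>R b + (2 * ((x - P) \<bullet> b) * p' ((norm (x - P))\<^sup>2)) *\<^sub>R (x - P))) (at 0)"
proof -
  have "((\<lambda>s. x + s *\<^sub>R b - P) has_vector_derivative b) (at 0)"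
    by (auto intro!: derivative_eq_intros)
  from has_vector_derivative_radial[OF p this, of x b P] show ?thesis
    by (simp add: radial_field_def)
qed

lemma pderiv_along_radial_field:
  "pderiv_along b (radial_field p P) =
     (\<lambda>x. p ((norm (x - P))\<^sup>2) *\<^sub>R b + (2 * ((x - P) \<bullet> b) * p' ((norm (x - P))\<^sup>2)) *\<^sub>R (x - P))"
  unfolding pderiv_along_def
  by (intro ext vector_derivative_at radial_field_has_derivative)

end

context
  fixes p p' p'' :: "real \<Rightarrow> real" and P :: "'a::euclidean_space"
  assumes p: "\<forall>t\<ge>0. (p has_real_derivative p' t) (at t within {0..})"
    and p': "\<forall>t\<ge>0. (p' has_real_derivative p'' t) (at t within {0..})"
begin

lemma pderiv_radial_field_has_derivative:
  "((\<lambda>s. pderiv_along b (radial_field p P) (x + s *\<^sub>R c)) has_vector_derivative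
     (2 * ((x - P) \<bullet> c) * p' ((norm (x - P))\<^sup>2)) *\<^sub>R b
     + (2 * ((x - P) \<bullet> b) * p' ((norm (x - P))\<^sup>2)) *\<^sub>R c
     + (2 * (c \<bullet> b) * p' ((norm (x - P))\<^sup>2)
        + 4 * ((x - P) \<bullet> b) * ((x - P) \<bullet> c) * p'' ((norm (x - P))\<^sup>2)) *\<^sub>R (x - P)) (at 0)"
proof -
  have 1: "((\<lambda>s. b) has_vector_derivative 0) (at 0)"
    by (auto intro!: derivative_eq_intros)
  have 2: "((\<lambda>s. (2 * ((x + s *\<^sub>R c - P) \<bullet> b)) *\<^sub>R (x + s *\<^sub>R c - P)) has_vector_derivative
      (2 * ((x - P) \<bullet> b)) *\<^sub>R c + (2 * (c \<bullet> b)) *\<^sub>R (x - P)) (at 0)"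
  proof -
    have a: "((\<lambda>s. 2 * ((x + s *\<^sub>R c - P) \<bullet> b)) has_real_derivative 2 * (c \<bullet> b)) (at 0)"
      by (auto intro!: derivative_eq_intros simp: inner_simps)
    have b: "((\<lambda>s. x + s *\<^sub>R c - P) has_vector_derivative c) (at 0)"
      by (auto intro!: derivative_eq_intros)
    from has_vector_derivative_scaleR[OF a b] show ?thesis by simp
  qed
  have "(\<lambda>s. pderiv_along b (radial_field p P) (x + s *\<^sub>R c)) =
      (\<lambda>s. p ((norm (x + s *\<^sub>R c - P))\<^sup>2) *\<^sub>R b
        + p' ((norm (x + s *\<^sub>R c - P))\<^sup>2) *\<^sub>R ((2 * ((x + s *\<^sub>R c - P) \<bullet> b)) *\<^sub>R (x + s *\<^sub>R c - P)))"
    by (simp only: pderiv_along_radial_field[OF p] scaleR_scaleR mult.commute)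
  with has_vector_derivative_add[OF has_vector_derivative_radial[OF p 1, of x c P]
      has_vector_derivative_radial[OF p' 2, of x c P]]
  show ?thesis
    by (simp add: scaleR_add_right scaleR_add_left mult_ac add_ac)
qed

lemma pderiv_along_pderiv_radial_field:
  "pderiv_along c (pderiv_along b (radial_field p P)) = (\<lambda>x.
     (2 * ((x - P) \<bullet> c) * p' ((norm (x - P))\<^sup>2)) *\<^sub>R b
     + (2 * ((x - P) \<bullet> b) * p' ((norm (x - P))\<^sup>2)) *\<^sub>R c
     + (2 * (c \<bullet> b) * p' ((norm (x - P))\<^sup>2)
        + 4 * ((x - P) \<bullet> b) * ((x - P) \<bullet> c) * p'' ((norm (x - P))\<^sup>2)) *\<^sub>R (x - P))"
  unfolding pderiv_along_def[of c "pderiv_along b (radial_field p P)"]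
  by (intro ext vector_derivative_at pderiv_radial_field_has_derivative)

lemma continuous_on_radial_field: "continuous_on S (radial_field p P)"
  unfolding radial_field_def
  by (intro continuous_intros continuous_on_radial DERIV_continuous_on[OF p[rule_format]]) auto

lemma C2_on_radial_field:
  assumes p'': "continuous_on {0..} p''"
  shows "C2_on S (radial_field p P)"
proof -
  have "continuous_on {0..} p" "continuous_on {0..} p'"
    using p p' by (auto intro!: DERIV_continuous_on)
  note cont = this[THEN continuous_on_radial]
    continuous_on_radial[OF p'']
  have "continuous_on S (pderiv_along b (radial_field p P))" for b
    unfolding pderiv_along_radial_field[OF p] by (intro continuous_intros cont)
  moreover have "continuous_on S (pderiv_along c (pderiv_along b (radial_field p P)))" for b c
    unfolding pderiv_along_pderiv_radial_field by (intro continuous_intros cont)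
  ultimately show ?thesis
    unfolding C2_on_def C1_on_def
    using radial_field_has_derivative[OF p] pderiv_radial_field_has_derivative
    by (blast intro: differentiableI_vector)
qed

end

lemma Basis_complex: "Basis = {1, \<i>}" "(1::complex) \<noteq> \<i>"
  by (auto simp: Basis_complex_def complex_eq_iff)

lemma laplacian_radial_field:
  fixes P :: complex
  assumes p: "\<forall>t\<ge>0. (p has_real_derivative p' t) (at t within {0..})"
    and p': "\<forall>t\<ge>0. (p' has_real_derivative p'' t) (at t within {0..})"
  defines "t \<equiv> \<lambda>x. (norm (x - P))\<^sup>2"
  shows "laplacian (radial_field p P) x = (4 * (t x * p'' (t x) + 2 * p' (t x))) *\<^sub>R (x - P)"
proof -
  have t: "t x = (Re (x - P))\<^sup>2 + (Im (x - P))\<^sup>2" by (simp add: t_def cmod_power2)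
  define B D a b where ab: "B = p' (t x)" "D = p'' (t x)" "a = Re (x - P)" "b = Im (x - P)"
  have "laplacian (radial_field p P) x =
     (2 * a * B) *\<^sub>R 1 + (2 * a * B) *\<^sub>R 1 + (2 * B + 4 * a * a * D) *\<^sub>R (x - P)
     + ((2 * b * B) *\<^sub>R \<i> + (2 * b * B) *\<^sub>R \<i> + (2 * B + 4 * b * b * D) *\<^sub>R (x - P))"
    unfolding laplacian_def Basis_complex pderiv_along_pderiv_radial_field[OF p p'] ab t_def
    using Basis_complex(2) by (simp add: inner_complex_def)
  also have "\<dots> = (4 * ((a\<^sup>2 + b\<^sup>2) * D + 2 * B)) *\<^sub>R (x - P)"
    by (simp add: complex_eq_iff ab(3,4)[symmetric] algebra_simps power2_eq_square)
       (simp add: ab algebra_simps)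
  finally show ?thesis unfolding ab t[symmetric] .
qed

text \<open>The two squares are the angular and the radial part of the gradient: for the modulus \<open>f r = r * p (r\<^sup>2)\<close>
  they are \<open>(f / r)\<^sup>2\<close> and \<open>f'\<^sup>2\<close>.\<close>

lemma grad_norm_sq_radial_field:
  fixes P :: complex
  assumes p: "\<forall>t\<ge>0. (p has_real_derivative p' t) (at t within {0..})"
  defines "t \<equiv> \<lambda>x. (norm (x - P))\<^sup>2"
  shows "grad_norm_sq (radial_field p P) x = (p (t x))\<^sup>2 + (p (t x) + 2 * t x * p' (t x))\<^sup>2"
proof -
  have t: "t x = (Re (x - P))\<^sup>2 + (Im (x - P))\<^sup>2" by (simp add: t_def cmod_power2)
  define A B a b where ab: "A = p (t x)" "B = p' (t x)" "a = Re (x - P)" "b = Im (x - P)"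
  have "grad_norm_sq (radial_field p P) x =
     (A + 2 * a * B * a)\<^sup>2 + (2 * a * B * b)\<^sup>2 + ((2 * b * B * a)\<^sup>2 + (A + 2 * b * B * b)\<^sup>2)"
    unfolding grad_norm_sq_def Basis_complex pderiv_along_radial_field[OF p] ab t_def
    using Basis_complex(2) by (simp add: cmod_power2 inner_complex_def)
  also have "\<dots> = A\<^sup>2 + (A + 2 * (a\<^sup>2 + b\<^sup>2) * B)\<^sup>2"
    by (simp add: algebra_simps power2_eq_square)
  finally show ?thesis unfolding ab t[symmetric] .
qed

text \<open>The bound is linear in the direction \<open>b\<close>, of arbitrary length, as the tangential derivative at a
  corner of a polygon is taken along an unspecified vector.\<close>

lemma norm_pderiv_along_radial_field_le:
  fixes P :: "'a::euclidean_space"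
  assumes p: "\<forall>t\<ge>0. (p has_real_derivative p' t) (at t within {0..})"
  defines "t \<equiv> \<lambda>x. (norm (x - P))\<^sup>2"
  shows "norm (pderiv_along b (radial_field p P) x)
     \<le> norm b * (2 * \<bar>p (t x)\<bar> + \<bar>p (t x) + 2 * t x * p' (t x)\<bar>)"
proof -
  have "\<bar>(x - P) \<bullet> b\<bar> * norm (x - P) \<le> (norm (x - P) * norm b) * norm (x - P)"
    by (intro mult_right_mono Cauchy_Schwarz_ineq2) auto
  then have "\<bar>(x - P) \<bullet> b\<bar> * norm (x - P) \<le> t x * norm b"
    by (simp add: t_def power2_eq_square mult_ac)
  then have "2 * \<bar>p' (t x)\<bar> * (\<bar>(x - P) \<bullet> b\<bar> * norm (x - P)) \<le> 2 * \<bar>p' (t x)\<bar> * (t x * norm b)"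
    by (rule mult_left_mono) simp
  moreover have "norm (pderiv_along b (radial_field p P) x)
      \<le> \<bar>p (t x)\<bar> * norm b + 2 * \<bar>p' (t x)\<bar> * (\<bar>(x - P) \<bullet> b\<bar> * norm (x - P))"
    unfolding pderiv_along_radial_field[OF p] t_def
    by (rule order_trans[OF norm_triangle_ineq]) (simp add: abs_mult mult_ac)
  moreover have "norm b * \<bar>2 * t x * p' (t x)\<bar> \<le> norm b * (\<bar>p (t x)\<bar> + \<bar>p (t x) + 2 * t x * p' (t x)\<bar>)"
    by (intro mult_left_mono) auto
  moreover have "\<bar>2 * t x * p' (t x)\<bar> = 2 * \<bar>p' (t x)\<bar> * t x" by (simp add: abs_mult t_def)
  ultimately show ?thesis by (simp add: algebra_simps)
qed

locale vortex_profile =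
  fixes q q' q'' :: "real \<Rightarrow> real" and C :: real
  assumes q_deriv: "\<And>t. 0 \<le> t \<Longrightarrow> (q has_real_derivative q' t) (at t within {0..})"
    and q'_deriv: "\<And>t. 0 \<le> t \<Longrightarrow> (q' has_real_derivative q'' t) (at t within {0..})"
    and q''_cont: "continuous_on {0..} q''"
    and ode: "\<And>t. 0 \<le> t \<Longrightarrow> 4 * (t * q'' t + 2 * q' t) + q t * (1 - t * (q t)\<^sup>2) = 0"
    and lower: "\<And>t. 0 \<le> t \<Longrightarrow> barrier 4 t \<le> q t"
    and upper: "\<And>t. 0 \<le> t \<Longrightarrow> q t \<le> barrier 1 t"
    and decay: "\<And>t. 0 \<le> t \<Longrightarrow> \<bar>q t + 2 * t * q' t\<bar> \<le> C / (1 + t)"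
begin

definition vortex :: "real \<Rightarrow> complex \<Rightarrow> complex \<Rightarrow> complex" where
  "vortex \<epsilon> = radial_field (\<lambda>t. q (t / \<epsilon>\<^sup>2) / \<epsilon>)"

lemma q_pos: "0 \<le> t \<Longrightarrow> 0 < q t"
  using lower[of t] barrier_pos[of t 4] by linarith

lemma q_sq_le: "0 \<le> t \<Longrightarrow> (q t)\<^sup>2 \<le> 1 / (1 + t)"
proof -
  assume t: "0 \<le> t"
  have "(q t)\<^sup>2 \<le> (barrier 1 t)\<^sup>2" using upper[OF t] q_pos[OF t] by (intro power_mono) auto
  then show ?thesis using t by (simp add: barrier_sq add.commute)
qed

lemma potential_le: "0 \<le> t \<Longrightarrow> (1 - t * (q t)\<^sup>2)\<^sup>2 \<le> (4 / (1 + t))\<^sup>2"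
proof (rule power_mono)
  assume t: "0 \<le> t"
  have "t * (q t)\<^sup>2 \<le> t * (1 / (1 + t))" using t by (intro mult_left_mono q_sq_le)
  also have "\<dots> \<le> 1" using t by simp
  finally show "0 \<le> 1 - t * (q t)\<^sup>2" by simp
  have "(barrier 4 t)\<^sup>2 \<le> (q t)\<^sup>2" using lower[OF t] barrier_pos[OF t, of 4] by (intro power_mono) auto
  then have "t * (1 / (t + 4)) \<le> t * (q t)\<^sup>2" using t by (intro mult_left_mono) (auto simp: barrier_sq)
  then have "1 - t * (q t)\<^sup>2 \<le> 1 - t * (1 / (t + 4))" by simp
  also have "\<dots> = 4 / (t + 4)" using t by (simp add: field_simps)
  also have "\<dots> \<le> 4 / (1 + t)" by (rule frac_le) (use t in auto)
  finally show "1 - t * (q t)\<^sup>2 \<le> 4 / (1 + t)" .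
qed

context
  fixes \<epsilon> :: real assumes \<epsilon>: "0 < \<epsilon>"
begin

lemma scaled_derivs:
  shows "\<forall>t\<ge>0. ((\<lambda>t. q (t / \<epsilon>\<^sup>2) / \<epsilon>) has_real_derivative q' (t / \<epsilon>\<^sup>2) / \<epsilon> ^ 3) (at t within {0..})"
    and "\<forall>t\<ge>0. ((\<lambda>t. q' (t / \<epsilon>\<^sup>2) / \<epsilon> ^ 3) has_real_derivative q'' (t / \<epsilon>\<^sup>2) / \<epsilon> ^ 5) (at t within {0..})"
proof -
  have *: "((\<lambda>t. f (t / \<epsilon>\<^sup>2) / c) has_real_derivative f' (t / \<epsilon>\<^sup>2) / (\<epsilon>\<^sup>2 * c)) (at t within {0..})"
    if f: "\<And>t. 0 \<le> t \<Longrightarrow> (f has_real_derivative f' t) (at t within {0..})" and t: "0 \<le> t"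
    for f f' :: "real \<Rightarrow> real" and c t
  proof -
    have "(f has_real_derivative f' (t / \<epsilon>\<^sup>2)) (at (t / \<epsilon>\<^sup>2) within (\<lambda>t. t / \<epsilon>\<^sup>2) ` {0..})"
      by (rule has_field_derivative_subset[OF f]) (use t in auto)
    then have "((f \<circ> (\<lambda>t. t / \<epsilon>\<^sup>2)) has_real_derivative f' (t / \<epsilon>\<^sup>2) * (1 / \<epsilon>\<^sup>2)) (at t within {0..})"
      by (rule DERIV_image_chain) (rule DERIV_cdivide[OF DERIV_ident])
    from DERIV_cdivide[OF this, of c] show ?thesis by (simp add: o_def)
  qed
  have e: "\<epsilon> ^ 3 = \<epsilon>\<^sup>2 * \<epsilon>" "\<epsilon> ^ 5 = \<epsilon>\<^sup>2 * \<epsilon> ^ 3" by (simp_all add: numeral_eq_Suc)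
  show "\<forall>t\<ge>0. ((\<lambda>t. q (t / \<epsilon>\<^sup>2) / \<epsilon>) has_real_derivative q' (t / \<epsilon>\<^sup>2) / \<epsilon> ^ 3) (at t within {0..})"
    unfolding e(1) by (intro allI impI *[OF q_deriv])
  show "\<forall>t\<ge>0. ((\<lambda>t. q' (t / \<epsilon>\<^sup>2) / \<epsilon> ^ 3) has_real_derivative q'' (t / \<epsilon>\<^sup>2) / \<epsilon> ^ 5) (at t within {0..})"
    unfolding e(2) by (intro allI impI *[OF q'_deriv])
qed

lemma scaled_cont: "continuous_on {0..} (\<lambda>t. q'' (t / \<epsilon>\<^sup>2) / \<epsilon> ^ 5)"
  by (intro continuous_intros continuous_on_compose2[OF q''_cont]) (use \<epsilon> in auto)

lemma norm_vortex_sq: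
  "(norm (vortex \<epsilon> P x))\<^sup>2 = (norm (x - P))\<^sup>2 / \<epsilon>\<^sup>2 * (q ((norm (x - P))\<^sup>2 / \<epsilon>\<^sup>2))\<^sup>2"
  by (simp add: vortex_def radial_field_def power_mult_distrib power_divide)

lemma C2_on_vortex: "C2_on S (vortex \<epsilon> P)"
  unfolding vortex_def by (rule C2_on_radial_field[OF scaled_derivs scaled_cont])

lemma continuous_on_vortex: "continuous_on S (vortex \<epsilon> P)"
  unfolding vortex_def by (rule continuous_on_radial_field[OF scaled_derivs])

lemma vortex_differentiable: "(\<lambda>s. vortex \<epsilon> P (x + s *\<^sub>R b)) differentiable (at 0)"
  unfolding vortex_def
  by (rule differentiableI_vector[OF radial_field_has_derivative[OF scaled_derivs(1)]])

lemma vortex_equation: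
  "- laplacian (vortex \<epsilon> P) x = (1 / \<epsilon>\<^sup>2) *\<^sub>R ((1 - (norm (vortex \<epsilon> P x))\<^sup>2) *\<^sub>R vortex \<epsilon> P x)"
proof -
  define t where "t = (norm (x - P))\<^sup>2"
  define s where "s = t / \<epsilon>\<^sup>2"
  have s: "0 \<le> s" by (simp add: s_def t_def)
  have "4 * (t * (q'' s / \<epsilon> ^ 5) + 2 * (q' s / \<epsilon> ^ 3)) = 4 * (s * q'' s + 2 * q' s) / \<epsilon> ^ 3"
    using \<epsilon> by (simp add: s_def field_simps power_add[symmetric] power2_eq_square numeral_eq_Suc)
  also have "4 * (s * q'' s + 2 * q' s) = - (q s * (1 - s * (q s)\<^sup>2))" using ode[OF s] by linarith
  finally have *: "4 * (t * (q'' s / \<epsilon> ^ 5) + 2 * (q' s / \<epsilon> ^ 3)) = - (1 / \<epsilon>\<^sup>2 * ((1 - s * (q s)\<^sup>2) * (q s / \<epsilon>)))"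
    by (simp add: power2_eq_square power3_eq_cube)
  have "laplacian (vortex \<epsilon> P) x = (4 * (t * (q'' s / \<epsilon> ^ 5) + 2 * (q' s / \<epsilon> ^ 3))) *\<^sub>R (x - P)"
    unfolding vortex_def laplacian_radial_field[OF scaled_derivs] t_def s_def by simp
  then show ?thesis unfolding *
    by (simp add: norm_vortex_sq t_def[symmetric] s_def[symmetric])
       (simp add: vortex_def radial_field_def t_def[symmetric] s_def[symmetric])
qed

lemma scaled_bounds:
  fixes x P :: complex
  defines "t \<equiv> (norm (x - P))\<^sup>2"
  shows "(q (t / \<epsilon>\<^sup>2) / \<epsilon>)\<^sup>2 \<le> 1 / (\<epsilon>\<^sup>2 + t)"
    and "(q (t / \<epsilon>\<^sup>2) / \<epsilon> + 2 * t * (q' (t / \<epsilon>\<^sup>2) / \<epsilon> ^ 3))\<^sup>2 \<le> C\<^sup>2 * \<epsilon>\<^sup>2 / (\<epsilon>\<^sup>2 + t)\<^sup>2"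
    and "1 / (4 * \<epsilon>\<^sup>2) * (1 - (norm (vortex \<epsilon> P x))\<^sup>2)\<^sup>2 \<le> 4 * \<epsilon>\<^sup>2 / (\<epsilon>\<^sup>2 + t)\<^sup>2"
proof -
  define s where "s = t / \<epsilon>\<^sup>2"
  have s: "0 \<le> s" by (simp add: s_def t_def)
  have t: "\<epsilon>\<^sup>2 + t = \<epsilon>\<^sup>2 * (1 + s)" using \<epsilon> by (simp add: s_def field_simps)
  show "(q (t / \<epsilon>\<^sup>2) / \<epsilon>)\<^sup>2 \<le> 1 / (\<epsilon>\<^sup>2 + t)"
    using divide_right_mono[OF q_sq_le[OF s], of "\<epsilon>\<^sup>2"]
    unfolding t s_def[symmetric] by (simp add: power_divide mult_ac)
  have "q s / \<epsilon> + 2 * t * (q' s / \<epsilon> ^ 3) = (q s + 2 * s * q' s) / \<epsilon>"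
    using \<epsilon> by (simp add: s_def field_simps power3_eq_cube power2_eq_square)
  moreover have "(q s + 2 * s * q' s)\<^sup>2 \<le> (C / (1 + s))\<^sup>2"
    using power_mono[OF decay[OF s], of 2] by simp
  ultimately show "(q (t / \<epsilon>\<^sup>2) / \<epsilon> + 2 * t * (q' (t / \<epsilon>\<^sup>2) / \<epsilon> ^ 3))\<^sup>2 \<le> C\<^sup>2 * \<epsilon>\<^sup>2 / (\<epsilon>\<^sup>2 + t)\<^sup>2"
    using \<epsilon> divide_right_mono[of "(q s + 2 * s * q' s)\<^sup>2" "(C / (1 + s))\<^sup>2" "\<epsilon>\<^sup>2"]
    unfolding t s_def[symmetric] by (simp add: power_divide power_mult_distrib power2_eq_square mult_ac)
  have "1 / (4 * \<epsilon>\<^sup>2) * (1 - (norm (vortex \<epsilon> P x))\<^sup>2)\<^sup>2 = 1 / (4 * \<epsilon>\<^sup>2) * (1 - s * (q s)\<^sup>2)\<^sup>2"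
    by (simp add: norm_vortex_sq s_def t_def)
  also have "\<dots> \<le> 1 / (4 * \<epsilon>\<^sup>2) * (4 / (1 + s))\<^sup>2"
    by (intro mult_left_mono potential_le s) simp
  also have "\<dots> = 4 * \<epsilon>\<^sup>2 / (\<epsilon>\<^sup>2 + t)\<^sup>2"
    unfolding t using \<epsilon> by (simp add: power_divide power_mult_distrib power2_eq_square mult_ac)
  finally show "1 / (4 * \<epsilon>\<^sup>2) * (1 - (norm (vortex \<epsilon> P x))\<^sup>2)\<^sup>2 \<le> 4 * \<epsilon>\<^sup>2 / (\<epsilon>\<^sup>2 + t)\<^sup>2" .
qed

text \<open>The first term comes from the phase and is the only one that produces a logarithm; the radial
  derivative and the potential only contribute to the second, whose integral over the plane is
  bounded independently of \<open>\<epsilon>\<close>.\<close>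

lemma energy_density_le:
  "1/2 * grad_norm_sq (vortex \<epsilon> P) x + 1 / (4 * \<epsilon>\<^sup>2) * (1 - (norm (vortex \<epsilon> P x))\<^sup>2)\<^sup>2
     \<le> 1/2 * (1 / (\<epsilon>\<^sup>2 + (norm (x - P))\<^sup>2)) + (C\<^sup>2 + 4) * (\<epsilon>\<^sup>2 / (\<epsilon>\<^sup>2 + (norm (x - P))\<^sup>2)\<^sup>2)"
proof -
  define D E where "D = 1 / (\<epsilon>\<^sup>2 + (norm (x - P))\<^sup>2)" and "E = \<epsilon>\<^sup>2 / (\<epsilon>\<^sup>2 + (norm (x - P))\<^sup>2)\<^sup>2"
  note b = scaled_bounds[where x = x and P = P, unfolded times_divide_eq_right[symmetric],
      folded D_def E_def]
  have "0 \<le> C\<^sup>2 * E" by (simp add: E_def)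
  moreover have "(C\<^sup>2 + 4) * E = C\<^sup>2 * E + 4 * E" by (simp add: algebra_simps)
  moreover have "grad_norm_sq (vortex \<epsilon> P) x \<le> D + C\<^sup>2 * E"
    unfolding vortex_def grad_norm_sq_radial_field[OF scaled_derivs(1)]
    using b(1,2) by simp
  ultimately show ?thesis
    unfolding D_def[symmetric] E_def[symmetric] using b(3) by simp
qed

lemma boundary_density_le:
  "1/2 * (norm (pderiv_along b (vortex \<epsilon> P) x))\<^sup>2 + 1 / (4 * \<epsilon>\<^sup>2) * (1 - (norm (vortex \<epsilon> P x))\<^sup>2)\<^sup>2
     \<le> ((norm b)\<^sup>2 * (4 + C\<^sup>2) + 4) / (\<epsilon>\<^sup>2 + (norm (x - P))\<^sup>2)"
proof -
  define t where "t = (norm (x - P))\<^sup>2"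
  have t: "0 \<le> t" by (simp add: t_def)
  define E where "E = 1 / (\<epsilon>\<^sup>2 + t)"
  have "\<epsilon>\<^sup>2 / (\<epsilon>\<^sup>2 + t)\<^sup>2 \<le> (\<epsilon>\<^sup>2 + t) / (\<epsilon>\<^sup>2 + t)\<^sup>2" using t by (intro divide_right_mono) auto
  also have "\<dots> = E" using \<epsilon> t by (simp add: E_def power2_eq_square)
  finally have E: "\<epsilon>\<^sup>2 / (\<epsilon>\<^sup>2 + t)\<^sup>2 \<le> E" .
  define A B where "A = q (t / \<epsilon>\<^sup>2) / \<epsilon>" and "B = A + 2 * t * (q' (t / \<epsilon>\<^sup>2) / \<epsilon> ^ 3)"
  have A: "A\<^sup>2 \<le> E" using scaled_bounds(1)[where x = x and P = P] by (simp add: A_def E_def t_def)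
  have "B\<^sup>2 \<le> C\<^sup>2 * (\<epsilon>\<^sup>2 / (\<epsilon>\<^sup>2 + t)\<^sup>2)" using scaled_bounds(2)[where x = x and P = P] by (simp add: A_def B_def t_def)
  also have "\<dots> \<le> C\<^sup>2 * E" by (intro mult_left_mono E) simp
  finally have B: "B\<^sup>2 \<le> C\<^sup>2 * E" .
  have "4 * (\<epsilon>\<^sup>2 / (\<epsilon>\<^sup>2 + t)\<^sup>2) \<le> 4 * E" using E by simp
  then have V: "1 / (4 * \<epsilon>\<^sup>2) * (1 - (norm (vortex \<epsilon> P x))\<^sup>2)\<^sup>2 \<le> 4 * E"
    using scaled_bounds(3)[where x = x and P = P] by (simp add: t_def)
  have "norm (pderiv_along b (vortex \<epsilon> P) x) \<le> norm b * (2 * \<bar>A\<bar> + \<bar>B\<bar>)"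
    using norm_pderiv_along_radial_field_le[OF scaled_derivs(1), of b P x]
    by (simp add: vortex_def A_def B_def t_def)
  then have "(norm (pderiv_along b (vortex \<epsilon> P) x))\<^sup>2 \<le> (norm b * (2 * \<bar>A\<bar> + \<bar>B\<bar>))\<^sup>2"
    by (rule power_mono) simp
  also have "\<dots> = (norm b)\<^sup>2 * (2 * \<bar>A\<bar> + \<bar>B\<bar>)\<^sup>2" by (rule power_mult_distrib)
  also have "\<dots> \<le> (norm b)\<^sup>2 * (2 * (4 * E + C\<^sup>2 * E))"
  proof (rule mult_left_mono)
    have "0 \<le> (2 * \<bar>A\<bar> - \<bar>B\<bar>)\<^sup>2" by simp
    then have "(2 * \<bar>A\<bar> + \<bar>B\<bar>)\<^sup>2 \<le> 2 * (4 * A\<^sup>2 + B\<^sup>2)"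
      by (simp add: power2_eq_square algebra_simps abs_mult[symmetric])
    also have "\<dots> \<le> 2 * (4 * E + C\<^sup>2 * E)" using A B by (intro mult_left_mono add_mono) auto
    finally show "(2 * \<bar>A\<bar> + \<bar>B\<bar>)\<^sup>2 \<le> 2 * (4 * E + C\<^sup>2 * E)" .
  qed simp
  finally have "1/2 * (norm (pderiv_along b (vortex \<epsilon> P) x))\<^sup>2 + 1 / (4 * \<epsilon>\<^sup>2) * (1 - (norm (vortex \<epsilon> P x))\<^sup>2)\<^sup>2
     \<le> (norm b)\<^sup>2 * (4 * E + C\<^sup>2 * E) + 4 * E" using V by linarith
  also have "\<dots> = ((norm b)\<^sup>2 * (4 + C\<^sup>2) + 4) * E" by (simp add: algebra_simps)
  finally show ?thesis by (simp add: E_def t_def)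
qed

text \<open>The phase of the vortex is exactly that of \<open>z - P\<close>, so on a circle around \<open>P\<close> the normalised field runs
  once around the unit circle.\<close>

lemma degree_one_vortex_vortex:
  assumes "0 < r" "ball P r \<subseteq> \<Omega>"
  shows "degree_one_vortex \<Omega> (vortex \<epsilon> P) P"
proof -
  have v: "vortex \<epsilon> P x = complex_of_real (q ((norm (x - P))\<^sup>2 / \<epsilon>\<^sup>2) / \<epsilon>) * (x - P)" for x
    by (simp add: vortex_def radial_field_def scaleR_conv_of_real)
  have pos: "0 < q ((norm (x - P))\<^sup>2 / \<epsilon>\<^sup>2) / \<epsilon>" for x
    using \<epsilon> q_pos[of "(norm (x - P))\<^sup>2 / \<epsilon>\<^sup>2"] by simp
  have "(\<lambda>t. vortex \<epsilon> P (circlepath P s t) / of_real (norm (vortex \<epsilon> P (circlepath P s t)))) = circlepath 0 1"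
    if s: "0 < s" for s
  proof
    fix t
    have nrm: "norm (vortex \<epsilon> P x) = q ((norm (x - P))\<^sup>2 / \<epsilon>\<^sup>2) / \<epsilon> * norm (x - P)" for x
      unfolding v norm_mult norm_of_real abs_of_pos[OF pos] ..
    have *: "of_real a * z / of_real (a * n) = z / of_real n" if "0 < a" for a n :: real and z :: complex
      using that by simp
    have "vortex \<epsilon> P x / of_real (norm (vortex \<epsilon> P x)) = (x - P) / of_real (norm (x - P))" for x
      unfolding nrm unfolding v by (rule *[OF pos])
    moreover have "norm (exp (2 * complex_of_real pi * \<i> * complex_of_real t)) = 1"
      by (simp add: norm_exp_eq_Re)
    ultimately show "vortex \<epsilon> P (circlepath P s t) / of_real (norm (vortex \<epsilon> P (circlepath P s t))) = circlepath 0 1 t"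
      using s by (simp add: circlepath norm_mult)
  qed
  then have "winding_number (\<lambda>t. vortex \<epsilon> P (circlepath P s t) / of_real (norm (vortex \<epsilon> P (circlepath P s t)))) 0 = 1"
    if "0 < s" for s using that by (simp add: winding_number_circlepath_centre)
  moreover have "vortex \<epsilon> P x \<noteq> 0" if "x \<noteq> P" for x 
    using pos[of x] that by (metis less_irrefl mult_eq_0_iff of_real_eq_0_iff right_minus_eq v)
  ultimately show ?thesis
    unfolding degree_one_vortex_def using assms by (auto simp: v intro!: exI[of _ r])
qed

lemma GL_solution_vortex: "GL_solution \<epsilon> \<Omega> (vortex \<epsilon> P) (vortex \<epsilon> P)"
  unfolding GL_solution_def tangentially_differentiable_on_def
  using C2_on_vortex continuous_on_vortex vortex_equation vortex_differentiable by blast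

end

end

section \<open>Integrals over planar regions\<close>

lemma Complex_measurable [measurable]:
  "(\<lambda>p. Complex (fst p) (snd p)) \<in> borel_measurable (lborel \<Otimes>\<^sub>M lborel)"
  unfolding Complex_eq by measurable

lemma lborel_complex_eq:
  "(lborel :: complex measure) = distr (lborel \<Otimes>\<^sub>M lborel) borel (\<lambda>p. Complex (fst p) (snd p))"
proof (rule lborel_eqI)
  fix l u :: complex
  assume le: "\<And>b. b \<in> Basis \<Longrightarrow> l \<bullet> b \<le> u \<bullet> b"
  then have le: "Re l \<le> Re u" "Im l \<le> Im u"
    using le[of 1] le[of \<i>] by (auto simp: Basis_complex_def inner_complex_def)
  have "(\<lambda>p. Complex (fst p) (snd p)) -` box l u \<inter> space (lborel \<Otimes>\<^sub>M lborel)
      = {Re l<..<Re u} \<times> {Im l<..<Im u}"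
    by (auto simp: box_def Basis_complex_def inner_complex_def space_pair_measure)
  then show "emeasure (distr (lborel \<Otimes>\<^sub>M lborel) borel (\<lambda>p. Complex (fst p) (snd p))) (box l u)
      = (\<Prod>b\<in>Basis. (u - l) \<bullet> b)"
    using le by (subst emeasure_distr)
      (auto simp: lborel.emeasure_pair_measure_Times Basis_complex_def inner_complex_def
         complex_eq_iff ennreal_mult)
qed simp

lemma nn_integral_complex:
  assumes [measurable]: "f \<in> borel_measurable borel"
  shows "(\<integral>\<^sup>+z. f z \<partial>lborel) = (\<integral>\<^sup>+x. \<integral>\<^sup>+y. f (Complex x y) \<partial>lborel \<partial>lborel)"
proof -
  have "(\<integral>\<^sup>+z. f z \<partial>lborel) = (\<integral>\<^sup>+p. f (Complex (fst p) (snd p)) \<partial>(lborel \<Otimes>\<^sub>M lborel))"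
    by (subst lborel_complex_eq, subst nn_integral_distr) auto
  also have "\<dots> = (\<integral>\<^sup>+x. \<integral>\<^sup>+y. f (Complex x y) \<partial>lborel \<partial>lborel)"
    by (subst lborel.nn_integral_fst[symmetric]) auto
  finally show ?thesis .
qed

lemma arctan_scaled_has_derivative:
  fixes a y :: real
  assumes "0 < a"
  shows "((\<lambda>y. arctan (y / a) / a) has_real_derivative 1 / (a\<^sup>2 + y\<^sup>2)) (at y)"
proof -
  have "((\<lambda>y. arctan (y / a) / a) has_real_derivative 1 / (1 + (y / a)\<^sup>2) * (1 / a) / a) (at y)"
    using assms by (auto intro!: derivative_eq_intros simp: divide_inverse mult_ac)
  moreover have "1 / (1 + (y / a)\<^sup>2) * (1 / a) / a = 1 / (a\<^sup>2 * (1 + (y / a)\<^sup>2))"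
    by (simp add: power2_eq_square)
  moreover have "a\<^sup>2 * (1 + (y / a)\<^sup>2) = a\<^sup>2 + y\<^sup>2"
    using assms by (simp add: distrib_left power_divide)
  ultimately show ?thesis by (simp only:)
qed

lemma cauchy_density_integral:
  fixes a m :: real
  assumes a: "0 < a"
  shows "(\<integral>\<^sup>+y. ennreal (1 / (a\<^sup>2 + (y - m)\<^sup>2)) \<partial>lborel) \<le> ennreal (pi / a)"
proof -
  define f where "f y = ennreal (1 / (a\<^sup>2 + y\<^sup>2))" for y
  have [measurable]: "f \<in> borel_measurable borel" unfolding f_def by measurable
  have half: "(\<integral>\<^sup>+y. f y * indicator {0..} y \<partial>lborel) = ennreal (pi / (2 * a))"
  proof -
    have "(\<integral>\<^sup>+y. ennreal (1 / (a\<^sup>2 + y\<^sup>2)) * indicator {0..} y \<partial>lborel)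
        = ennreal (pi / 2 / a - arctan (0 / a) / a)"
    proof (rule nn_integral_FTC_atLeast)
      fix y :: real
      show "((\<lambda>y. arctan (y / a) / a) has_real_derivative 1 / (a\<^sup>2 + y\<^sup>2)) (at y)"
        by (rule arctan_scaled_has_derivative[OF a])
      show "((\<lambda>y. arctan (y / a) / a) \<longlongrightarrow> pi / 2 / a) at_top"
        using a by real_asymp (simp add: field_simps)
    qed auto
    then show ?thesis by (simp add: f_def)
  qed
  have "(\<integral>\<^sup>+y. ennreal (1 / (a\<^sup>2 + (y - m)\<^sup>2)) \<partial>lborel) = (\<integral>\<^sup>+y. f y \<partial>lborel)"
    using nn_integral_real_affine[of "\<lambda>y. f (y - m)" 1 m] by (simp add: f_def)
  also have "\<dots> \<le> (\<integral>\<^sup>+y. f y * indicator {0..} y + f (- y) * indicator {0..} (- y) \<partial>lborel)"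
    by (rule nn_integral_mono) (auto simp: f_def indicator_def)
  also have "\<dots> = (\<integral>\<^sup>+y. f y * indicator {0..} y \<partial>lborel) + (\<integral>\<^sup>+y. f (- y) * indicator {0..} (- y) \<partial>lborel)"
    by (rule nn_integral_add) auto
  also have "(\<integral>\<^sup>+y. f (- y) * indicator {0..} (- y) \<partial>lborel) = (\<integral>\<^sup>+y. f y * indicator {0..} y \<partial>lborel)"
    using nn_integral_real_affine[of "\<lambda>y. f y * indicator {0..} y" "- 1" 0] by simp
  finally show ?thesis
    unfolding half using a by (simp add: ennreal_plus[symmetric] del: ennreal_plus)
qed

text \<open>Since \<open>(\<epsilon>\<^sup>2 + a + b)\<^sup>2 \<ge> (\<epsilon>\<^sup>2 + a) (\<epsilon>\<^sup>2 + b)\<close>, the integrand is dominated by \<open>\<epsilon>\<^sup>2\<close> times a product of two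
  Cauchy densities in the real and imaginary part, each of integral \<open>\<pi> / \<epsilon>\<close>.\<close>

lemma core_integral:
  fixes \<epsilon> :: real and P :: complex
  assumes "0 < \<epsilon>"
  shows "(\<integral>\<^sup>+z. ennreal (\<epsilon>\<^sup>2 / (\<epsilon>\<^sup>2 + (norm (z - P))\<^sup>2)\<^sup>2) \<partial>lborel) \<le> ennreal (pi\<^sup>2)"
proof -
  have le: "ennreal (\<epsilon>\<^sup>2 / (\<epsilon>\<^sup>2 + (norm (Complex x y - P))\<^sup>2)\<^sup>2)
     \<le> ennreal (\<epsilon>\<^sup>2) * ennreal (1 / (\<epsilon>\<^sup>2 + (x - Re P)\<^sup>2)) * ennreal (1 / (\<epsilon>\<^sup>2 + (y - Im P)\<^sup>2))" for x y
  proof -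
    define a b where "a = (x - Re P)\<^sup>2" and "b = (y - Im P)\<^sup>2"
    have ab: "0 \<le> a" "0 \<le> b" by (auto simp: a_def b_def)
    have "(\<epsilon>\<^sup>2 + a) * (\<epsilon>\<^sup>2 + b) \<le> (\<epsilon>\<^sup>2 + (a + b))\<^sup>2"
      unfolding power2_eq_square[of "_ + _"] using ab by (intro mult_mono) auto
    then have "\<epsilon>\<^sup>2 / (\<epsilon>\<^sup>2 + (a + b))\<^sup>2 \<le> \<epsilon>\<^sup>2 / ((\<epsilon>\<^sup>2 + a) * (\<epsilon>\<^sup>2 + b))"
      using assms ab by (intro divide_left_mono mult_pos_pos zero_less_power add_pos_nonneg) auto
    also have "\<dots> = \<epsilon>\<^sup>2 * (1 / (\<epsilon>\<^sup>2 + a)) * (1 / (\<epsilon>\<^sup>2 + b))" by simp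
    finally have "ennreal (\<epsilon>\<^sup>2 / (\<epsilon>\<^sup>2 + (a + b))\<^sup>2) \<le> ennreal (\<epsilon>\<^sup>2 * (1 / (\<epsilon>\<^sup>2 + a)) * (1 / (\<epsilon>\<^sup>2 + b)))"
      by (rule ennreal_leI)
    also have "\<dots> = ennreal (\<epsilon>\<^sup>2) * ennreal (1 / (\<epsilon>\<^sup>2 + a)) * ennreal (1 / (\<epsilon>\<^sup>2 + b))"
      using ab by (subst ennreal_mult, simp, simp, subst ennreal_mult) auto
    finally show ?thesis by (simp add: cmod_power2 a_def b_def)
  qed
  have "(\<integral>\<^sup>+z. ennreal (\<epsilon>\<^sup>2 / (\<epsilon>\<^sup>2 + (norm (z - P))\<^sup>2)\<^sup>2) \<partial>lborel)
      = (\<integral>\<^sup>+x. \<integral>\<^sup>+y. ennreal (\<epsilon>\<^sup>2 / (\<epsilon>\<^sup>2 + (norm (Complex x y - P))\<^sup>2)\<^sup>2) \<partial>lborel \<partial>lborel)"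
    by (rule nn_integral_complex) measurable
  also have "\<dots> \<le> (\<integral>\<^sup>+x. \<integral>\<^sup>+y. ennreal (\<epsilon>\<^sup>2) * ennreal (1 / (\<epsilon>\<^sup>2 + (x - Re P)\<^sup>2))
      * ennreal (1 / (\<epsilon>\<^sup>2 + (y - Im P)\<^sup>2)) \<partial>lborel \<partial>lborel)"
    by (rule nn_integral_mono, rule nn_integral_mono, rule le)
  also have "\<dots> = (\<integral>\<^sup>+x. ennreal (\<epsilon>\<^sup>2) * ennreal (1 / (\<epsilon>\<^sup>2 + (x - Re P)\<^sup>2))
      * (\<integral>\<^sup>+y. ennreal (1 / (\<epsilon>\<^sup>2 + (y - Im P)\<^sup>2)) \<partial>lborel) \<partial>lborel)"
    by (subst nn_integral_cmult) auto
  also have "\<dots> = ennreal (\<epsilon>\<^sup>2) * (\<integral>\<^sup>+x. ennreal (1 / (\<epsilon>\<^sup>2 + (x - Re P)\<^sup>2)) \<partial>lborel)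
      * (\<integral>\<^sup>+y. ennreal (1 / (\<epsilon>\<^sup>2 + (y - Im P)\<^sup>2)) \<partial>lborel)"
    by (subst nn_integral_multc, measurable, subst nn_integral_cmult, measurable)
  also have "\<dots> \<le> ennreal (\<epsilon>\<^sup>2) * ennreal (pi / \<epsilon>) * ennreal (pi / \<epsilon>)"
    by (rule mult_mono, rule mult_left_mono)
       (use assms in \<open>auto intro: cauchy_density_integral\<close>)
  also have "\<dots> = ennreal (\<epsilon>\<^sup>2 * (pi / \<epsilon>) * (pi / \<epsilon>))"
    using assms by (subst ennreal_mult, simp, simp, subst ennreal_mult) auto
  also have "\<epsilon>\<^sup>2 * (pi / \<epsilon>) * (pi / \<epsilon>) = pi\<^sup>2" using assms by (simp add: power2_eq_square)
  finally show ?thesis .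
qed

lemma arsinh_le_ln:
  fixes u :: real
  assumes "0 \<le> u" shows "arsinh u \<le> ln (1 + 2 * u)"
proof -
  have "sqrt (u\<^sup>2 + 1) \<le> sqrt ((u + 1)\<^sup>2)"
    using assms by (intro real_sqrt_le_mono) (simp add: power2_eq_square algebra_simps)
  then have "sqrt (u\<^sup>2 + 1) \<le> u + 1" using assms by simp
  moreover have "0 < u + sqrt (u\<^sup>2 + 1)" using assms by (intro add_nonneg_pos) (auto simp: add_nonneg_pos)
  ultimately show ?thesis unfolding arsinh_real_def using assms by (subst ln_le_cancel_iff) auto
qed

text \<open>Integrating over whole vertical lines turns the integrand into \<open>\<pi> / sqrt (\<epsilon>\<^sup>2 + (x - \<rho>)\<^sup>2)\<close>, whose primitive is
  an inverse hyperbolic sine. The factor \<open>2 \<pi>\<close> is that of a full disc.\<close>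

lemma near_integral:
  fixes \<epsilon> \<rho> L :: real
  assumes "0 < \<epsilon>" "0 \<le> \<rho>" "\<rho> \<le> L"
  shows "(\<integral>\<^sup>+z. ennreal (1 / (\<epsilon>\<^sup>2 + (norm (z - of_real \<rho>))\<^sup>2)) * indicator {z. 0 \<le> Re z \<and> Re z \<le> L} z \<partial>lborel)
     \<le> ennreal (2 * pi * ln (1 + 2 * (L / \<epsilon>)))"
proof -
  define s where "s x = sqrt (\<epsilon>\<^sup>2 + (x - \<rho>)\<^sup>2)" for x
  have s: "0 < s x" "(s x)\<^sup>2 = \<epsilon>\<^sup>2 + (x - \<rho>)\<^sup>2" for x
    using assms by (auto simp: s_def add_pos_nonneg)
  have "{z. 0 \<le> Re z \<and> Re z \<le> L} \<in> sets borel"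
    by (intro borel_closed closed_Collect_conj closed_Collect_le continuous_intros)
  then have "(\<integral>\<^sup>+z. ennreal (1 / (\<epsilon>\<^sup>2 + (norm (z - of_real \<rho>))\<^sup>2)) * indicator {z. 0 \<le> Re z \<and> Re z \<le> L} z \<partial>lborel)
     = (\<integral>\<^sup>+x. \<integral>\<^sup>+y. ennreal (1 / (\<epsilon>\<^sup>2 + (norm (Complex x y - of_real \<rho>))\<^sup>2))
         * indicator {z. 0 \<le> Re z \<and> Re z \<le> L} (Complex x y) \<partial>lborel \<partial>lborel)"
    by (intro nn_integral_complex) measurable
  also have "\<dots> = (\<integral>\<^sup>+x. \<integral>\<^sup>+y. ennreal (1 / ((s x)\<^sup>2 + (y - 0)\<^sup>2)) * indicator {0..L} x \<partial>lborel \<partial>lborel)"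
    unfolding s(2) by (simp add: cmod_power2 indicator_def add_ac)
  also have "\<dots> = (\<integral>\<^sup>+x. (\<integral>\<^sup>+y. ennreal (1 / ((s x)\<^sup>2 + (y - 0)\<^sup>2)) \<partial>lborel) * indicator {0..L} x \<partial>lborel)"
    by (subst nn_integral_multc) auto
  also have "\<dots> \<le> (\<integral>\<^sup>+x. ennreal (pi / s x) * indicator {0..L} x \<partial>lborel)"
    by (intro nn_integral_mono mult_right_mono cauchy_density_integral s) auto
  also have "\<dots> = ennreal (pi * arsinh ((L - \<rho>) / \<epsilon>) - pi * arsinh ((0 - \<rho>) / \<epsilon>))"
  proof (rule nn_integral_FTC_Icc[where F = "\<lambda>x. pi * arsinh ((x - \<rho>) / \<epsilon>)"])
    show "(\<lambda>x. pi / s x) \<in> borel_measurable borel" unfolding s_def by measurable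
    fix x assume "x \<in> {0..L}"
    show "0 \<le> pi / s x" using s(1)[of x] by simp
    have eq: "\<epsilon> * sqrt (((x - \<rho>) / \<epsilon>)\<^sup>2 + 1) = s x"
    proof (rule power2_eq_imp_eq)
      show "(\<epsilon> * sqrt (((x - \<rho>) / \<epsilon>)\<^sup>2 + 1))\<^sup>2 = (s x)\<^sup>2"
        unfolding s(2) using assms by (simp add: power_mult_distrib power_divide field_simps)
    qed (use s(1)[of x] assms in auto)
    have "((\<lambda>x. (x - \<rho>) / \<epsilon>) has_real_derivative 1 / \<epsilon>) (at x)"
      using assms by (auto intro!: derivative_eq_intros)
    from DERIV_chain2[OF arsinh_real_has_field_derivative[of "(x - \<rho>) / \<epsilon>" UNIV] this]
    have "((\<lambda>x. pi * arsinh ((x - \<rho>) / \<epsilon>)) has_real_derivative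
        pi * (1 / sqrt (((x - \<rho>) / \<epsilon>)\<^sup>2 + 1) * (1 / \<epsilon>))) (at x)"
      by (rule DERIV_cmult)
    also have "pi * (1 / sqrt (((x - \<rho>) / \<epsilon>)\<^sup>2 + 1) * (1 / \<epsilon>)) = pi / s x"
      unfolding eq[symmetric] by (simp add: mult_ac)
    finally show "((\<lambda>x. pi * arsinh ((x - \<rho>) / \<epsilon>)) has_real_derivative pi / s x) (at x)" .
  qed (use assms in auto)
  also have "\<dots> \<le> ennreal (2 * pi * ln (1 + 2 * (L / \<epsilon>)))"
  proof (rule ennreal_leI)
    have "arsinh ((L - \<rho>) / \<epsilon>) \<le> ln (1 + 2 * (L / \<epsilon>))"
    proof -
      have "arsinh ((L - \<rho>) / \<epsilon>) \<le> ln (1 + 2 * ((L - \<rho>) / \<epsilon>))" using assms by (intro arsinh_le_ln) auto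
      also have "\<dots> \<le> ln (1 + 2 * (L / \<epsilon>))"
        using assms by (intro ln_mono) (auto simp: divide_right_mono add_pos_nonneg)
      finally show ?thesis .
    qed
    moreover have "arsinh (\<rho> / \<epsilon>) \<le> ln (1 + 2 * (L / \<epsilon>))"
    proof -
      have "arsinh (\<rho> / \<epsilon>) \<le> ln (1 + 2 * (\<rho> / \<epsilon>))" using assms by (intro arsinh_le_ln) auto
      also have "\<dots> \<le> ln (1 + 2 * (L / \<epsilon>))"
        using assms by (intro ln_mono) (auto simp: divide_right_mono add_pos_nonneg)
      finally show ?thesis .
    qed
    moreover have "arsinh ((0 - \<rho>) / \<epsilon>) = - arsinh (\<rho> / \<epsilon>)" by (simp add: arsinh_minus_real)
    ultimately have "pi * (arsinh ((L - \<rho>) / \<epsilon>) - arsinh ((0 - \<rho>) / \<epsilon>)) \<le> pi * (2 * ln (1 + 2 * (L / \<epsilon>)))"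
      by (intro mult_left_mono) auto
    then show "pi * arsinh ((L - \<rho>) / \<epsilon>) - pi * arsinh ((0 - \<rho>) / \<epsilon>) \<le> 2 * pi * ln (1 + 2 * (L / \<epsilon>))"
      by (simp add: algebra_simps)
  qed
  finally show ?thesis .
qed

text \<open>The cross-section of the cone at height \<open>x\<close> contributes \<open>2 arctan (tan (\<theta> / 2)) / x = \<theta> / x\<close>, which is
  where the opening angle enters.\<close>

lemma far_integral:
  fixes \<theta> a c :: real
  assumes \<theta>: "0 < \<theta>" "\<theta> < pi" and a: "0 < a" "a \<le> c"
  shows "(\<integral>\<^sup>+z. ennreal (1 / (norm z)\<^sup>2) * indicator {z. a \<le> Re z \<and> Re z \<le> c \<and> \<bar>Im z\<bar> \<le> Re z * tan (\<theta> / 2)} z \<partial>lborel)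
     = ennreal (\<theta> * ln (c / a))"
proof -
  define \<tau> where "\<tau> = tan (\<theta> / 2)"
  have \<tau>: "0 < \<tau>" using \<theta> by (auto simp: \<tau>_def intro!: tan_gt_zero)
  have at: "arctan \<tau> = \<theta> / 2" unfolding \<tau>_def using \<theta> by (intro arctan_tan) auto
  have "{z. a \<le> Re z \<and> Re z \<le> c \<and> \<bar>Im z\<bar> \<le> Re z * \<tau>} \<in> sets borel"
    by (intro borel_closed closed_Collect_conj closed_Collect_le continuous_intros)
  then have "(\<integral>\<^sup>+z. ennreal (1 / (norm z)\<^sup>2) * indicator {z. a \<le> Re z \<and> Re z \<le> c \<and> \<bar>Im z\<bar> \<le> Re z * \<tau>} z \<partial>lborel)
     = (\<integral>\<^sup>+x. \<integral>\<^sup>+y. ennreal (1 / (norm (Complex x y))\<^sup>2)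
         * indicator {z. a \<le> Re z \<and> Re z \<le> c \<and> \<bar>Im z\<bar> \<le> Re z * \<tau>} (Complex x y) \<partial>lborel \<partial>lborel)"
    by (intro nn_integral_complex) measurable
  also have "\<dots> = (\<integral>\<^sup>+x. (\<integral>\<^sup>+y. (ennreal (1 / (x\<^sup>2 + y\<^sup>2)) * indicator {- (x * \<tau>)..x * \<tau>} y) * indicator {a..c} x \<partial>lborel) \<partial>lborel)"
    by (intro nn_integral_cong) (auto simp: cmod_power2 indicator_def)
  also have "\<dots> = (\<integral>\<^sup>+x. (\<integral>\<^sup>+y. ennreal (1 / (x\<^sup>2 + y\<^sup>2)) * indicator {- (x * \<tau>)..x * \<tau>} y \<partial>lborel) * indicator {a..c} x \<partial>lborel)"
    by (subst nn_integral_multc) auto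
  also have "\<dots> = (\<integral>\<^sup>+x. ennreal (\<theta> / x) * indicator {a..c} x \<partial>lborel)"
  proof (rule nn_integral_cong)
    fix x
    have "(\<integral>\<^sup>+y. ennreal (1 / (x\<^sup>2 + y\<^sup>2)) * indicator {- (x * \<tau>)..x * \<tau>} y \<partial>lborel) = ennreal (\<theta> / x)"
      if x: "0 < x"
    proof -
      have "(\<integral>\<^sup>+y. ennreal (1 / (x\<^sup>2 + y\<^sup>2)) * indicator {- (x * \<tau>)..x * \<tau>} y \<partial>lborel)
          = ennreal (arctan (x * \<tau> / x) / x - arctan (- (x * \<tau>) / x) / x)"
      proof (rule nn_integral_FTC_Icc)
        fix y :: real
        show "((\<lambda>y. arctan (y / x) / x) has_real_derivative 1 / (x\<^sup>2 + y\<^sup>2)) (at y)"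
          by (rule arctan_scaled_has_derivative[OF x])
        show "- (x * \<tau>) \<le> x * \<tau>" using x \<tau> by simp
      qed auto
      also have "arctan (x * \<tau> / x) / x - arctan (- (x * \<tau>) / x) / x = \<theta> / x"
        using x at by (simp add: arctan_minus add_divide_distrib[symmetric])
      finally show ?thesis .
    qed
    then show "(\<integral>\<^sup>+y. ennreal (1 / (x\<^sup>2 + y\<^sup>2)) * indicator {- (x * \<tau>)..x * \<tau>} y \<partial>lborel) * indicator {a..c} x
        = ennreal (\<theta> / x) * indicator {a..c} x"
      using a by (auto simp: indicator_def)
  qed
  also have "\<dots> = ennreal (\<theta> * ln c - \<theta> * ln a)"
    by (rule nn_integral_FTC_Icc)
       (use a \<theta> in \<open>auto intro!: derivative_eq_intros\<close>)
  also have "\<theta> * ln c - \<theta> * ln a = \<theta> * ln (c / a)" using a by (simp add: ln_div algebra_simps)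
  finally show ?thesis unfolding \<tau>_def .
qed

text \<open>The cone is cut at \<open>Re z = \<Lambda> * \<rho>\<close>. Beyond the cut, \<open>\<bar>z - \<rho>\<bar>\<close> is at least
  \<open>1 - 1 / \<Lambda>\<close> times \<open>\<bar>z\<bar>\<close>, so the vortex may be moved to the apex at the cost of a factor close to \<open>1\<close> for large \<open>\<Lambda>\<close>.\<close>

lemma cone_energy_bound:
  fixes \<epsilon> \<rho> \<theta> \<Lambda> K c :: real
  assumes \<epsilon>: "0 < \<epsilon>" and \<rho>: "0 < \<rho>" and \<theta>: "0 < \<theta>" "\<theta> < pi" and \<Lambda>: "1 < \<Lambda>" and K: "0 \<le> K"
    and c: "c \<le> 1" "\<Lambda> * \<rho> \<le> c"
    and \<Omega>: "\<Omega> \<subseteq> {z. 0 \<le> Re z \<and> Re z \<le> c \<and> \<bar>Im z\<bar> \<le> Re z * tan (\<theta> / 2)}"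
  shows "(\<integral>\<^sup>+z\<in>\<Omega>. ennreal (1/2 * (1 / (\<epsilon>\<^sup>2 + (norm (z - of_real \<rho>))\<^sup>2))
      + K * (\<epsilon>\<^sup>2 / (\<epsilon>\<^sup>2 + (norm (z - of_real \<rho>))\<^sup>2)\<^sup>2)) \<partial>lborel)
    \<le> ennreal (pi * ln (1 + 2 * (\<Lambda> * \<rho> / \<epsilon>)) + \<theta> / 2 / (1 - 1 / \<Lambda>)\<^sup>2 * ln (1 / \<rho>) + K * pi\<^sup>2)"
proof -
  define P where "P = complex_of_real \<rho>"
  define N where "N = {z. 0 \<le> Re z \<and> Re z \<le> \<Lambda> * \<rho>}"
  define F where "F = {z. \<Lambda> * \<rho> \<le> Re z \<and> Re z \<le> c \<and> \<bar>Im z\<bar> \<le> Re z * tan (\<theta> / 2)}"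
  define \<kappa> where "\<kappa> = 1 / (1 - 1 / \<Lambda>)\<^sup>2"
  have \<kappa>: "0 \<le> \<kappa>" by (simp add: \<kappa>_def)
  define e where "e z = 1 / (\<epsilon>\<^sup>2 + (norm (z - P))\<^sup>2)" for z
  define k where "k z = \<epsilon>\<^sup>2 / (\<epsilon>\<^sup>2 + (norm (z - P))\<^sup>2)\<^sup>2" for z
  have nonneg: "0 \<le> e z" "0 \<le> k z" for z by (auto simp: e_def k_def)
  have [measurable]: "N \<in> sets borel" "F \<in> sets borel" unfolding N_def F_def
    by (intro borel_closed closed_Collect_conj closed_Collect_le continuous_intros)+
  have [measurable]: "e \<in> borel_measurable borel" "k \<in> borel_measurable borel"
    unfolding e_def k_def by measurable
  have far: "e z \<le> \<kappa> * (1 / (norm z)\<^sup>2)" if "z \<in> F" for z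
  proof -
    have re: "\<Lambda> * \<rho> \<le> norm z" using that abs_Re_le_cmod[of z] by (auto simp: F_def)
    have z: "0 < norm z" using re \<Lambda> \<rho> by (meson less_le_trans mult_pos_pos less_trans zero_less_one)
    have "norm z * (1 - 1 / \<Lambda>) \<le> norm z - \<rho>"
      using re \<Lambda> by (simp add: field_simps)
    also have "\<dots> \<le> norm (z - P)"
      using norm_triangle_ineq2[of z P] \<rho> by (simp add: P_def)
    finally have "(norm z * (1 - 1 / \<Lambda>))\<^sup>2 \<le> (norm (z - P))\<^sup>2"
      using \<Lambda> by (intro power_mono) auto
    then have "(norm z * (1 - 1 / \<Lambda>))\<^sup>2 \<le> \<epsilon>\<^sup>2 + (norm (z - P))\<^sup>2"
      using zero_le_power2[of \<epsilon>] by linarith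
    then have "e z \<le> 1 / (norm z * (1 - 1 / \<Lambda>))\<^sup>2"
      unfolding e_def using z \<Lambda> by (intro divide_left_mono) (use \<epsilon> in \<open>auto intro!: mult_pos_pos add_pos_nonneg\<close>)
    then show ?thesis by (simp add: \<kappa>_def power_mult_distrib mult.commute)
  qed
  have split: "ennreal (1/2 * e z + K * k z) * indicator \<Omega> z
     \<le> ennreal (1/2) * (ennreal (e z) * indicator N z)
       + ennreal (\<kappa> / 2) * (ennreal (1 / (norm z)\<^sup>2) * indicator F z) + ennreal K * ennreal (k z)" for z
  proof (cases "z \<in> \<Omega>")
    case True
    then have "z \<in> N \<or> z \<in> F" using \<Omega> by (auto simp: N_def F_def)
    have eq: "ennreal (1/2 * e z + K * k z) = ennreal (1/2) * ennreal (e z) + ennreal K * ennreal (k z)"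
    proof -
      have "ennreal (1/2 * e z + K * k z) = ennreal (1/2 * e z) + ennreal (K * k z)"
        by (rule ennreal_plus) (use nonneg K in auto)
      also have "ennreal (1/2 * e z) = ennreal (1/2) * ennreal (e z)"
        by (rule ennreal_mult) (use nonneg in auto)
      also have "ennreal (K * k z) = ennreal K * ennreal (k z)"
        by (rule ennreal_mult) (use nonneg K in auto)
      finally show ?thesis .
    qed
    have "ennreal (1/2) * ennreal (e z) \<le> ennreal (\<kappa> / 2) * ennreal (1 / (norm z)\<^sup>2)" if "z \<in> F"
    proof -
      have "ennreal (1/2 * e z) \<le> ennreal (\<kappa> / 2 * (1 / (norm z)\<^sup>2))"
        using far[OF that] by (intro ennreal_leI) simp
      then show ?thesis using nonneg \<kappa> by (subst (asm) (1 2) ennreal_mult) auto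
    qed
    then have "ennreal (1/2) * ennreal (e z) \<le> ennreal (1/2) * (ennreal (e z) * indicator N z)
       + ennreal (\<kappa> / 2) * (ennreal (1 / (norm z)\<^sup>2) * indicator F z)"
      using \<open>z \<in> N \<or> z \<in> F\<close> by (auto simp: indicator_def intro: add_increasing)
    then show ?thesis using True unfolding eq by (simp add: add_right_mono)
  qed simp
  have "(\<integral>\<^sup>+z\<in>\<Omega>. ennreal (1/2 * e z + K * k z) \<partial>lborel)
     \<le> (\<integral>\<^sup>+z. ennreal (1/2) * (ennreal (e z) * indicator N z)
       + ennreal (\<kappa> / 2) * (ennreal (1 / (norm z)\<^sup>2) * indicator F z) + ennreal K * ennreal (k z) \<partial>lborel)"
    by (rule nn_integral_mono) (rule split)
  also have "\<dots> = (\<integral>\<^sup>+z. ennreal (1/2) * (ennreal (e z) * indicator N z) \<partial>lborel)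
      + (\<integral>\<^sup>+z. ennreal (\<kappa> / 2) * (ennreal (1 / (norm z)\<^sup>2) * indicator F z) \<partial>lborel)
      + (\<integral>\<^sup>+z. ennreal K * ennreal (k z) \<partial>lborel)"
    by (subst nn_integral_add, measurable, subst nn_integral_add, measurable)
  also have "\<dots> = ennreal (1/2) * (\<integral>\<^sup>+z. ennreal (e z) * indicator N z \<partial>lborel)
      + ennreal (\<kappa> / 2) * (\<integral>\<^sup>+z. ennreal (1 / (norm z)\<^sup>2) * indicator F z \<partial>lborel)
      + ennreal K * (\<integral>\<^sup>+z. ennreal (k z) \<partial>lborel)"
    by (subst (1 2 3) nn_integral_cmult) measurable
  also have "\<dots> \<le> ennreal (1/2) * ennreal (2 * pi * ln (1 + 2 * (\<Lambda> * \<rho> / \<epsilon>)))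
      + ennreal (\<kappa> / 2) * ennreal (\<theta> * ln (1 / \<rho>)) + ennreal K * ennreal (pi\<^sup>2)"
  proof (intro add_mono mult_left_mono)
    show "(\<integral>\<^sup>+z. ennreal (e z) * indicator N z \<partial>lborel) \<le> ennreal (2 * pi * ln (1 + 2 * (\<Lambda> * \<rho> / \<epsilon>)))"
      unfolding e_def N_def P_def using \<epsilon> \<rho> \<Lambda> by (intro near_integral) auto
    have "(\<integral>\<^sup>+z. ennreal (1 / (norm z)\<^sup>2) * indicator F z \<partial>lborel) = ennreal (\<theta> * ln (c / (\<Lambda> * \<rho>)))"
      unfolding F_def using \<theta> \<Lambda> \<rho> c by (intro far_integral) auto
    also have "\<dots> \<le> ennreal (\<theta> * ln (1 / \<rho>))"
    proof (intro ennreal_leI mult_left_mono ln_mono)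
      have "0 < \<Lambda> * \<rho>" using \<Lambda> \<rho> by simp
      then show "0 < c / (\<Lambda> * \<rho>)" using c by simp
      have "\<rho> \<le> \<Lambda> * \<rho>" using \<Lambda> \<rho> by simp
      then show "c / (\<Lambda> * \<rho>) \<le> 1 / \<rho>" using c \<rho> \<open>0 < \<Lambda> * \<rho>\<close> by (intro frac_le) auto
    qed (use \<theta> \<rho> in auto)
    finally show "(\<integral>\<^sup>+z. ennreal (1 / (norm z)\<^sup>2) * indicator F z \<partial>lborel) \<le> ennreal (\<theta> * ln (1 / \<rho>))" .
    show "(\<integral>\<^sup>+z. ennreal (k z) \<partial>lborel) \<le> ennreal (pi\<^sup>2)"
      unfolding k_def by (rule core_integral[OF \<epsilon>])
  qed auto
  also have "\<dots> = ennreal (pi * ln (1 + 2 * (\<Lambda> * \<rho> / \<epsilon>)) + \<theta> / 2 / (1 - 1 / \<Lambda>)\<^sup>2 * ln (1 / \<rho>) + K * pi\<^sup>2)"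
  proof -
    have "\<rho> \<le> \<Lambda> * \<rho>" using \<Lambda> \<rho> by simp
    then have "\<rho> \<le> 1" using c by linarith
    then have l: "0 \<le> ln (1 / \<rho>)" using \<rho> by (simp add: ln_div)
    have n: "0 \<le> ln (1 + 2 * (\<Lambda> * \<rho> / \<epsilon>))" using \<Lambda> \<rho> \<epsilon> by (intro ln_ge_zero) auto
    have "ennreal (1/2) * ennreal (2 * pi * ln (1 + 2 * (\<Lambda> * \<rho> / \<epsilon>))) = ennreal (pi * ln (1 + 2 * (\<Lambda> * \<rho> / \<epsilon>)))"
      using n by (subst ennreal_mult[symmetric]) auto
    moreover have "ennreal (\<kappa> / 2) * ennreal (\<theta> * ln (1 / \<rho>)) = ennreal (\<theta> / 2 / (1 - 1 / \<Lambda>)\<^sup>2 * ln (1 / \<rho>))"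
      using l \<kappa> \<theta> by (subst ennreal_mult[symmetric]) (auto simp: \<kappa>_def)
    moreover have "ennreal K * ennreal (pi\<^sup>2) = ennreal (K * pi\<^sup>2)"
      using K by (subst ennreal_mult[symmetric]) auto
    ultimately show ?thesis using n l K \<theta> by (simp add: ennreal_plus)
  qed
  finally show ?thesis unfolding e_def k_def P_def .
qed

section \<open>The cone and the length measure on its boundary\<close>

text \<open>The segment is covered by its \<open>n\<close> parts of equal length, with \<open>n\<close> large in terms of \<open>\<delta>\<close>.\<close>

lemma hausdorff1_closed_segment_le:
  fixes a b :: "'a::euclidean_space"
  shows "emeasure hausdorff1 (closed_segment a b) \<le> ennreal (dist a b)"
proof -
  have "hausdorff1_pre \<delta> (closed_segment a b) \<le> ennreal (dist a b)" if \<delta>: "0 < \<delta>" for \<delta>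
  proof -
    obtain n :: nat where n: "dist a b / \<delta> < real n" using reals_Archimedean2 by blast
    have "0 \<le> dist a b / \<delta>" using \<delta> by simp
    then have n0: "0 < real n" using n by linarith
    have nd: "dist a b / real n \<le> \<delta>" using n n0 \<delta> by (simp add: field_simps)
    define U where "U i = (if i < n then (\<lambda>u. a + u *\<^sub>R (b - a)) ` {real i / real n..(real i + 1) / real n} else {})"
      for i
    have cover: "closed_segment a b \<subseteq> (\<Union>i. U i)"
    proof
      fix x assume "x \<in> closed_segment a b"
      then obtain u where u: "0 \<le> u" "u \<le> 1" "x = (1 - u) *\<^sub>R a + u *\<^sub>R b"
        by (auto simp: closed_segment_def)
      then have x: "x = a + u *\<^sub>R (b - a)" by (simp add: algebra_simps)
      define i where "i = (if u = 1 then n - 1 else nat \<lfloor>u * real n\<rfloor>)"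
      have "i < n \<and> real i / real n \<le> u \<and> u \<le> (real i + 1) / real n"
      proof (cases "u = 1")
        case True
        then show ?thesis using n0 by (simp add: i_def of_nat_diff)
      next
        case False
        then have "u * real n < real n" using u n0 by simp
        moreover have i: "real i = of_int \<lfloor>u * real n\<rfloor>" using False u by (simp add: i_def)
        moreover have "of_int \<lfloor>u * real n\<rfloor> \<le> u * real n" "u * real n \<le> of_int \<lfloor>u * real n\<rfloor> + 1"
          by linarith+
        ultimately have "real i \<le> u * real n" "u * real n \<le> real i + 1" "real i < real n" by linarith+
        then show ?thesis using n0 by (simp add: field_simps)
      qed
      then have "x \<in> U i" unfolding U_def x by auto
      then show "x \<in> (\<Union>i. U i)" by blast
    qed
    have dist_le: "dist x y \<le> dist a b / real n" if "x \<in> U i" "y \<in> U i" for x y i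
    proof -
      from that obtain u v where uv: "u \<in> {real i / real n..(real i + 1) / real n}"
          "v \<in> {real i / real n..(real i + 1) / real n}"
          "x = a + u *\<^sub>R (b - a)" "y = a + v *\<^sub>R (b - a)"
        by (auto simp: U_def split: if_splits)
      then have "\<bar>u - v\<bar> \<le> 1 / real n" by (auto simp: abs_le_iff add_divide_distrib)
      moreover have "x - y = (u - v) *\<^sub>R (b - a)" unfolding uv(3,4) by (simp add: algebra_simps)
      then have "dist x y = \<bar>u - v\<bar> * dist a b" by (simp add: dist_norm norm_minus_commute)
      ultimately show ?thesis using mult_right_mono[of "\<bar>u - v\<bar>" "1 / real n" "dist a b"] by simp
    qed
    have diam: "diameter (U i) \<le> dist a b / real n" for i
      by (rule diameter_le) (use dist_le n0 in \<open>auto simp: dist_norm\<close>)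
    have bdd: "bounded (U i)" for i
      using dist_le unfolding bounded_two_points by blast
    have "hausdorff1_pre \<delta> (closed_segment a b) \<le> (\<Sum>i. ennreal (diameter (U i)))"
      by (rule hausdorff1_pre_le[OF cover]) (use bdd diam nd order_trans in blast)+
    also have "\<dots> = (\<Sum>i<n. ennreal (diameter (U i)))"
      by (rule suminf_finite) (auto simp: U_def)
    also have "\<dots> \<le> (\<Sum>i<n. ennreal (dist a b / real n))"
      by (intro sum_mono ennreal_leI diam)
    also have "\<dots> = ennreal (dist a b)"
      using n0 by (simp add: sum_ennreal ennreal_of_nat_eq_real_of_nat ennreal_mult[symmetric])
    finally show ?thesis .
  qed
  then have "hausdorff1_outer (closed_segment a b) \<le> ennreal (dist a b)"
    unfolding hausdorff1_outer_def by (intro SUP_least) auto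
  then show ?thesis by (subst emeasure_hausdorff1) (auto intro: borel_closed)
qed

text \<open>A measure of linear growth behaves like length on a line, for which the integral is of order \<open>1 / \<rho>\<close>.
  The integrand is dominated by a sum over dyadic balls of radius \<open>2\<^sup>k \<rho>\<close>, whose terms
  decay like \<open>(1/2)\<^sup>k\<close>.\<close>

lemma nn_integral_linear_growth_le:
  fixes \<Gamma> :: "'a::real_normed_vector set" and C M \<rho> :: real
  assumes \<Gamma> [measurable]: "\<Gamma> \<in> sets borel" and \<mu>: "sets \<mu> = sets borel"
    and growth: "\<And>r. 0 < r \<Longrightarrow> emeasure \<mu> (\<Gamma> \<inter> cball 0 r) \<le> ennreal (M * r)"
    and \<rho>: "0 < \<rho>" and C: "0 \<le> C" and M: "0 \<le> M"
  shows "(\<integral>\<^sup>+z\<in>\<Gamma>. ennreal (C / (\<rho>\<^sup>2 + (norm z)\<^sup>2)) \<partial>\<mu>) \<le> ennreal (8 * C * M / \<rho>)"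
proof -
  note [measurable_cong] = \<mu>
  define r where "r k = 2 ^ k * \<rho>" for k :: nat
  have [measurable]: "cball (0::'a) (r k) \<in> sets borel" for k by (intro borel_closed) simp
  have r: "0 < r k" for k using \<rho> by (simp add: r_def)
  have point: "ennreal (C / (\<rho>\<^sup>2 + (norm z)\<^sup>2)) * indicator \<Gamma> z
      \<le> (\<Sum>k. ennreal (4 * C / (r k)\<^sup>2) * indicator (\<Gamma> \<inter> cball 0 (r k)) z)" for z
  proof (cases "z \<in> \<Gamma>")
    case True
    obtain k0 where "norm z / \<rho> < 2 ^ k0" using real_arch_pow[of 2 "norm z / \<rho>"] by auto
    then have "norm z \<le> r k0" using \<rho> by (simp add: r_def field_simps)
    \<comment> \<open>The smallest dyadic ball containing \<open>z\<close>: its radius is at most twice the larger of \<open>\<rho>\<close> and \<open>\<bar>z\<bar>\<close>.\<close>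
    define k where "k = (LEAST k. norm z \<le> r k)"
    have k: "norm z \<le> r k" unfolding k_def by (rule LeastI) fact
    have "(r k)\<^sup>2 \<le> 4 * (\<rho>\<^sup>2 + (norm z)\<^sup>2)"
    proof (cases k)
      case 0
      then show ?thesis using zero_le_power2[of "norm z"] by (simp add: r_def)
    next
      case (Suc j)
      then have "\<not> norm z \<le> r j" unfolding k_def by (metis lessI not_less_Least)
      then have "r k \<le> 2 * norm z" using Suc by (simp add: r_def)
      then have "(r k)\<^sup>2 \<le> (2 * norm z)\<^sup>2" using r[of k] by (intro power_mono) auto
      then have "(r k)\<^sup>2 \<le> 4 * (norm z)\<^sup>2" by (simp add: power_mult_distrib)
      then show ?thesis using zero_le_power2[of \<rho>] unfolding distrib_left by linarith
    qed
    moreover have "0 < \<rho>\<^sup>2 + (norm z)\<^sup>2" using \<rho> by (intro add_pos_nonneg) auto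
    ultimately have "4 * C / (4 * (\<rho>\<^sup>2 + (norm z)\<^sup>2)) \<le> 4 * C / (r k)\<^sup>2"
      using r[of k] C by (intro divide_left_mono mult_pos_pos) auto
    then have "C / (\<rho>\<^sup>2 + (norm z)\<^sup>2) \<le> 4 * C / (r k)\<^sup>2"
      by (subst (asm) mult_divide_mult_cancel_left) auto
    then have "ennreal (C / (\<rho>\<^sup>2 + (norm z)\<^sup>2)) * indicator \<Gamma> z
        \<le> ennreal (4 * C / (r k)\<^sup>2) * indicator (\<Gamma> \<inter> cball 0 (r k)) z"
      using True k by (auto intro: ennreal_leI)
    also have "\<dots> \<le> (\<Sum>k. ennreal (4 * C / (r k)\<^sup>2) * indicator (\<Gamma> \<inter> cball 0 (r k)) z)"
    proof -
      have "f k \<le> (\<Sum>k. f k)" for f :: "nat \<Rightarrow> ennreal"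
        using sum_le_suminf[OF summableI, of "{k}" f] by simp
      then show ?thesis .
    qed
    finally show ?thesis .
  qed simp
  have "(\<integral>\<^sup>+z\<in>\<Gamma>. ennreal (C / (\<rho>\<^sup>2 + (norm z)\<^sup>2)) \<partial>\<mu>)
      \<le> (\<integral>\<^sup>+z. (\<Sum>k. ennreal (4 * C / (r k)\<^sup>2) * indicator (\<Gamma> \<inter> cball 0 (r k)) z) \<partial>\<mu>)"
    by (rule nn_integral_mono) (rule point)
  also have "\<dots> = (\<Sum>k. \<integral>\<^sup>+z. ennreal (4 * C / (r k)\<^sup>2) * indicator (\<Gamma> \<inter> cball 0 (r k)) z \<partial>\<mu>)"
    by (rule nn_integral_suminf) measurable
  also have "\<dots> = (\<Sum>k. ennreal (4 * C / (r k)\<^sup>2) * emeasure \<mu> (\<Gamma> \<inter> cball 0 (r k)))"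
    by (subst nn_integral_cmult_indicator) (auto simp: \<mu>)
  also have "\<dots> \<le> (\<Sum>k. ennreal (4 * C * M / \<rho> * (1/2) ^ k))"
  proof (intro suminf_le summableI)
    fix k
    have "ennreal (4 * C / (r k)\<^sup>2) * emeasure \<mu> (\<Gamma> \<inter> cball 0 (r k))
        \<le> ennreal (4 * C / (r k)\<^sup>2) * ennreal (M * r k)"
      by (intro mult_left_mono growth r) auto
    also have "\<dots> = ennreal (4 * C / (r k)\<^sup>2 * (M * r k))"
      using r[of k] C M by (subst ennreal_mult) auto
    also have "4 * C / (r k)\<^sup>2 * (M * r k) = 4 * C * M / \<rho> * (1/2) ^ k"
      using r[of k] \<rho> by (simp add: r_def power2_eq_square field_simps power_one_over)
    finally show "ennreal (4 * C / (r k)\<^sup>2) * emeasure \<mu> (\<Gamma> \<inter> cball 0 (r k))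
        \<le> ennreal (4 * C * M / \<rho> * (1/2) ^ k)" .
  qed
  also have "\<dots> = ennreal (4 * C * M / \<rho> * 2)"
  proof (rule suminf_ennreal_eq)
    have "(\<lambda>k. (1/2) ^ k) sums (1 / (1 - 1/2 :: real))" by (rule geometric_sums) simp
    from sums_mult[OF this, of "4 * C * M / \<rho>"] show "(\<lambda>k. 4 * C * M / \<rho> * (1/2) ^ k) sums (4 * C * M / \<rho> * 2)"
      by simp
  qed (use C M \<rho> in auto)
  also have "4 * C * M / \<rho> * 2 = 8 * C * M / \<rho>" by simp
  finally show ?thesis .
qed

context
  fixes \<theta> :: real
  assumes \<theta>: "0 < \<theta>" "\<theta> < pi"
begin

definition cone_triangle :: "complex set" where
  "cone_triangle = convex hull {0, cis (\<theta> / 2), cis (- (\<theta> / 2))}"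

lemma cos_half_angle: "0 < cos (\<theta> / 2)" "cos (\<theta> / 2) < 1"
proof -
  show "0 < cos (\<theta> / 2)" using \<theta> by (intro cos_gt_zero_pi) auto
  have "cos (\<theta> / 2) < cos 0" using \<theta> by (intro cos_monotone_0_pi) auto
  then show "cos (\<theta> / 2) < 1" by simp
qed

lemma sin_half_angle: "0 < sin (\<theta> / 2)"
  using \<theta> by (intro sin_gt_zero) auto

lemma cone_domain_triangle: "cone_domain \<theta> (interior cone_triangle)"
proof -
  have "cis (\<theta> / 2) \<bullet> cis (- (\<theta> / 2)) = cos (2 * (\<theta> / 2))"
    unfolding cos_double by (simp add: inner_complex_def power2_eq_square)
  then have "apex_angle 0 (cis (\<theta> / 2)) (cis (- (\<theta> / 2))) = \<theta>"
    using \<theta> by (simp add: apex_angle_def arccos_cos)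
  then show ?thesis
    unfolding cone_domain_def cone_triangle_def
    by (intro exI[of _ 0] exI[of _ "cis (\<theta> / 2)"] exI[of _ "cis (- (\<theta> / 2))"]) simp
qed

lemma interior_cone_triangle_subset:
  "interior cone_triangle \<subseteq> {z. 0 \<le> Re z \<and> Re z \<le> cos (\<theta> / 2) \<and> \<bar>Im z\<bar> \<le> Re z * tan (\<theta> / 2)}"
proof
  fix z assume "z \<in> interior cone_triangle"
  then have "z \<in> cone_triangle" using interior_subset by blast
  then obtain u v w where uvw: "0 \<le> u" "0 \<le> v" "0 \<le> w" "u + v + w = 1"
      "z = u *\<^sub>R 0 + v *\<^sub>R cis (\<theta> / 2) + w *\<^sub>R cis (- (\<theta> / 2))"
    unfolding cone_triangle_def convex_hull_3 by auto
  then have z: "Re z = (v + w) * cos (\<theta> / 2)" "Im z = (v - w) * sin (\<theta> / 2)"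
    by (auto simp: algebra_simps)
  have eq: "Re z * tan (\<theta> / 2) = (v + w) * sin (\<theta> / 2)"
    using cos_half_angle by (simp add: z tan_def)
  have "\<bar>Im z\<bar> \<le> Re z * tan (\<theta> / 2)"
  proof -
    have "\<bar>v - w\<bar> * sin (\<theta> / 2) \<le> (v + w) * sin (\<theta> / 2)"
      using sin_half_angle uvw by (intro mult_right_mono) auto
    then show ?thesis using sin_half_angle unfolding eq unfolding z(2) abs_mult by simp
  qed
  moreover have "(v + w) * cos (\<theta> / 2) \<le> 1 * cos (\<theta> / 2)"
    using cos_half_angle uvw by (intro mult_right_mono) auto
  moreover have "0 \<le> Re z" using cos_half_angle uvw z by simp
  ultimately show "z \<in> {z. 0 \<le> Re z \<and> Re z \<le> cos (\<theta> / 2) \<and> \<bar>Im z\<bar> \<le> Re z * tan (\<theta> / 2)}"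
    by (simp add: z(1)[symmetric])
qed

lemma axis_in_interior_cone_triangle:
  assumes "0 < \<rho>" "\<rho> < cos (\<theta> / 2)"
  shows "complex_of_real \<rho> \<in> interior cone_triangle"
  unfolding cone_triangle_def
proof (subst interior_of_triangle)
  have "\<rho> / cos (\<theta> / 2) \<le> 1" using assms cos_half_angle by simp
  moreover have "complex_of_real \<rho> = (1 - \<rho> / cos (\<theta> / 2)) *\<^sub>R 0
      + (\<rho> / (2 * cos (\<theta> / 2))) *\<^sub>R cis (\<theta> / 2) + (\<rho> / (2 * cos (\<theta> / 2))) *\<^sub>R cis (- (\<theta> / 2))"
    using cos_half_angle by (simp add: complex_eq_iff)
  ultimately have "complex_of_real \<rho> \<in> convex hull {0, cis (\<theta> / 2), cis (- (\<theta> / 2))}"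
    unfolding convex_hull_3 using assms cos_half_angle
    by (intro CollectI exI[of _ "1 - \<rho> / cos (\<theta> / 2)"] exI[of _ "\<rho> / (2 * cos (\<theta> / 2))"] conjI) auto
  moreover have "complex_of_real \<rho> \<notin> closed_segment 0 (cis (\<theta> / 2))"
    "complex_of_real \<rho> \<notin> closed_segment (cis (- (\<theta> / 2))) 0"
    "complex_of_real \<rho> \<notin> closed_segment (cis (\<theta> / 2)) (cis (- (\<theta> / 2)))"
    using assms sin_half_angle by (auto simp: closed_segment_def complex_eq_iff algebra_simps)
  ultimately show "complex_of_real \<rho> \<in> convex hull {0, cis (\<theta> / 2), cis (- (\<theta> / 2))} -
     (closed_segment 0 (cis (\<theta> / 2)) \<union> closed_segment (cis (\<theta> / 2)) (cis (- (\<theta> / 2))) \<union>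
      closed_segment (cis (- (\<theta> / 2))) 0)" by blast
qed simp

definition cone_boundary :: "complex set" where
  "cone_boundary = closed_segment 0 (cis (\<theta> / 2)) \<union> closed_segment 0 (cis (- (\<theta> / 2)))
     \<union> closed_segment (cis (\<theta> / 2)) (cis (- (\<theta> / 2)))"

lemma frontier_interior_cone_triangle: "frontier (interior cone_triangle) \<subseteq> cone_boundary"
proof -
  have "frontier (interior cone_triangle) \<subseteq> frontier cone_triangle"
    unfolding frontier_def by (simp add: closure_mono interior_subset Diff_mono)
  also have "\<dots> = cone_boundary"
    unfolding cone_triangle_def cone_boundary_def
    by (subst frontier_of_triangle) (auto simp: closed_segment_commute)
  finally show ?thesis .
qed

lemma cone_boundary_borel: "cone_boundary \<in> sets borel"
  unfolding cone_boundary_def by (intro borel_closed closed_Un) auto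

lemma cone_edge_points:
  assumes "z \<in> closed_segment 0 (cis \<phi>)"
  obtains t where "0 \<le> t" "t \<le> 1" "z = t *\<^sub>R cis \<phi>"
  using assms by (auto simp: closed_segment_def)

lemma cone_base_points:
  assumes "z \<in> closed_segment (cis (\<theta> / 2)) (cis (- (\<theta> / 2)))"
  shows "Re z = cos (\<theta> / 2)" "norm z \<le> 1"
proof -
  from assms obtain u where u: "0 \<le> u" "u \<le> 1" "z = (1 - u) *\<^sub>R cis (\<theta> / 2) + u *\<^sub>R cis (- (\<theta> / 2))"
    by (auto simp: closed_segment_def)
  show "Re z = cos (\<theta> / 2)" unfolding u(3) by (simp add: algebra_simps)
  have "norm z \<le> norm ((1 - u) *\<^sub>R cis (\<theta> / 2)) + norm (u *\<^sub>R cis (- (\<theta> / 2)))"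
    unfolding u(3) by (rule norm_triangle_ineq)
  then show "norm z \<le> 1" using u by simp
qed

lemma cone_boundary_growth:
  assumes r: "0 < r"
  shows "emeasure hausdorff1 (cone_boundary \<inter> cball 0 r) \<le> ennreal ((2 + 2 / cos (\<theta> / 2)) * r)"
proof -
  have edge: "emeasure hausdorff1 (closed_segment 0 (cis \<phi>) \<inter> cball 0 r) \<le> ennreal r" for \<phi>
  proof -
    have "closed_segment 0 (cis \<phi>) \<inter> cball 0 r \<subseteq> closed_segment 0 (r *\<^sub>R cis \<phi>)"
    proof
      fix z assume z: "z \<in> closed_segment 0 (cis \<phi>) \<inter> cball 0 r"
      then obtain t where t: "0 \<le> t" "z = t *\<^sub>R cis \<phi>" by (auto elim: cone_edge_points)
      with z have "t \<le> r" by (simp add: dist_norm)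
      then have "0 \<le> t / r" "t / r \<le> 1" "z = (t / r) *\<^sub>R (r *\<^sub>R cis \<phi>)" using t r by auto
      then show "z \<in> closed_segment 0 (r *\<^sub>R cis \<phi>)" unfolding closed_segment_def
        by (intro CollectI exI[of _ "t / r"] conjI) simp_all
    qed
    then have "emeasure hausdorff1 (closed_segment 0 (cis \<phi>) \<inter> cball 0 r)
        \<le> emeasure hausdorff1 (closed_segment 0 (r *\<^sub>R cis \<phi>))"
      by (rule emeasure_mono) (auto intro: borel_closed)
    also have "\<dots> \<le> ennreal (dist 0 (r *\<^sub>R cis \<phi>))" by (rule hausdorff1_closed_segment_le)
    also have "dist 0 (r *\<^sub>R cis \<phi>) = r" using r by simp
    finally show ?thesis .
  qed
  let ?b = "closed_segment (cis (\<theta> / 2)) (cis (- (\<theta> / 2)))"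
  have base: "emeasure hausdorff1 (?b \<inter> cball 0 r) \<le> ennreal (2 / cos (\<theta> / 2) * r)"
  proof (cases "r < cos (\<theta> / 2)")
    case True
    have "z \<notin> ?b \<inter> cball 0 r" for z
    proof
      assume "z \<in> ?b \<inter> cball 0 r"
      then have "Re z = cos (\<theta> / 2)" "norm z \<le> r" using cone_base_points by auto
      then show False using True abs_Re_le_cmod[of z] by linarith
    qed
    then have "?b \<inter> cball 0 r = {}" by blast
    then show ?thesis by simp
  next
    case False
    have "emeasure hausdorff1 (?b \<inter> cball 0 r) \<le> emeasure hausdorff1 ?b"
      by (rule emeasure_mono) (auto intro: borel_closed)
    also have "\<dots> \<le> ennreal (dist (cis (\<theta> / 2)) (cis (- (\<theta> / 2))))" by (rule hausdorff1_closed_segment_le)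
    also have "\<dots> \<le> ennreal (2 / cos (\<theta> / 2) * r)"
    proof (rule ennreal_leI)
      have "dist (cis (\<theta> / 2)) (cis (- (\<theta> / 2))) \<le> norm (cis (\<theta> / 2)) + norm (cis (- (\<theta> / 2)))"
        unfolding dist_norm by (rule norm_triangle_ineq4)
      also have "\<dots> \<le> 2 / cos (\<theta> / 2) * r" using False cos_half_angle by (simp add: field_simps)
      finally show "dist (cis (\<theta> / 2)) (cis (- (\<theta> / 2))) \<le> 2 / cos (\<theta> / 2) * r" .
    qed
    finally show ?thesis .
  qed
  have [measurable]: "closed_segment x y \<inter> cball 0 r \<in> sets hausdorff1" for x y :: complex
    by (auto intro: borel_closed)
  have "cone_boundary \<inter> cball 0 r = (closed_segment 0 (cis (\<theta> / 2)) \<inter> cball 0 r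
      \<union> closed_segment 0 (cis (- (\<theta> / 2))) \<inter> cball 0 r) \<union> ?b \<inter> cball 0 r"
    unfolding cone_boundary_def by blast
  then have "emeasure hausdorff1 (cone_boundary \<inter> cball 0 r)
      \<le> emeasure hausdorff1 (closed_segment 0 (cis (\<theta> / 2)) \<inter> cball 0 r
          \<union> closed_segment 0 (cis (- (\<theta> / 2))) \<inter> cball 0 r) + emeasure hausdorff1 (?b \<inter> cball 0 r)"
    by (simp add: emeasure_subadditive sets.Un)
  also have "\<dots> \<le> (emeasure hausdorff1 (closed_segment 0 (cis (\<theta> / 2)) \<inter> cball 0 r)
       + emeasure hausdorff1 (closed_segment 0 (cis (- (\<theta> / 2))) \<inter> cball 0 r))
       + emeasure hausdorff1 (?b \<inter> cball 0 r)"
    by (intro add_right_mono emeasure_subadditive) auto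
  also have "\<dots> \<le> (ennreal r + ennreal r) + ennreal (2 / cos (\<theta> / 2) * r)"
    by (intro add_mono edge base)
  also have "\<dots> = ennreal (r + r + 2 / cos (\<theta> / 2) * r)"
    using r cos_half_angle by (simp add: ennreal_plus[symmetric] del: ennreal_plus)
  also have "r + r + 2 / cos (\<theta> / 2) * r = (2 + 2 / cos (\<theta> / 2)) * r" by (simp add: algebra_simps)
  finally show ?thesis .
qed

text \<open>On the edges at the apex this is the law of cosines, as these edges meet the axis under the fixed angle
  \<open>\<theta> / 2\<close>. The base lies at height \<open>cos (\<theta> / 2)\<close>, hence at distance at least \<open>cos (\<theta> / 2) / 2\<close> from the centre.\<close>

lemma cone_boundary_distance:
  obtains m where "0 < m"
    "\<And>\<rho> z. \<lbrakk>0 < \<rho>; \<rho> \<le> cos (\<theta> / 2) / 2; z \<in> cone_boundary\<rbrakk> \<Longrightarrow> m * (\<rho>\<^sup>2 + (norm z)\<^sup>2) \<le> (norm (z - of_real \<rho>))\<^sup>2"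
proof
  define c where "c = cos (\<theta> / 2)"
  have c: "0 < c" "c < 1" using cos_half_angle by (auto simp: c_def)
  define m where "m = min (1 - c) (c\<^sup>2 / 8)"
  show "0 < m" using c by (simp add: m_def)
  fix \<rho> z assume \<rho>: "0 < \<rho>" "\<rho> \<le> cos (\<theta> / 2) / 2" and z: "z \<in> cone_boundary"
  have edge: "m * (\<rho>\<^sup>2 + (norm z)\<^sup>2) \<le> (norm (z - of_real \<rho>))\<^sup>2"
    if "z \<in> closed_segment 0 (cis \<phi>)" "cos \<phi> = c" for \<phi>
  proof -
    from that(1) obtain t where t: "0 \<le> t" "z = t *\<^sub>R cis \<phi>" by (auto elim: cone_edge_points)
    have "(norm (z - of_real \<rho>))\<^sup>2 = t\<^sup>2 * ((cos \<phi>)\<^sup>2 + (sin \<phi>)\<^sup>2) + \<rho>\<^sup>2 - 2 * t * \<rho> * cos \<phi>"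
    proof -
      have "(t * a - \<rho>)\<^sup>2 + (t * b)\<^sup>2 = t\<^sup>2 * (a\<^sup>2 + b\<^sup>2) + \<rho>\<^sup>2 - 2 * t * \<rho> * a" for a b
        by (simp add: power2_eq_square algebra_simps)
      from this[of "cos \<phi>" "sin \<phi>"] show ?thesis unfolding cmod_power2 t(2) by simp
    qed
    then have eq: "(norm (z - of_real \<rho>))\<^sup>2 = t\<^sup>2 + \<rho>\<^sup>2 - 2 * t * \<rho> * c"
      unfolding that(2)[symmetric] by simp
    have "0 \<le> c * (t - \<rho>)\<^sup>2" using c by simp
    then have "(1 - c) * (\<rho>\<^sup>2 + t\<^sup>2) \<le> (norm (z - of_real \<rho>))\<^sup>2"
      unfolding eq by (simp add: power2_eq_square algebra_simps)
    moreover have "m * (\<rho>\<^sup>2 + t\<^sup>2) \<le> (1 - c) * (\<rho>\<^sup>2 + t\<^sup>2)"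
      by (intro mult_right_mono) (auto simp: m_def)
    moreover have "norm z = t" using t by simp
    ultimately show ?thesis by simp
  qed
  have base: "m * (\<rho>\<^sup>2 + (norm z)\<^sup>2) \<le> (norm (z - of_real \<rho>))\<^sup>2"
    if "z \<in> closed_segment (cis (\<theta> / 2)) (cis (- (\<theta> / 2)))"
  proof -
    note b = cone_base_points[OF that, folded c_def]
    have "\<rho>\<^sup>2 \<le> 1\<^sup>2" "(norm z)\<^sup>2 \<le> 1\<^sup>2" using b(2) \<rho> c unfolding c_def[symmetric] by (intro power_mono; simp)+
    moreover have "m \<le> c\<^sup>2 / 8" unfolding m_def by (rule min.cobounded2)
    ultimately have "m * (\<rho>\<^sup>2 + (norm z)\<^sup>2) \<le> c\<^sup>2 / 8 * 2"
      by (intro mult_mono) auto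
    also have "\<dots> = (c / 2)\<^sup>2" by (simp add: power_divide)
    also have "\<dots> \<le> (norm (z - of_real \<rho>))\<^sup>2"
    proof (rule power_mono)
      have "c / 2 \<le> Re (z - of_real \<rho>)" using b(1) \<rho> unfolding c_def[symmetric] by simp
      also have "\<dots> \<le> norm (z - of_real \<rho>)" by (rule complex_Re_le_cmod)
      finally show "c / 2 \<le> norm (z - of_real \<rho>)" .
    qed (use c in simp)
    finally show ?thesis .
  qed
  show "m * (\<rho>\<^sup>2 + (norm z)\<^sup>2) \<le> (norm (z - of_real \<rho>))\<^sup>2"
    using z edge[of "\<theta> / 2"] edge[of "- (\<theta> / 2)"] base unfolding cone_boundary_def by (auto simp: c_def)
qed

end

section \<open>The vortex near the apex of the cone\<close>

text \<open>The logarithmic terms add up to \<open>\<pi> (1 - \<beta>) + \<beta> (\<theta> / 2 + \<eta> / 4) \<le> \<theta> / 2 + \<eta> / 2\<close> times \<open>\<bar>ln \<epsilon>\<bar>\<close>; the remaining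
  \<open>\<eta> / 2\<close> absorbs the constants.\<close>

lemma core_and_cone_energy_le_log:
  fixes \<epsilon> \<beta> \<Lambda> \<theta> K \<eta> :: real
  assumes \<epsilon>: "0 < \<epsilon>" "\<epsilon> < 1" and \<beta>: "0 < \<beta>" "\<beta> < 1" "pi * (1 - \<beta>) \<le> \<eta> / 4"
    and \<Lambda>: "1 < \<Lambda>" "\<theta> / 2 / (1 - 1 / \<Lambda>)\<^sup>2 = \<theta> / 2 + \<eta> / 4"
    and \<theta>: "0 < \<theta>" and \<eta>: "0 < \<eta>"
    and small: "pi * ln (3 * \<Lambda>) + K * pi\<^sup>2 \<le> \<eta> / 2 * \<bar>ln \<epsilon>\<bar>"
  defines "\<rho> \<equiv> \<epsilon> powr \<beta>"
  shows "pi * ln (1 + 2 * (\<Lambda> * \<rho> / \<epsilon>)) + \<theta> / 2 / (1 - 1 / \<Lambda>)\<^sup>2 * ln (1 / \<rho>) + K * pi\<^sup>2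
     \<le> (\<theta> / 2 + \<eta>) * \<bar>ln \<epsilon>\<bar>"
proof -
  define l where "l = \<bar>ln \<epsilon>\<bar>"
  have l: "ln \<epsilon> = - l" "0 < l" using \<epsilon> by (auto simp: l_def)
  have ratio: "\<rho> / \<epsilon> = \<epsilon> powr (\<beta> - 1)" using \<epsilon> by (simp add: \<rho>_def powr_diff)
  have "1 = \<epsilon> powr 0" using \<epsilon> by simp
  also have "\<dots> \<le> \<epsilon> powr (\<beta> - 1)" using \<epsilon> \<beta> by (intro powr_mono') auto
  finally have ge1: "1 \<le> \<rho> / \<epsilon>" unfolding ratio .
  have "1 * 1 \<le> \<Lambda> * (\<rho> / \<epsilon>)" using \<Lambda> ge1 by (intro mult_mono) auto
  then have "1 + 2 * (\<Lambda> * \<rho> / \<epsilon>) \<le> (3 * \<Lambda>) * (\<rho> / \<epsilon>)" by simp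
  moreover have "0 < \<Lambda> * (\<rho> / \<epsilon>)" using \<open>1 * 1 \<le> \<Lambda> * (\<rho> / \<epsilon>)\<close> by linarith
  ultimately have "ln (1 + 2 * (\<Lambda> * \<rho> / \<epsilon>)) \<le> ln ((3 * \<Lambda>) * (\<rho> / \<epsilon>))" by (intro ln_mono) auto
  also have "\<dots> = ln (3 * \<Lambda>) + ln (\<rho> / \<epsilon>)" using \<Lambda> ge1 by (intro ln_mult_pos) auto
  also have "ln (\<rho> / \<epsilon>) = (1 - \<beta>) * l" unfolding ratio using \<epsilon> by (simp add: ln_powr l algebra_simps)
  finally have "pi * ln (1 + 2 * (\<Lambda> * \<rho> / \<epsilon>)) \<le> pi * (ln (3 * \<Lambda>) + (1 - \<beta>) * l)"
    by (intro mult_left_mono) auto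
  moreover have "pi * (1 - \<beta>) * l \<le> \<eta> / 4 * l" using \<beta> l by (intro mult_right_mono) auto
  moreover have "ln (1 / \<rho>) = \<beta> * l" using \<epsilon> by (simp add: \<rho>_def ln_div ln_powr l)
  moreover have "(\<theta> / 2 + \<eta> / 4) * (\<beta> * l) \<le> (\<theta> / 2 + \<eta> / 4) * (1 * l)"
    using \<theta> \<eta> \<beta> l by (intro mult_left_mono mult_right_mono) auto
  ultimately show ?thesis using small unfolding \<Lambda>(2) l_def[symmetric] by (simp add: algebra_simps)
qed

context vortex_profile
begin

lemma GL_energy_vortex_le:
  assumes \<epsilon>: "0 < \<epsilon>" and \<rho>: "0 < \<rho>" and \<theta>: "0 < \<theta>" "\<theta> < pi" and \<Lambda>: "1 < \<Lambda>"
    and small: "\<Lambda> * \<rho> \<le> cos (\<theta> / 2)"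
  shows "GL_energy \<epsilon> (interior (cone_triangle \<theta>)) (vortex \<epsilon> (of_real \<rho>))
    \<le> ennreal (pi * ln (1 + 2 * (\<Lambda> * \<rho> / \<epsilon>)) + \<theta> / 2 / (1 - 1 / \<Lambda>)\<^sup>2 * ln (1 / \<rho>) + (C\<^sup>2 + 4) * pi\<^sup>2)"
proof -
  have "GL_energy \<epsilon> (interior (cone_triangle \<theta>)) (vortex \<epsilon> (of_real \<rho>))
      \<le> (\<integral>\<^sup>+z\<in>interior (cone_triangle \<theta>). ennreal (1/2 * (1 / (\<epsilon>\<^sup>2 + (norm (z - of_real \<rho>))\<^sup>2))
        + (C\<^sup>2 + 4) * (\<epsilon>\<^sup>2 / (\<epsilon>\<^sup>2 + (norm (z - of_real \<rho>))\<^sup>2)\<^sup>2)) \<partial>lborel)"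
    unfolding GL_energy_def
    by (intro nn_integral_mono mult_right_mono ennreal_leI energy_density_le[OF \<epsilon>]) auto
  also have "\<dots> \<le> ennreal (pi * ln (1 + 2 * (\<Lambda> * \<rho> / \<epsilon>)) + \<theta> / 2 / (1 - 1 / \<Lambda>)\<^sup>2 * ln (1 / \<rho>) + (C\<^sup>2 + 4) * pi\<^sup>2)"
    using interior_cone_triangle_subset[OF \<theta>] cos_half_angle[OF \<theta>] \<epsilon> \<rho> \<theta> \<Lambda> small
    by (intro cone_energy_bound[where c = "cos (\<theta> / 2)"]) auto
  finally show ?thesis .
qed

text \<open>The distance from the centre to a boundary point \<open>z\<close> is comparable to \<open>\<rho> + \<bar>z\<bar>\<close>, uniformly in \<open>\<rho>\<close>, so
  the boundary density is at most a multiple of \<open>1 / (\<rho>\<^sup>2 + \<bar>z\<bar>\<^sup>2)\<close>.\<close>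

lemma GL_boundary_energy_vortex_le:
  assumes \<theta>: "0 < \<theta>" "\<theta> < pi"
  obtains K where "0 \<le> K" "\<And>\<epsilon> \<rho>. \<lbrakk>0 < \<epsilon>; 0 < \<rho>; \<rho> \<le> cos (\<theta> / 2) / 2\<rbrakk> \<Longrightarrow>
    GL_boundary_energy \<epsilon> (interior (cone_triangle \<theta>)) (vortex \<epsilon> (of_real \<rho>)) \<le> ennreal (K / \<rho>)"
proof -
  obtain m where m: "0 < m" and dist: "\<And>\<rho> z. \<lbrakk>0 < \<rho>; \<rho> \<le> cos (\<theta> / 2) / 2; z \<in> cone_boundary \<theta>\<rbrakk>
      \<Longrightarrow> m * (\<rho>\<^sup>2 + (norm z)\<^sup>2) \<le> (norm (z - of_real \<rho>))\<^sup>2"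
    using cone_boundary_distance[OF \<theta>] by blast
  define \<Gamma> where "\<Gamma> = frontier (interior (cone_triangle \<theta>))"
  \<comment> \<open>At a corner there is no unit tangent, and the choice operator picks a vector that is the same for all
    such points. Its length enters the bound as a constant.\<close>
  define T where "T = max 1 (norm (SOME \<tau>::complex. False))"
  have tangent: "norm (SOME \<tau>. unit_tangent \<Gamma> x \<tau>) \<le> T" for x
  proof (cases "\<exists>\<tau>. unit_tangent \<Gamma> x \<tau>")
    case True
    then have "unit_tangent \<Gamma> x (SOME \<tau>. unit_tangent \<Gamma> x \<tau>)" by (rule someI_ex)
    then show ?thesis by (simp add: unit_tangent_def T_def)
  next
    case False
    then have "unit_tangent \<Gamma> x = (\<lambda>_. False)" by blast
    then show ?thesis by (simp add: T_def)
  qed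
  define D where "D = T\<^sup>2 * (4 + C\<^sup>2) + 4"
  have D: "0 \<le> D" by (simp add: D_def)
  define M where "M = 2 + 2 / cos (\<theta> / 2)"
  have M: "0 \<le> M" using cos_half_angle[OF \<theta>] by (simp add: M_def)
  show ?thesis
  proof (rule that[of "8 * (D / m) * M"])
    show "0 \<le> 8 * (D / m) * M" using D m M by simp
    fix \<epsilon> \<rho> :: real assume \<epsilon>: "0 < \<epsilon>" and \<rho>: "0 < \<rho>" "\<rho> \<le> cos (\<theta> / 2) / 2"
    have density: "1/2 * (norm (tangential_deriv \<Gamma> (vortex \<epsilon> (of_real \<rho>)) z))\<^sup>2
         + 1 / (4 * \<epsilon>\<^sup>2) * (1 - (norm (vortex \<epsilon> (of_real \<rho>) z))\<^sup>2)\<^sup>2 \<le> D / m / (\<rho>\<^sup>2 + (norm z)\<^sup>2)"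
      if z: "z \<in> cone_boundary \<theta>" for z
    proof -
      define b where "b = (SOME \<tau>. unit_tangent \<Gamma> z \<tau>)"
      have pos: "0 < m * (\<rho>\<^sup>2 + (norm z)\<^sup>2)" using m \<rho> by (intro mult_pos_pos add_pos_nonneg) auto
      also have le: "\<dots> \<le> \<epsilon>\<^sup>2 + (norm (z - of_real \<rho>))\<^sup>2"
        using dist[OF \<rho> z] zero_le_power2[of \<epsilon>] by linarith
      finally have pos': "0 < \<epsilon>\<^sup>2 + (norm (z - of_real \<rho>))\<^sup>2" .
      have "1/2 * (norm (tangential_deriv \<Gamma> (vortex \<epsilon> (of_real \<rho>)) z))\<^sup>2
         + 1 / (4 * \<epsilon>\<^sup>2) * (1 - (norm (vortex \<epsilon> (of_real \<rho>) z))\<^sup>2)\<^sup>2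
         \<le> ((norm b)\<^sup>2 * (4 + C\<^sup>2) + 4) / (\<epsilon>\<^sup>2 + (norm (z - of_real \<rho>))\<^sup>2)"
        unfolding tangential_deriv_def b_def by (rule boundary_density_le[OF \<epsilon>])
      also have "\<dots> \<le> D / (\<epsilon>\<^sup>2 + (norm (z - of_real \<rho>))\<^sup>2)"
        unfolding D_def b_def using pos'
        by (intro divide_right_mono add_mono mult_right_mono power_mono tangent) auto
      also have "\<dots> \<le> D / (m * (\<rho>\<^sup>2 + (norm z)\<^sup>2))"
        using le D mult_pos_pos[OF pos pos'] by (intro divide_left_mono) (auto simp: mult.commute)
      finally show ?thesis by simp
    qed
    have "GL_boundary_energy \<epsilon> (interior (cone_triangle \<theta>)) (vortex \<epsilon> (of_real \<rho>))
        \<le> (\<integral>\<^sup>+z\<in>cone_boundary \<theta>. ennreal (D / m / (\<rho>\<^sup>2 + (norm z)\<^sup>2)) \<partial>hausdorff1)"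
      unfolding GL_boundary_energy_def \<Gamma>_def[symmetric]
    proof (rule nn_integral_mono)
      fix z
      have "\<Gamma> \<subseteq> cone_boundary \<theta>" unfolding \<Gamma>_def by (rule frontier_interior_cone_triangle[OF \<theta>])
      then show "ennreal (1/2 * (norm (tangential_deriv \<Gamma> (vortex \<epsilon> (of_real \<rho>)) z))\<^sup>2
         + 1 / (4 * \<epsilon>\<^sup>2) * (1 - (norm (vortex \<epsilon> (of_real \<rho>) z))\<^sup>2)\<^sup>2) * indicator \<Gamma> z
         \<le> ennreal (D / m / (\<rho>\<^sup>2 + (norm z)\<^sup>2)) * indicator (cone_boundary \<theta>) z"
        using density[of z, THEN ennreal_leI] by (cases "z \<in> \<Gamma>") (auto simp: indicator_def)
    qed
    also have "\<dots> \<le> ennreal (8 * (D / m) * M / \<rho>)"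
      unfolding M_def
      using cone_boundary_borel[OF \<theta>] cone_boundary_growth[OF \<theta>] \<rho> D m M
      by (intro nn_integral_linear_growth_le) (auto simp: M_def)
    finally show "GL_boundary_energy \<epsilon> (interior (cone_triangle \<theta>)) (vortex \<epsilon> (of_real \<rho>))
        \<le> ennreal (8 * (D / m) * M / \<rho>)" .
  qed
qed

end

theorem proposition2:
  fixes \<theta>0 \<eta> :: real
  assumes "0 < \<theta>0" and "\<theta>0 < pi" and "0 < \<eta>"
  shows "\<exists>(\<Omega> :: complex set) (\<alpha> :: real) (u :: real \<Rightarrow> complex \<Rightarrow> complex)
           (g :: real \<Rightarrow> complex \<Rightarrow> complex) (P :: real \<Rightarrow> complex).
     cone_domain \<theta>0 \<Omega> \<and> 0 < \<alpha> \<and> \<alpha> < 1 \<and>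
     (\<forall>\<^sub>F \<epsilon> in at_right 0. GL_solution \<epsilon> \<Omega> (g \<epsilon>) (u \<epsilon>)) \<and>
     (\<forall>\<^sub>F \<epsilon> in at_right 0. degree_one_vortex \<Omega> (u \<epsilon>) (P \<epsilon>)) \<and>
     (\<forall>\<^sub>F \<epsilon> in at_right 0. GL_energy \<epsilon> \<Omega> (u \<epsilon>) \<le> ennreal ((\<theta>0 / 2 + \<eta>) * \<bar>ln \<epsilon>\<bar>)) \<and>
     ((\<lambda>\<epsilon>. ennreal (\<epsilon> powr \<alpha>) * GL_boundary_energy \<epsilon> \<Omega> (g \<epsilon>)) \<longlongrightarrow> 0) (at_right 0)"
proof -
  note \<theta> = assms(1,2)
  obtain q q' q'' where profile:
    "\<And>t. 0 \<le> t \<Longrightarrow> (q has_real_derivative q' t) (at t within {0..})"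
    "\<And>t. 0 \<le> t \<Longrightarrow> (q' has_real_derivative q'' t) (at t within {0..})"
    "continuous_on {0..} q''"
    "\<And>t. 0 \<le> t \<Longrightarrow> 4 * (t * q'' t + 2 * q' t) + q t * (1 - t * (q t)\<^sup>2) = 0"
    "\<And>t. 0 \<le> t \<Longrightarrow> barrier 4 t \<le> q t" "\<And>t. 0 \<le> t \<Longrightarrow> q t \<le> barrier 1 t"
    using vortex_profile_exists by metis
  obtain C where decay: "\<And>t. 0 \<le> t \<Longrightarrow> \<bar>q t + 2 * t * q' t\<bar> \<le> C / (1 + t)"
    using radial_derivative_decay[OF profile(1,2,4,5,6)] by metis
  interpret vortex_profile q q' q'' C
    by unfold_locales (fact profile decay)+
  define \<Omega> where "\<Omega> = interior (cone_triangle \<theta>0)"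
  define c where "c = cos (\<theta>0 / 2)"
  have c: "0 < c" using cos_half_angle[OF \<theta>] by (simp add: c_def)
  \<comment> \<open>Close enough to \<open>1\<close> for the disc around the vortex to cost at most \<open>\<eta> / 4 * \<bar>ln \<epsilon>\<bar>\<close>.\<close>
  define \<beta> where "\<beta> = 1 - min (1/2) (\<eta> / (4 * pi))"
  have \<beta>: "0 < \<beta>" "\<beta> < 1" using assms(3) by (auto simp: \<beta>_def min_def)
  have "1 - \<beta> \<le> \<eta> / (4 * pi)" by (simp add: \<beta>_def)
  then have \<beta>': "pi * (1 - \<beta>) \<le> \<eta> / 4" by (simp add: field_simps)
  \<comment> \<open>\<open>\<kappa>\<close> is the admissible loss in moving the vortex to the apex; \<open>\<Lambda>\<close> is the solution of
    \<open>1 / (1 - 1 / \<Lambda>)\<^sup>2 = \<kappa>\<close>.\<close>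
  define \<kappa> where "\<kappa> = 1 + \<eta> / (2 * \<theta>0)"
  have \<kappa>: "1 < \<kappa>" using assms by (simp add: \<kappa>_def)
  define \<Lambda> where "\<Lambda> = 1 / (1 - 1 / sqrt \<kappa>)"
  have "1 < sqrt \<kappa>" using \<kappa> by simp
  then have s: "0 < 1 / sqrt \<kappa>" "1 / sqrt \<kappa> < 1" by auto
  then have \<Lambda>: "1 < \<Lambda>" by (simp add: \<Lambda>_def)
  have "1 / (1 - 1 / \<Lambda>)\<^sup>2 = \<kappa>" using \<kappa> by (simp add: \<Lambda>_def power_divide)
  then have "\<theta>0 / 2 / (1 - 1 / \<Lambda>)\<^sup>2 = \<theta>0 / 2 * \<kappa>" by (metis times_divide_eq_right mult_1_right)
  also have "\<dots> = \<theta>0 / 2 + \<eta> / 4" using assms by (simp add: \<kappa>_def field_simps)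
  finally have \<Lambda>': "\<theta>0 / 2 / (1 - 1 / \<Lambda>)\<^sup>2 = \<theta>0 / 2 + \<eta> / 4" .
  define \<rho> where "\<rho> \<epsilon> = \<epsilon> powr \<beta>" for \<epsilon> :: real
  define u where "u \<epsilon> = vortex \<epsilon> (of_real (\<rho> \<epsilon>))" for \<epsilon>
  have "(\<rho> \<longlongrightarrow> 0) (at_right 0)"
    unfolding \<rho>_def using \<beta> by real_asymp
  then have ev_\<rho>: "\<forall>\<^sub>F \<epsilon> in at_right 0. \<rho> \<epsilon> < min (c / 2) (c / \<Lambda>)"
    by (rule order_tendstoD) (use c \<Lambda> in auto)
  have ev_01: "\<forall>\<^sub>F \<epsilon> in at_right (0::real). 0 < \<epsilon> \<and> \<epsilon> < 1"
    using eventually_at_right_real[of 0 "1::real"] by simp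
  define A where "A = (pi * ln (3 * \<Lambda>) + (C\<^sup>2 + 4) * pi\<^sup>2) / (\<eta> / 2)"
  have ev_ln: "\<forall>\<^sub>F \<epsilon> in at_right (0::real). A \<le> \<bar>ln \<epsilon>\<bar>"
  proof -
    have "\<forall>\<^sub>F \<epsilon> in at_right (0::real). ln \<epsilon> \<le> - A"
      using ln_at_0 by (simp add: filterlim_at_bot)
    then show ?thesis by eventually_elim auto
  qed
  have solution: "\<forall>\<^sub>F \<epsilon> in at_right 0. GL_solution \<epsilon> \<Omega> (u \<epsilon>) (u \<epsilon>)"
    using ev_01 by eventually_elim (auto simp: u_def intro: GL_solution_vortex)
  have degree: "\<forall>\<^sub>F \<epsilon> in at_right 0. degree_one_vortex \<Omega> (u \<epsilon>) (of_real (\<rho> \<epsilon>))"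
    using ev_01 ev_\<rho>
  proof eventually_elim
    case (elim \<epsilon>)
    then have "0 < \<rho> \<epsilon>" "\<rho> \<epsilon> < cos (\<theta>0 / 2)" using c by (auto simp: \<rho>_def c_def)
    then have "complex_of_real (\<rho> \<epsilon>) \<in> \<Omega>"
      unfolding \<Omega>_def by (rule axis_in_interior_cone_triangle[OF \<theta>])
    then obtain r where "0 < r" "ball (complex_of_real (\<rho> \<epsilon>)) r \<subseteq> \<Omega>"
      using open_contains_ball[of \<Omega>] unfolding \<Omega>_def by auto
    then show ?case unfolding u_def using elim by (intro degree_one_vortex_vortex) auto
  qed
  have energy: "\<forall>\<^sub>F \<epsilon> in at_right 0. GL_energy \<epsilon> \<Omega> (u \<epsilon>) \<le> ennreal ((\<theta>0 / 2 + \<eta>) * \<bar>ln \<epsilon>\<bar>)"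
    using ev_01 ev_\<rho> ev_ln
  proof eventually_elim
    case (elim \<epsilon>)
    have "GL_energy \<epsilon> \<Omega> (u \<epsilon>) \<le> ennreal (pi * ln (1 + 2 * (\<Lambda> * \<rho> \<epsilon> / \<epsilon>))
        + \<theta>0 / 2 / (1 - 1 / \<Lambda>)\<^sup>2 * ln (1 / \<rho> \<epsilon>) + (C\<^sup>2 + 4) * pi\<^sup>2)"
      unfolding \<Omega>_def u_def
    proof (rule GL_energy_vortex_le[OF _ _ \<theta> \<Lambda>])
      show "\<Lambda> * \<rho> \<epsilon> \<le> cos (\<theta>0 / 2)" using elim \<Lambda> by (simp add: c_def field_simps)
    qed (use elim in \<open>auto simp: \<rho>_def\<close>)
    also have "\<dots> \<le> ennreal ((\<theta>0 / 2 + \<eta>) * \<bar>ln \<epsilon>\<bar>)"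
      unfolding \<rho>_def
    proof (intro ennreal_leI core_and_cone_energy_le_log \<beta> \<beta>' \<Lambda> \<Lambda>' assms)
      show "pi * ln (3 * \<Lambda>) + (C\<^sup>2 + 4) * pi\<^sup>2 \<le> \<eta> / 2 * \<bar>ln \<epsilon>\<bar>"
        using elim(3) assms(3) unfolding A_def by (simp add: field_simps)
    qed (use elim in auto)
    finally show ?case .
  qed
  define \<alpha> where "\<alpha> = (1 + \<beta>) / 2"
  have \<alpha>: "0 < \<alpha>" "\<alpha> < 1" "0 < \<alpha> - \<beta>" using \<beta> by (auto simp: \<alpha>_def)
  obtain K where K: "0 \<le> K" "\<And>\<epsilon> \<rho>. \<lbrakk>0 < \<epsilon>; 0 < \<rho>; \<rho> \<le> cos (\<theta>0 / 2) / 2\<rbrakk> \<Longrightarrow>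
    GL_boundary_energy \<epsilon> (interior (cone_triangle \<theta>0)) (vortex \<epsilon> (of_real \<rho>)) \<le> ennreal (K / \<rho>)"
    using GL_boundary_energy_vortex_le[OF \<theta>] by blast
  have boundary: "((\<lambda>\<epsilon>. ennreal (\<epsilon> powr \<alpha>) * GL_boundary_energy \<epsilon> \<Omega> (u \<epsilon>)) \<longlongrightarrow> 0) (at_right 0)"
  proof (rule tendsto_sandwich)
    show "\<forall>\<^sub>F \<epsilon> in at_right 0. 0 \<le> ennreal (\<epsilon> powr \<alpha>) * GL_boundary_energy \<epsilon> \<Omega> (u \<epsilon>)" by simp
    show "((\<lambda>_. 0 :: ennreal) \<longlongrightarrow> 0) (at_right (0::real))" by simp
    show "\<forall>\<^sub>F \<epsilon> in at_right 0. ennreal (\<epsilon> powr \<alpha>) * GL_boundary_energy \<epsilon> \<Omega> (u \<epsilon>) \<le> ennreal (K * \<epsilon> powr (\<alpha> - \<beta>))"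
      using ev_01 ev_\<rho>
    proof eventually_elim
      case (elim \<epsilon>)
      have "ennreal (\<epsilon> powr \<alpha>) * GL_boundary_energy \<epsilon> \<Omega> (u \<epsilon>) \<le> ennreal (\<epsilon> powr \<alpha>) * ennreal (K / \<rho> \<epsilon>)"
        unfolding \<Omega>_def u_def using elim by (intro mult_left_mono K) (auto simp: \<rho>_def c_def)
      also have "\<dots> = ennreal (\<epsilon> powr \<alpha> * (K / \<rho> \<epsilon>))" by (rule ennreal_mult'[symmetric]) simp
      also have "\<epsilon> powr \<alpha> * (K / \<rho> \<epsilon>) = K * \<epsilon> powr (\<alpha> - \<beta>)" by (simp add: \<rho>_def powr_diff)
      finally show ?case .
    qed
    have "((\<lambda>\<epsilon>. K * \<epsilon> powr (\<alpha> - \<beta>)) \<longlongrightarrow> 0) (at_right 0)" using \<alpha>(3) by real_asymp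
    then have "((\<lambda>\<epsilon>. ennreal (K * \<epsilon> powr (\<alpha> - \<beta>))) \<longlongrightarrow> ennreal 0) (at_right 0)" by (rule tendsto_ennrealI)
    then show "((\<lambda>\<epsilon>. ennreal (K * \<epsilon> powr (\<alpha> - \<beta>))) \<longlongrightarrow> 0) (at_right 0)" by simp
  qed
  have "cone_domain \<theta>0 \<Omega>" unfolding \<Omega>_def by (rule cone_domain_triangle[OF \<theta>])
  then show ?thesis
    using \<alpha>(1,2) solution degree energy boundary
    by (intro exI[of _ \<Omega>] exI[of _ \<alpha>] exI[of _ u] exI[of _ "\<lambda>\<epsilon>. of_real (\<rho> \<epsilon>)"] conjI)
qed

end
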